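(* For every $\varepsilon>0$ there exists an $n_0=n_0(\varepsilon)$ such that if $G$ is a simple connected graph with $n\geqslant n_0$ vertices and less than $\binom{n}{2}-\left(\frac{1}{4}+\varepsilon\right)n$ edges, then $$Q(G)> Q(K_n).$$
   Context: All graphs are finite. For a connected graph $G=(V,E)$, $F(G)$ denotes the number of spanning forests of $G$, that is, the number of edge subsets $A\subseteq E$ containing no cycle (the empty set included), $T(G)$ denotes the number of spanning trees of $G$, and $Q(G)=\frac{F(G)}{T(G)}$. $K_n$ is the complete graph on $n$ vertices. *)

theory Defs
  imports Complex_Main
begin

locale simple_graph =
  fixes V :: "'a set" and E :: "'a set set"
  assumes finite_vertices: "finite V"
    and edges_wf: "e \<in> E \<Longrightarrow> e \<subseteq> V \<and> card e = 2"

definition connected_graph :: "'a set \<Rightarrow> 'a set set \<Rightarrow> bool" where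
  "connected_graph V A \<longleftrightarrow> V \<noteq> {} \<and> (\<forall>u\<in>V. \<forall>v\<in>V. (u, v) \<in> {(x, y). {x, y} \<in> A}\<^sup>*)"

(* A cycle is given by the list of its vertices in cyclic order, the first one not repeated at
   the end.  The bound 3 rules out going back and forth along a single edge. *)
definition is_cycle :: "'a set set \<Rightarrow> 'a list \<Rightarrow> bool" where
  "is_cycle A p \<longleftrightarrow> 3 \<le> length p \<and> distinct p \<and>
     (\<forall>i<length p. {p ! i, p ! (Suc i mod length p)} \<in> A)"

definition cycle_free :: "'a set set \<Rightarrow> bool" where
  "cycle_free A \<longleftrightarrow> (\<nexists>p. is_cycle A p)"

(* Spanning forests and trees of (V, E) are identified with their edge sets, the vertex set
   always being V.  In particular a spanning forest need not be connected or maximal. *)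
definition spanning_forests :: "'a set set \<Rightarrow> 'a set set set" where
  "spanning_forests E = {A. A \<subseteq> E \<and> cycle_free A}"

definition spanning_trees :: "'a set \<Rightarrow> 'a set set \<Rightarrow> 'a set set set" where
  "spanning_trees V E = {A. A \<subseteq> E \<and> cycle_free A \<and> connected_graph V A}"

definition forest_tree_ratio :: "'a set \<Rightarrow> 'a set set \<Rightarrow> real" where
  "forest_tree_ratio V E = real (card (spanning_forests E)) / real (card (spanning_trees V E))"

definition complete_edges :: "'a set \<Rightarrow> 'a set set" where
  "complete_edges V = {e. e \<subseteq> V \<and> card e = 2}"

end

(*
  Lower bound.  Let T be the number of spanning trees, S the number of spanning forests with two
  components divided by T, and c(F) the number of edges between the two components of F.  Basis
  exchange bounds the number of trees containing a subset A of a tree X by the product of the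
  c(X - e) over e in X - A; counting pairs (A, X) then gives Q >= E prod (1 + 1 / c(X - e)) for a
  uniformly random tree X, and Jensen's inequality gives ln Q >= S - (1/T) sum 1 / (2 c(F)).
  Electrical network theory gives the identity S = 3 rho + (1/4) sum R_e^2, where R_e are effective
  resistances and rho is the squared circumradius of the vertices in the Euclidean embedding with
  squared distances R.  Since the R_e sum to n - 1, Cauchy-Schwarz yields
  S >= 3 rho + (n - 1)^2 / (4 m), and 1 / c(F) <= 4 rho, rho >= (n - 1) / n^2.  Altogether
  ln Q >= 1/2 + (9/4 + D/n - o(1)) / n for D missing edges, up to cases with a larger gain.
  Upper bound.  With Abel's identities, the number of forests of K_n is the Gaussian expectation of
  y (y + n)^(n-1) at y = 1 + iZ, whence Q(K_n) = sqrt e (1 + (5/2 + o(1)) / n).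
*)
theory Submission
  imports Defs "HOL-Analysis.Analysis" "HOL-Computational_Algebra.Polynomial"
begin

section \<open>Components and cycles\<close>

text \<open>The bound Q >= 1 + S cannot suffice, since S is near 1/2 and 3/2 < sqrt e: the
  exponential must be recovered, with exact terms of order 1/n. The 9/4 is 3 - 1/2 - 1/4: 3 rho is
  at least about 3/n, (n - 1)^2 / (4 m) gives at least 1/2 - 1/(2n) + D/n^2, and the loss sum is
  about S/(2n), that is 1/(4n). For K_n the bounds on S are equalities, so the 1/4 = 5/2 - 9/4 of
  the theorem is the loss at K_n itself, which D/n has to outweigh. The loss is the delicate term.
  Using 1 / c(F) <= 4 rho for every F costs about 1/n instead of 1/(4n), which is affordable only if
  rho, S or D leaves a surplus. Otherwise a cut with clearly fewer than n edges must isolate a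
  vertex of low degree, and such forests are few. The identity for S rests on Euler's relation: the
  component avoiding a root is a tree, so 1 is its number of vertices minus its number of edges, and
  both numbers sum to Green functions.\<close>

definition reach :: "'a set set \<Rightarrow> 'a \<Rightarrow> 'a \<Rightarrow> bool" where
  "reach A x y \<longleftrightarrow> (x, y) \<in> {(x, y). {x, y} \<in> A}\<^sup>*"

lemma connected_graph_reach:
  "connected_graph V A \<longleftrightarrow> V \<noteq> {} \<and> (\<forall>u\<in>V. \<forall>v\<in>V. reach A u v)"
  by (simp add: connected_graph_def reach_def)

lemma reach_refl [simp]: "reach A x x"
  by (simp add: reach_def)

lemma reach_trans: "reach A x y \<Longrightarrow> reach A y z \<Longrightarrow> reach A x z"
  unfolding reach_def by (rule rtrancl_trans)

lemma reach_edge: "{x, y} \<in> A \<Longrightarrow> reach A x y"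
  unfolding reach_def by auto

lemma reach_sym: "reach A x y \<Longrightarrow> reach A y x"
proof -
  have "sym {(x, y). {x, y} \<in> A}"
    by (auto simp: sym_def insert_commute)
  then show "reach A x y \<Longrightarrow> reach A y x"
    unfolding reach_def by (meson sym_rtrancl symD)
qed

lemma reach_commute: "reach A x y \<longleftrightarrow> reach A y x"
  by (intro iffI; rule reach_sym)

definition component :: "'a set set \<Rightarrow> 'a \<Rightarrow> 'a set" where
  "component A x = {y. reach A x y}"

text \<open>Rewriting with it makes \<open>reach\<close> an equality of sets, so that simp and auto
  carry out arguments by symmetry and transitivity.\<close>

lemma reach_iff_eq: "reach A x y \<longleftrightarrow> component A x = component A y"
proof
  assume xy: "reach A x y"
  have "reach A x z \<longleftrightarrow> reach A y z" for z
  proof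
    assume "reach A x z"
    with reach_sym[OF xy] show "reach A y z" by (rule reach_trans)
  next
    assume "reach A y z"
    with xy show "reach A x z" by (rule reach_trans)
  qed
  then show "component A x = component A y" by (simp add: component_def)
next
  assume "component A x = component A y"
  then have "y \<in> component A x" by (simp add: component_def)
  then show "reach A x y" by (simp add: component_def)
qed

lemma reach_mono:
  assumes "reach A x y" "A \<subseteq> B"
  shows "reach B x y"
proof -
  have "{(x, y). {x, y} \<in> A} \<subseteq> {(x, y). {x, y} \<in> B}" using assms(2) by auto
  from rtrancl_mono[OF this] show ?thesis using assms(1) by (auto simp: reach_def)
qed

lemma reach_induct [consumes 1, case_names refl step]:
  assumes "reach A x y" "P x"
    and "\<And>y z. reach A x y \<Longrightarrow> P y \<Longrightarrow> {y, z} \<in> A \<Longrightarrow> P z"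
  shows "P y"
  using assms(1) unfolding reach_def
proof (induction rule: rtrancl_induct)
  case base
  then show ?case using assms(2) .
next
  case (step y z)
  show ?case
  proof (rule assms(3))
    show "reach A x y" using step.hyps(1) by (simp add: reach_def)
    show "P y" by (rule step.IH)
    show "{y, z} \<in> A" using step.hyps(2) by simp
  qed
qed

lemma reach_empty [simp]: "reach {} x y \<longleftrightarrow> x = y"
proof
  assume "reach {} x y"
  then show "x = y" by (induction rule: reach_induct) auto
qed simp

text \<open>After a second crossing of the new edge the walk stands at an end that it has visited
  before, so one crossing is enough.\<close>

lemma reach_insert:
  "reach (insert {x, y} A) u v \<longleftrightarrow>
     reach A u v \<or> reach A u x \<and> reach A y v \<or> reach A u y \<and> reach A x v" (is "?L \<longleftrightarrow> ?R")
proof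
  assume ?L
  then show ?R
  proof (induction rule: reach_induct)
    case refl
    then show ?case by simp
  next
    case (step w z)
    show ?case
    proof (cases "{w, z} \<in> A")
      case True
      then have "reach A w z" by (rule reach_edge)
      with step.IH show ?thesis by (auto simp: reach_iff_eq)
    next
      case False
      with step.hyps have "w = x \<and> z = y \<or> w = y \<and> z = x"
        by (auto simp: doubleton_eq_iff)
      then show ?thesis
      proof (elim disjE conjE)
        assume "w = x" "z = y"
        then show ?thesis using step.IH by (auto simp: reach_iff_eq)
      next
        assume "w = y" "z = x"
        then show ?thesis using step.IH by (auto simp: reach_iff_eq)
      qed
    qed
  qed
next
  have e: "reach (insert {x, y} A) x y" by (rule reach_edge) simp
  have m: "reach A p q \<Longrightarrow> reach (insert {x, y} A) p q" for p q
    by (erule reach_mono) auto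
  assume ?R
  then consider "reach A u v" | "reach A u x" "reach A y v" | "reach A u y" "reach A x v"
    by blast
  then show ?L
  proof cases
    case 1
    then show ?thesis by (rule m)
  next
    case 2
    then show ?thesis using m[of u x] m[of y v] e by (simp add: reach_iff_eq)
  next
    case 3
    then show ?thesis using m[of u y] m[of x v] e by (simp add: reach_iff_eq)
  qed
qed

text \<open>A walk avoiding the edge between its ends closes up to a cycle only if it repeats no vertex.\<close>

lemma reach_imp_path:
  assumes "reach A x y"
  shows "\<exists>p. distinct p \<and> p \<noteq> [] \<and> hd p = x \<and> last p = y \<and>
    (\<forall>i. Suc i < length p \<longrightarrow> {p ! i, p ! Suc i} \<in> A)"
  using assms
proof (induction rule: reach_induct)
  case refl
  show ?case by (rule exI[of _ "[x]"]) auto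
next
  case (step y z)
  then obtain p where p: "distinct p" "p \<noteq> []" "hd p = x" "last p = y"
    "\<And>i. Suc i < length p \<Longrightarrow> {p ! i, p ! Suc i} \<in> A"
    by blast
  show ?case
  proof (cases "z \<in> set p")
    case True
    then obtain k where k: "k < length p" "p ! k = z"
      by (auto simp: in_set_conv_nth)
    \<comment> \<open>If \<open>z\<close> is already on the path, the path is cut back to that
      visit, so no vertex repeats.\<close>
    let ?q = "take (Suc k) p"
    have "last ?q = z"
      using k by (simp add: take_Suc_conv_app_nth)
    moreover have "hd ?q = x" using p by (cases p) auto
    moreover have "distinct ?q" "?q \<noteq> []" using p by auto
    moreover have "\<forall>i. Suc i < length ?q \<longrightarrow> {?q ! i, ?q ! Suc i} \<in> A"
      using p(5) by auto
    ultimately show ?thesis by blast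
  next
    case False
    have "{(p @ [z]) ! i, (p @ [z]) ! Suc i} \<in> A" if "Suc i < length (p @ [z])" for i
    proof (cases "Suc i < length p")
      case True
      then show ?thesis using p(5)[of i] by (simp add: nth_append)
    next
      case False
      with that have i: "i = length p - 1" "Suc i = length p" by auto
      then have "(p @ [z]) ! i = y" "(p @ [z]) ! Suc i = z"
        using p by (auto simp: nth_append last_conv_nth)
      then show ?thesis using step.hyps(2) by simp
    qed
    moreover have "distinct (p @ [z])" "hd (p @ [z]) = x" "last (p @ [z]) = z"
      using p False by auto
    ultimately show ?thesis by (intro exI[of _ "p @ [z]"]) auto
  qed
qed

lemma reach_path:
  assumes "i \<le> j" "j < length p" "\<And>l. i \<le> l \<Longrightarrow> l < j \<Longrightarrow> {p ! l, p ! Suc l} \<in> A"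
  shows "reach A (p ! i) (p ! j)"
  using assms
proof (induction j)
  case 0
  then show ?case by simp
next
  case (Suc j)
  show ?case
  proof (cases "i = Suc j")
    case True
    then show ?thesis by simp
  next
    case False
    then have "reach A (p ! i) (p ! j)" using Suc by auto
    moreover have "reach A (p ! j) (p ! Suc j)"
      using Suc.prems False by (intro reach_edge) auto
    ultimately show ?thesis by (rule reach_trans)
  qed
qed

text \<open>The bridge criterion replaces cyclic vertex lists, which behave badly when edges are
  inserted or deleted.\<close>

lemma cycle_free_iff:
  "cycle_free A \<longleftrightarrow> (\<forall>x y. x \<noteq> y \<longrightarrow> {x, y} \<in> A \<longrightarrow> \<not> reach (A - {{x, y}}) x y)"
proof (intro iffI allI impI notI)
  fix x y assume cf: "cycle_free A" and xy: "x \<noteq> y" "{x, y} \<in> A" and r: "reach (A - {{x, y}}) x y"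
  from r obtain p where p: "distinct p" "p \<noteq> []" "hd p = x" "last p = y"
    "\<And>i. Suc i < length p \<Longrightarrow> {p ! i, p ! Suc i} \<in> A - {{x, y}}"
    by (meson reach_imp_path)
  have 0: "p ! 0 = x" "p ! (length p - 1) = y"
    using p by (auto simp: hd_conv_nth last_conv_nth)
  have "length p \<noteq> 0" "length p \<noteq> 1" using p(2) 0 xy by auto
  \<comment> \<open>A path with two vertices would be the removed edge itself; this yields the bound
    3 in \<open>is_cycle\<close>.\<close>
  moreover have "length p \<noteq> 2"
  proof
    assume "length p = 2"
    then show False using p(5)[of 0] 0 by auto
  qed
  ultimately have 3: "3 \<le> length p" by linarith
  have "{p ! i, p ! (Suc i mod length p)} \<in> A" if i: "i < length p" for i
  proof (cases "Suc i < length p")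
    case True
    then show ?thesis using p(5)[of i] by auto
  next
    case False
    with i have "i = length p - 1" "Suc i = length p" by auto
    then show ?thesis using 0 xy by (auto simp: insert_commute)
  qed
  then have "is_cycle A p" using 3 p by (auto simp: is_cycle_def)
  with cf show False by (auto simp: cycle_free_def)
next
  assume *: "\<forall>x y. x \<noteq> y \<longrightarrow> {x, y} \<in> A \<longrightarrow> \<not> reach (A - {{x, y}}) x y"
  show "cycle_free A"
    unfolding cycle_free_def
  proof
    assume "\<exists>p. is_cycle A p"
    then obtain p where p: "3 \<le> length p" "distinct p"
      "\<And>i. i < length p \<Longrightarrow> {p ! i, p ! (Suc i mod length p)} \<in> A"
      by (auto simp: is_cycle_def)
    define k where "k = length p - 1"
    have k: "Suc k = length p" "2 \<le> k" using p by (auto simp: k_def)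
    let ?x = "p ! 0" and ?y = "p ! k"
    have inj: "p ! i = p ! j \<longleftrightarrow> i = j" if "i \<le> k" "j \<le> k" for i j
      using that k by (intro nth_eq_iff_index_eq p(2)) auto
    have ne: "?x \<noteq> ?y" using k by (simp add: inj)
    have e: "{?x, ?y} \<in> A" using p(3)[of k] k by (simp add: insert_commute)
    have "reach (A - {{?x, ?y}}) (p ! 0) (p ! k)"
    proof (rule reach_path)
      fix l assume l: "0 \<le> l" "l < k"
      have "{p ! l, p ! Suc l} \<noteq> {?x, ?y}"
        using l k by (auto simp: doubleton_eq_iff inj)
      moreover have "{p ! l, p ! Suc l} \<in> A" using p(3)[of l] l k by simp
      ultimately show "{p ! l, p ! Suc l} \<in> A - {{?x, ?y}}" by simp
    qed (use k in auto)
    with * ne e show False by blast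
  qed
qed

section \<open>Forests under insertion and deletion of an edge\<close>

lemma cycle_free_mono: "cycle_free A \<Longrightarrow> B \<subseteq> A \<Longrightarrow> cycle_free B"
  by (auto simp: cycle_free_def is_cycle_def)

lemma cycle_free_empty [simp]: "cycle_free {}"
  by (auto simp: cycle_free_iff)

lemma cycle_free_separates:
  "cycle_free A \<Longrightarrow> {x, y} \<in> A \<Longrightarrow> x \<noteq> y \<Longrightarrow> \<not> reach (A - {{x, y}}) x y"
  by (auto simp: cycle_free_iff)

text \<open>If an old edge \<open>{u, v}\<close> had a detour through the new edge, then
  \<open>{u, v}\<close> together with the two halves of the detour would connect \<open>x\<close>
  and \<open>y\<close> within \<open>A\<close>.\<close>

lemma cycle_free_insert:
  assumes "{x, y} \<notin> A" "x \<noteq> y"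
  shows "cycle_free (insert {x, y} A) \<longleftrightarrow> cycle_free A \<and> \<not> reach A x y"
proof
  assume L: "cycle_free (insert {x, y} A)"
  then have "\<not> reach (insert {x, y} A - {{x, y}}) x y"
    using assms by (intro cycle_free_separates) auto
  moreover have "insert {x, y} A - {{x, y}} = A" using assms by auto
  ultimately show "cycle_free A \<and> \<not> reach A x y"
    using cycle_free_mono[OF L] by auto
next
  assume R: "cycle_free A \<and> \<not> reach A x y"
  show "cycle_free (insert {x, y} A)"
    unfolding cycle_free_iff
  proof (intro allI impI notI)
    fix u v assume uv: "u \<noteq> v" "{u, v} \<in> insert {x, y} A"
      and r: "reach (insert {x, y} A - {{u, v}}) u v"
    show False
    proof (cases "{u, v} = {x, y}")
      case True
      then have "insert {x, y} A - {{u, v}} = A" using assms by auto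
      with r have "reach A u v" by simp
      moreover from True have "u = x \<and> v = y \<or> u = y \<and> v = x"
        by (simp add: doubleton_eq_iff)
      ultimately have "reach A x y" using reach_sym[of A u v] by blast
      with R show False by blast
    next
      case False
      then have uvA: "{u, v} \<in> A" using uv by auto
      let ?B = "A - {{u, v}}"
      have "insert {x, y} A - {{u, v}} = insert {x, y} ?B" using False by auto
      with r have "reach ?B u v \<or> reach ?B u x \<and> reach ?B y v \<or> reach ?B u y \<and> reach ?B x v"
        using reach_insert[of x y ?B u v] by simp
      moreover have "\<not> reach ?B u v"
        using R uvA uv by (intro cycle_free_separates) auto
      ultimately have "reach ?B u x \<and> reach ?B y v \<or> reach ?B u y \<and> reach ?B x v" by blast
      moreover have m: "reach A p q" if "reach ?B p q" for p q
        using that by (rule reach_mono) auto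
      ultimately have "reach A u x \<and> reach A y v \<or> reach A u y \<and> reach A x v"
        by blast
      moreover have "reach A u v" using uvA by (rule reach_edge)
      ultimately have "reach A x y"
        by (auto simp: reach_iff_eq)
      with R show False by blast
    qed
  qed
qed

text \<open>The induction restarts at every return to \<open>x\<close>; what it keeps is the walk
  after the last departure, which does not use its first edge again.\<close>

lemma reach_first_edge:
  assumes "reach A x w" "x \<noteq> w"
  shows "\<exists>y. {x, y} \<in> A \<and> reach (A - {{x, y}}) y w"
proof -
  from assms(1) have "w = x \<or> (\<exists>y. {x, y} \<in> A \<and> reach (A - {{x, y}}) y w)"
  proof (induction rule: reach_induct)
    case refl
    then show ?case by simp
  next
    case (step w z)
    show ?case
    proof (cases "w = x")
      case True
      then show ?thesis using step.hyps by (intro disjI2 exI[of _ z]) simp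
    next
      case False
      then obtain y where y: "{x, y} \<in> A" "reach (A - {{x, y}}) y w"
        using step.IH by blast
      show ?thesis
      proof (cases "{w, z} = {x, y}")
        case True
        then have "z = x \<or> z = y" by (auto simp: doubleton_eq_iff)
        with y(1) show ?thesis using reach_refl[of "A - {{x, y}}" y] by auto
      next
        case False
        then have "reach (A - {{x, y}}) w z" using step.hyps by (intro reach_edge) auto
        with y have "reach (A - {{x, y}}) y z" by (simp add: reach_iff_eq)
        with y show ?thesis by blast
      qed
    qed
  qed
  with assms(2) show ?thesis by auto
qed

text \<open>Two different first edges leading to \<open>w\<close> would close a cycle through
  \<open>x\<close>. So the forest determines the next hop from \<open>x\<close> towards
  \<open>w\<close>.\<close>

lemma cycle_free_first_edge_unique:
  assumes "cycle_free A" "{x, y} \<in> A" "{x, z} \<in> A" "x \<noteq> y" "x \<noteq> z"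
    and "reach (A - {{x, y}}) y w" "reach (A - {{x, z}}) z w"
  shows "y = z"
proof (rule ccontr)
  assume "y \<noteq> z"
  let ?B = "A - {{x, y}} - {{x, z}}"
  have ne: "{x, y} \<noteq> {x, z}" using \<open>y \<noteq> z\<close> by (auto simp: doubleton_eq_iff)
  have eq: "A - {{x, z}} = insert {x, y} ?B" "A - {{x, y}} = insert {x, z} ?B"
    using assms ne by auto
  have s: "\<not> reach (A - {{x, y}}) x y" "\<not> reach (A - {{x, z}}) x z"
    using cycle_free_separates[OF assms(1,2,4)] cycle_free_separates[OF assms(1,3,5)] by auto
  have xz: "reach (A - {{x, y}}) x z" using assms ne by (intro reach_edge) auto
  have xy: "reach (A - {{x, z}}) x y" using assms ne by (intro reach_edge) auto
  have m: "reach ?B p q \<Longrightarrow> reach (A - {{x, z}}) p q"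
    "reach ?B p q \<Longrightarrow> reach (A - {{x, y}}) p q" for p q
    by (auto elim!: reach_mono)
  have "reach ?B z w \<or> reach ?B z x \<or> reach ?B z y"
    using assms(7) unfolding eq(1) reach_insert[of x y ?B z w] by blast
  then have "reach (A - {{x, y}}) z w \<or> reach (A - {{x, z}}) z x \<or> reach (A - {{x, y}}) z y"
    using m[of z] by auto
  then show False using s xz assms(6) by (auto simp: reach_iff_eq)
qed

section \<open>Trees and forests with two components\<close>

text \<open>Unlike \<open>spanning_trees\<close> this refers to no host graph, so it also serves for
  the pieces into which a forest or a tree is cut.\<close>

definition is_tree :: "'a set \<Rightarrow> 'a set set \<Rightarrow> bool" where
  "is_tree V T \<longleftrightarrow> T \<subseteq> complete_edges V \<and> cycle_free T \<and> connected_graph V T"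

text \<open>The number of components is fixed by two representatives \<open>x\<close> and
  \<open>y\<close>, which avoids counting classes or edges.\<close>

definition two_forests :: "'a set \<Rightarrow> 'a set set \<Rightarrow> 'a set set set" where
  "two_forests V E = {F. F \<subseteq> E \<and> cycle_free F \<and>
     (\<exists>x\<in>V. \<exists>y\<in>V. \<not> reach F x y \<and> (\<forall>z\<in>V. reach F z x \<or> reach F z y))}"

lemma complete_edges_pairD:
  assumes "{x, y} \<in> complete_edges V"
  shows "x \<noteq> y" "x \<in> V" "y \<in> V"
  using assms by (auto simp: complete_edges_def)

lemma complete_edgesE:
  assumes "e \<in> complete_edges V"
  obtains x y where "e = {x, y}" "x \<noteq> y" "x \<in> V" "y \<in> V"
  using assms by (auto simp: complete_edges_def card_2_iff)

lemma finite_complete_edges: "finite V \<Longrightarrow> finite (complete_edges V)"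
  unfolding complete_edges_def by (rule finite_subset[of _ "Pow V"]) auto

lemma tree_edge_sides:
  assumes "is_tree V T" "{x, y} \<in> T" "w \<in> V"
  shows "reach (T - {{x, y}}) w x \<noteq> reach (T - {{x, y}}) w y"
proof -
  let ?B = "T - {{x, y}}"
  have xy: "x \<noteq> y" "x \<in> V" "y \<in> V"
    using assms complete_edges_pairD[of x y V] by (auto simp: is_tree_def)
  have "\<not> reach ?B x y" using assms xy by (intro cycle_free_separates) (auto simp: is_tree_def)
  moreover have "reach T w x" using assms xy by (auto simp: is_tree_def connected_graph_reach)
  then have "reach (insert {x, y} ?B) w x" using assms(2) by (simp add: insert_absorb)
  then have "reach ?B w x \<or> reach ?B w y" unfolding reach_insert by blast
  ultimately show ?thesis unfolding reach_iff_eq by metis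
qed

lemma tree_finite:
  assumes "is_tree V T" "finite V"
  shows "finite T"
proof (rule finite_subset)
  show "T \<subseteq> complete_edges V" using assms by (simp add: is_tree_def)
  show "finite (complete_edges V)" using assms by (simp add: finite_complete_edges)
qed

lemma neighbours_finite:
  assumes "T \<subseteq> complete_edges V" "finite V"
  shows "finite {y. {x, y} \<in> T}"
proof (rule finite_subset)
  show "{y. {x, y} \<in> T} \<subseteq> V" using assms(1) by (auto simp: complete_edges_def)
qed (rule assms)

text \<open>The combinatorial source of the potential theory: from \<open>x\<close> a single tree
  edge leads towards \<open>w\<close>. Summed over trees, these indicators become the point charges
  in \<open>lap_green\<close> and \<open>contracted_green\<close>.\<close>

lemma tree_next_hop:
  assumes "is_tree V T" "finite V" "x \<in> V" "w \<in> V"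
  shows "(\<Sum>y | {x, y} \<in> T. of_bool (reach (T - {{x, y}}) y w)) = (of_bool (x \<noteq> w) :: real)"
proof -
  have fin: "finite {y. {x, y} \<in> T}"
    using assms by (auto simp: is_tree_def intro: neighbours_finite)
  have ne: "x \<noteq> y" if "{x, y} \<in> T" for y
    using that assms complete_edges_pairD(1)[of x y V] by (auto simp: is_tree_def)
  have sep: "\<not> reach (T - {{x, y}}) x y" if "{x, y} \<in> T" for y
    using that ne assms by (intro cycle_free_separates) (auto simp: is_tree_def)
  show ?thesis
  proof (cases "x = w")
    case True
    then show ?thesis using sep reach_commute[of _ _ w] by simp
  next
    case False
    have "reach T x w" using assms by (auto simp: is_tree_def connected_graph_reach)
    from reach_first_edge[OF this False] obtain y
      where y: "{x, y} \<in> T" "reach (T - {{x, y}}) y w" by blast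
    have "{z. {x, z} \<in> T \<and> reach (T - {{x, z}}) z w} = {y}"
    proof (intro equalityI subsetI)
      fix z assume z: "z \<in> {z. {x, z} \<in> T \<and> reach (T - {{x, z}}) z w}"
      have "z = y"
      proof (rule cycle_free_first_edge_unique)
        show "cycle_free T" using assms by (simp add: is_tree_def)
        show "x \<noteq> z" "x \<noteq> y" using ne z y by auto
      qed (use y z in auto)
      then show "z \<in> {y}" by simp
    qed (use y in auto)
    moreover have "(\<Sum>y | {x, y} \<in> T. of_bool (reach (T - {{x, y}}) y w))
        = (\<Sum>y\<in>{z. {x, z} \<in> T \<and> reach (T - {{x, z}}) z w}. (1::real))"
      using fin by (simp add: of_bool_def sum.If_cases Int_def)
    ultimately show ?thesis using False by simp
  qed
qed

text \<open>Edges are oriented towards a root \<open>r\<close>: each other vertex has one outgoing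
  edge by \<open>tree_next_hop\<close>, and each edge has one orientation by
  \<open>tree_edge_sides\<close>.\<close>

lemma card_tree:
  assumes "is_tree V T" "finite V"
  shows "card V = card T + 1"
proof -
  from assms obtain r where r: "r \<in> V"
    by (auto simp: is_tree_def connected_graph_def)
  define P where "P = (SIGMA x:V. {y. {x, y} \<in> T \<and> reach (T - {{x, y}}) y r})"
  have T: "T \<subseteq> complete_edges V" using assms by (simp add: is_tree_def)
  have fin: "finite {y. {x, y} \<in> T}" for x using T assms(2) by (rule neighbours_finite)
  have fin': "finite {y. {x, y} \<in> T \<and> reach (T - {{x, y}}) y r}" for x
    by (rule finite_subset[OF _ fin[of x]]) auto
  have "real (card P) = (\<Sum>x\<in>V. real (card {y. {x, y} \<in> T \<and> reach (T - {{x, y}}) y r}))"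
    unfolding P_def using assms(2) fin' by simp
  also have "\<dots> = (\<Sum>x\<in>V. \<Sum>y | {x, y} \<in> T. of_bool (reach (T - {{x, y}}) y r))"
    using fin by (simp add: of_bool_def sum.If_cases Int_def)
  also have "\<dots> = (\<Sum>x\<in>V. of_bool (x \<noteq> r))"
    using tree_next_hop[OF assms _ r] by simp
  also have "\<dots> = real (card (V - {r}))"
    using assms(2) by (simp add: of_bool_def sum.If_cases Int_def set_diff_eq)
  also have "\<dots> = real (card V) - 1"
    using r assms(2) card_gt_0_iff[of V] by (auto simp: card_Diff_singleton of_nat_diff)
  finally have 1: "real (card P) = real (card V) - 1" .
  have "bij_betw (\<lambda>(x, y). {x, y}) P T"
  proof (rule bij_betwI')
    fix p q assume "p \<in> P" "q \<in> P"
    then obtain x y u v where pq: "p = (x, y)" "q = (u, v)" "x \<in> V" "u \<in> V" "{x, y} \<in> T" "{u, v} \<in> T"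
      "reach (T - {{x, y}}) y r" "reach (T - {{u, v}}) v r"
      by (auto simp: P_def)
    have "reach (T - {{x, y}}) r x \<noteq> reach (T - {{x, y}}) r y"
      using tree_edge_sides[OF assms(1) pq(5) r] .
    then have "{x, y} = {u, v} \<Longrightarrow> x = u \<and> y = v"
      using pq by (auto simp: doubleton_eq_iff reach_commute[of _ r] insert_commute)
    then show "((case p of (x, y) \<Rightarrow> {x, y}) = (case q of (x, y) \<Rightarrow> {x, y})) = (p = q)"
      using pq by auto
  next
    fix p assume "p \<in> P"
    then show "(case p of (x, y) \<Rightarrow> {x, y}) \<in> T" by (auto simp: P_def)
  next
    fix e assume e: "e \<in> T"
    with T obtain x y where xy: "e = {x, y}" "x \<in> V" "y \<in> V" by (blast elim: complete_edgesE)
    have "reach (T - {{x, y}}) r x \<noteq> reach (T - {{x, y}}) r y"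
      using tree_edge_sides[OF assms(1) _ r] e xy by simp
    then have "(x, y) \<in> P \<or> (y, x) \<in> P"
      using e xy by (auto simp: P_def reach_commute[of _ r] insert_commute)
    then show "\<exists>p\<in>P. e = (case p of (x, y) \<Rightarrow> {x, y})"
      using xy by (auto simp: insert_commute)
  qed
  then have "card P = card T" by (rule bij_betw_same_card)
  moreover have "card V > 0" using r assms(2) by (auto simp: card_gt_0_iff)
  ultimately show ?thesis using 1 by linarith
qed

lemma two_values:
  fixes u v w x y :: 'b
  shows "\<lbrakk>u = x \<or> u = y; v = x \<or> v = y; w = x \<or> w = y; u \<noteq> v\<rbrakk> \<Longrightarrow> (w = u) \<noteq> (w = v)"
  by auto

lemma two_forests_sides:
  assumes "F \<in> two_forests V E" "u \<in> V" "v \<in> V" "w \<in> V" "\<not> reach F u v"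
  shows "reach F w u \<noteq> reach F w v"
proof -
  from assms(1) obtain x y where *: "\<forall>z\<in>V. reach F z x \<or> reach F z y"
    unfolding two_forests_def by blast
  show ?thesis
    using bspec[OF * assms(2)] bspec[OF * assms(3)] bspec[OF * assms(4)] assms(5)
    unfolding reach_iff_eq by (rule two_values)
qed

lemma two_forests_insert:
  assumes "F \<in> two_forests V E" "u \<in> V" "v \<in> V" "\<not> reach F u v" "{u, v} \<in> E"
  shows "insert {u, v} F \<in> spanning_trees V E" "{u, v} \<notin> F"
proof -
  show notin: "{u, v} \<notin> F" using assms(4) reach_edge[of u v F] by auto
  have "u \<noteq> v" using assms(4) by auto
  then have "cycle_free (insert {u, v} F)"
    using assms notin by (simp add: cycle_free_insert two_forests_def)
  moreover have "reach (insert {u, v} F) w z" if "w \<in> V" "z \<in> V" for w z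
  proof -
    have "reach F w u \<or> reach F w v" "reach F z u \<or> reach F z v"
      using two_forests_sides[OF assms(1,2,3) that(1) assms(4)]
        two_forests_sides[OF assms(1,2,3) that(2) assms(4)] by auto
    then show ?thesis unfolding reach_insert unfolding reach_iff_eq by auto
  qed
  moreover have "insert {u, v} F \<subseteq> E" using assms by (auto simp: two_forests_def)
  ultimately show "insert {u, v} F \<in> spanning_trees V E"
    using assms(2) by (auto simp: spanning_trees_def connected_graph_reach)
qed

lemma spanning_trees_is_tree:
  "E \<subseteq> complete_edges V \<Longrightarrow> T \<in> spanning_trees V E \<Longrightarrow> is_tree V T"
  by (auto simp: spanning_trees_def is_tree_def)

lemma spanning_trees_remove:
  assumes "E \<subseteq> complete_edges V" "T \<in> spanning_trees V E" "{u, v} \<in> T"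
  shows "T - {{u, v}} \<in> two_forests V E" "\<not> reach (T - {{u, v}}) u v"
proof -
  have tree: "is_tree V T" using assms by (simp add: spanning_trees_is_tree)
  then have uv: "u \<noteq> v" "u \<in> V" "v \<in> V"
    using assms(3) complete_edges_pairD[of u v V] by (auto simp: is_tree_def)
  show sep: "\<not> reach (T - {{u, v}}) u v"
    using tree assms(3) uv by (intro cycle_free_separates) (auto simp: is_tree_def)
  have "reach (T - {{u, v}}) z u \<or> reach (T - {{u, v}}) z v" if "z \<in> V" for z
    using tree_edge_sides[OF tree assms(3) that] by blast
  moreover have "cycle_free (T - {{u, v}})"
    using tree by (auto simp: is_tree_def intro: cycle_free_mono)
  moreover have "T - {{u, v}} \<subseteq> E" using assms by (auto simp: spanning_trees_def)
  ultimately show "T - {{u, v}} \<in> two_forests V E"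
    using uv sep by (auto simp: two_forests_def)
qed

text \<open>Deleting and restoring \<open>{u, v}\<close> are inverse to each other. Sums over
  two-component forests turn into sums over trees only through this lemma.\<close>

lemma sum_edge_exchange:
  fixes g :: "'a set set \<Rightarrow> real"
  assumes "E \<subseteq> complete_edges V" "{u, v} \<in> E"
  shows "(\<Sum>F | F \<in> two_forests V E \<and> \<not> reach F u v. g F)
       = (\<Sum>T | T \<in> spanning_trees V E \<and> {u, v} \<in> T. g (T - {{u, v}}))"
proof (rule sum.reindex_bij_witness[where i = "\<lambda>T. T - {{u, v}}" and j = "insert {u, v}"])
  have uv: "u \<in> V" "v \<in> V" using assms complete_edges_pairD[of u v V] by auto
  fix F assume "F \<in> {F \<in> two_forests V E. \<not> reach F u v}"
  then have F: "F \<in> two_forests V E" "\<not> reach F u v" by auto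
  note ins = two_forests_insert[OF F(1) uv F(2) assms(2)]
  then show "insert {u, v} F \<in> {T \<in> spanning_trees V E. {u, v} \<in> T}" by simp
  show "insert {u, v} F - {{u, v}} = F" using ins by simp
  then show "g (insert {u, v} F - {{u, v}}) = g F" by simp
next
  fix T assume T: "T \<in> {T \<in> spanning_trees V E. {u, v} \<in> T}"
  then show "insert {u, v} (T - {{u, v}}) = T" by auto
  show "T - {{u, v}} \<in> {F \<in> two_forests V E. \<not> reach F u v}"
    using spanning_trees_remove[OF assms(1)] T by auto
qed

lemma reach_restrict:
  assumes "reach F u v" "u \<in> A" "\<And>x y. x \<in> A \<Longrightarrow> {x, y} \<in> F \<Longrightarrow> y \<in> A"
  shows "v \<in> A \<and> reach (F \<inter> Pow A) u v"
  using assms(1)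
proof (induction rule: reach_induct)
  case refl
  then show ?case using assms(2) by simp
next
  case (step y z)
  then have z: "z \<in> A" using assms(3) by blast
  then have "reach (F \<inter> Pow A) y z" using step by (intro reach_edge) auto
  with step.IH z show ?case by (simp add: reach_iff_eq)
qed

lemma two_forests_component_card:
  assumes "E \<subseteq> complete_edges V" "finite V" "F \<in> two_forests V E" "r \<in> V"
  shows "card {v \<in> V. \<not> reach F v r} = card {e \<in> F. \<forall>v\<in>e. \<not> reach F v r} + 1"
proof -
  define A where "A = {v \<in> V. \<not> reach F v r}"
  have FV: "F \<subseteq> complete_edges V" using assms by (auto simp: two_forests_def)
  have closed: "y \<in> A" if "x \<in> A" "{x, y} \<in> F" for x y
    using that reach_edge[of x y F] FV complete_edges_pairD[of x y V]
    by (auto simp: A_def reach_iff_eq)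
  have "A \<noteq> {}"
  proof -
    from assms(3) obtain x y where "x \<in> V" "y \<in> V" "\<not> reach F x y"
      by (auto simp: two_forests_def)
    then have "x \<in> A \<or> y \<in> A" by (auto simp: A_def reach_iff_eq)
    then show ?thesis by auto
  qed
  moreover have "reach (F \<inter> Pow A) u v" if "u \<in> A" "v \<in> A" for u v
  proof -
    have "reach F u v"
      using two_forests_sides[OF assms(3), of u r v] that assms(4)
      by (auto simp: A_def reach_commute)
    then show ?thesis using reach_restrict[of F u v A] that closed by blast
  qed
  moreover have "F \<inter> Pow A \<subseteq> complete_edges A"
    using FV by (auto simp: complete_edges_def)
  moreover have "cycle_free (F \<inter> Pow A)"
    using assms(3) by (auto simp: two_forests_def intro: cycle_free_mono)
  ultimately have "is_tree A (F \<inter> Pow A)"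
    by (auto simp: is_tree_def connected_graph_reach)
  then have "card A = card (F \<inter> Pow A) + 1"
    using assms(2) by (intro card_tree) (auto simp: A_def)
  moreover have "F \<inter> Pow A = {e \<in> F. \<forall>v\<in>e. \<not> reach F v r}"
    using FV by (auto simp: A_def complete_edges_def)
  ultimately show ?thesis by (simp add: A_def)
qed

text \<open>A maximal cycle-free set between \<open>A\<close> and \<open>E\<close> is spanning: an
  edge of \<open>E\<close> joining two of its components could still be added.\<close>

lemma cycle_free_extend:
  assumes "finite E" "E \<subseteq> complete_edges V" "connected_graph V E" "A \<subseteq> E" "cycle_free A"
  shows "\<exists>T\<in>spanning_trees V E. A \<subseteq> T"
proof -
  let ?S = "{T. A \<subseteq> T \<and> T \<subseteq> E \<and> cycle_free T}"
  have "?S \<subseteq> Pow E" by auto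
  then have "finite ?S" by (rule finite_subset) (simp add: assms(1))
  moreover have "A \<in> ?S" using assms(4,5) by simp
  ultimately have "\<exists>T\<in>?S. A \<subseteq> T \<and> (\<forall>T'\<in>?S. T \<subseteq> T' \<longrightarrow> T = T')"
    by (rule finite_has_maximal2)
  then obtain T where T: "T \<in> ?S" and max: "\<forall>T'\<in>?S. T \<subseteq> T' \<longrightarrow> T = T'"
    by (elim bexE conjE)
  have edge: "reach T u v" if "{u, v} \<in> E" for u v
  proof (rule ccontr)
    assume n: "\<not> reach T u v"
    have ne: "u \<noteq> v" using that assms complete_edges_pairD[of u v V] by auto
    have notin: "{u, v} \<notin> T" using n reach_edge[of u v T] by auto
    then have "insert {u, v} T \<in> ?S" using T n ne that by (auto simp: cycle_free_insert)
    from bspec[OF max this] have "T = insert {u, v} T" by auto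
    with notin show False by auto
  qed
  have "reach T u v" if "u \<in> V" "v \<in> V" for u v
  proof -
    have "reach E u v" using assms that by (auto simp: connected_graph_reach)
    then show ?thesis
    proof (induction rule: reach_induct)
      case (step y z)
      then show ?case using edge[of y z] by (simp add: reach_iff_eq)
    qed simp
  qed
  then have "T \<in> spanning_trees V E"
    using T assms by (auto simp: spanning_trees_def connected_graph_reach)
  with T(1) show ?thesis by auto
qed

section \<open>The Green function of a graph\<close>

text \<open>With only two classes, the relation of \<open>x\<close> and \<open>y\<close> can be read
  off from their sides relative to \<open>r\<close>.\<close>

lemma two_forests_reach_iff:
  assumes "F \<in> two_forests V E" "x \<in> V" "y \<in> V" "r \<in> V"
  shows "reach F x y \<longleftrightarrow> (reach F x r \<longleftrightarrow> reach F y r)"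
proof -
  from assms(1) obtain p q where *: "\<forall>z\<in>V. reach F z p \<or> reach F z q"
    unfolding two_forests_def by blast
  have aux: "(a = b) = ((a = c) = (b = c))"
    if "a = p \<or> a = q" "b = p \<or> b = q" "c = p \<or> c = q" for a b c p q :: "'a set"
    using that by auto
  show ?thesis
    using bspec[OF * assms(2)] bspec[OF * assms(3)] bspec[OF * assms(4)]
    unfolding reach_iff_eq by (rule aux)
qed

locale conn_graph =
  fixes V :: "'a set" and E :: "'a set set"
  assumes finV: "finite V" and EV: "E \<subseteq> complete_edges V" and conn: "connected_graph V E"
begin

abbreviation trees :: "'a set set set" where "trees \<equiv> spanning_trees V E"

abbreviation biforests :: "'a set set set" where "biforests \<equiv> two_forests V E"

definition tau :: real where "tau = real (card trees)"

definition nb :: "'a \<Rightarrow> 'a set" where "nb x = {y. {x, y} \<in> E}"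

text \<open>The combinatorial Laplacian, with the sign that makes it positive semidefinite.\<close>

definition lap :: "('a \<Rightarrow> real) \<Rightarrow> 'a \<Rightarrow> real" where "lap h x = (\<Sum>y\<in>nb x. h x - h y)"

lemma finE: "finite E"
  using EV finV finite_complete_edges[of V] finite_subset[of E] by simp

lemma finite_trees: "finite trees"
proof (rule finite_subset)
  show "trees \<subseteq> Pow E" by (auto simp: spanning_trees_def)
qed (simp add: finE)

lemma finite_biforests: "finite biforests"
proof (rule finite_subset)
  show "biforests \<subseteq> Pow E" by (auto simp: two_forests_def)
qed (simp add: finE)

lemma tau_pos: "tau > 0"
proof -
  have "\<exists>T\<in>trees. {} \<subseteq> T"
    using finE EV conn by (intro cycle_free_extend) auto
  then have "trees \<noteq> {}" by auto
  then show ?thesis using finite_trees by (simp add: tau_def card_gt_0_iff)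
qed

lemma tree_is_tree: "T \<in> trees \<Longrightarrow> is_tree V T"
  using EV by (rule spanning_trees_is_tree)

lemma edgeD:
  assumes "{x, y} \<in> E"
  shows "x \<noteq> y" "x \<in> V" "y \<in> V"
  using complete_edges_pairD[of x y V] assms EV by auto

lemma nb_subset: "nb x \<subseteq> V"
  using edgeD by (auto simp: nb_def)

lemma finite_nb: "finite (nb x)"
  using nb_subset finV by (rule finite_subset)

lemma nb_sym: "y \<in> nb x \<longleftrightarrow> x \<in> nb y"
  by (simp add: nb_def insert_commute)

lemma nb_eq: "nb x = {y \<in> V. y \<in> nb x}"
  using nb_subset by auto

lemma sum_nb_swap: "(\<Sum>x\<in>V. \<Sum>y\<in>nb x. f x y) = (\<Sum>x\<in>V. \<Sum>y\<in>nb x. f y x :: real)"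
proof -
  have "(\<Sum>x\<in>V. \<Sum>y\<in>nb x. f x y) = (\<Sum>x\<in>V. \<Sum>y\<in>{y \<in> V. y \<in> nb x}. f x y)"
    by (simp flip: nb_eq)
  also have "\<dots> = (\<Sum>y\<in>V. \<Sum>x\<in>{x \<in> V. y \<in> nb x}. f x y)"
    using finV by (intro sum.swap_restrict)
  also have "\<dots> = (\<Sum>y\<in>V. \<Sum>x\<in>{x \<in> V. x \<in> nb y}. f x y)"
    by (simp add: nb_sym)
  finally show ?thesis by (simp flip: nb_eq)
qed

lemma sum_handshake: "(\<Sum>x\<in>V. \<Sum>y\<in>nb x. g {x, y}) = 2 * (\<Sum>e\<in>E. g e :: real)"
proof -
  have "(\<Sum>y\<in>nb x. g {x, y}) = (\<Sum>e\<in>{e \<in> E. x \<in> e}. g e)" for x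
  proof (rule sum.reindex_bij_betw)
    show "bij_betw (\<lambda>y. {x, y}) (nb x) {e \<in> E. x \<in> e}"
      unfolding bij_betw_def
    proof
      show "inj_on (\<lambda>y. {x, y}) (nb x)" by (auto simp: inj_on_def doubleton_eq_iff)
      show "(\<lambda>y. {x, y}) ` nb x = {e \<in> E. x \<in> e}"
      proof (intro equalityI subsetI)
        fix e assume e: "e \<in> {e \<in> E. x \<in> e}"
        with EV obtain u v where "e = {u, v}" by (blast elim: complete_edgesE)
        with e show "e \<in> (\<lambda>y. {x, y}) ` nb x" by (auto simp: nb_def insert_commute)
      qed (auto simp: nb_def)
    qed
  qed
  then have "(\<Sum>x\<in>V. \<Sum>y\<in>nb x. g {x, y}) = (\<Sum>x\<in>V. \<Sum>e\<in>{e \<in> E. x \<in> e}. g e)"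
    by simp
  also have "\<dots> = (\<Sum>e\<in>E. \<Sum>x\<in>{x \<in> V. x \<in> e}. g e)"
    using finV finE by (intro sum.swap_restrict)
  also have "\<dots> = (\<Sum>e\<in>E. 2 * g e)"
  proof (rule sum.cong)
    fix e assume e: "e \<in> E"
    then have "{x \<in> V. x \<in> e} = e" "card e = 2" using EV by (auto simp: complete_edges_def)
    then show "(\<Sum>x\<in>{x \<in> V. x \<in> e}. g e) = 2 * g e" by simp
  qed simp
  finally show ?thesis by (simp add: sum_distrib_left)
qed

section \<open>The Laplacian and its Dirichlet energy\<close>

lemma lap_diff: "lap (\<lambda>x. f x - g x) x = lap f x - lap g x"
  unfolding lap_def sum_subtractf[symmetric] by (simp add: algebra_simps)

lemma lap_mult: "lap (\<lambda>x. c * f x) x = c * lap f x"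
  by (simp add: lap_def sum_distrib_left algebra_simps)

lemma lap_sum: "lap (\<lambda>x. \<Sum>i\<in>I. f i x) x = (\<Sum>i\<in>I. lap (f i) x)"
  unfolding lap_def sum_subtractf[symmetric] by (rule sum.swap)

lemma lap_energy:
  "(\<Sum>x\<in>V. f x * lap g x) = (\<Sum>x\<in>V. \<Sum>y\<in>nb x. (f x - f y) * (g x - g y)) / 2"
proof -
  have "(\<Sum>x\<in>V. f x * lap g x) = (\<Sum>x\<in>V. \<Sum>y\<in>nb x. f x * (g x - g y))"
    by (simp add: lap_def sum_distrib_left)
  moreover have "\<dots> = (\<Sum>x\<in>V. \<Sum>y\<in>nb x. f y * (g y - g x))"
    by (rule sum_nb_swap)
  moreover have "(\<Sum>x\<in>V. \<Sum>y\<in>nb x. (f x - f y) * (g x - g y))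
      = (\<Sum>x\<in>V. \<Sum>y\<in>nb x. f x * (g x - g y)) + (\<Sum>x\<in>V. \<Sum>y\<in>nb x. f y * (g y - g x))"
    by (simp add: algebra_simps flip: sum.distrib)
  ultimately show ?thesis by linarith
qed

lemma lap_energy_nonneg: "(\<Sum>x\<in>V. f x * lap f x) \<ge> 0"
  unfolding lap_energy by (intro divide_nonneg_pos sum_nonneg) auto

text \<open>Zero Laplacian forces zero energy, hence equal values along every edge. It serves as the
  uniqueness principle: potentials with the same Laplacian that agree at a root agree
  everywhere.\<close>

lemma harmonic_constant:
  assumes "\<And>x. x \<in> V \<Longrightarrow> lap h x = 0" "u \<in> V" "v \<in> V"
  shows "h u = h v"
proof -
  have "(\<Sum>x\<in>V. \<Sum>y\<in>nb x. (h x - h y) * (h x - h y)) = 0"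
    using lap_energy[of h h] assms(1) by simp
  then have "(\<Sum>y\<in>nb x. (h x - h y) * (h x - h y)) = 0" if "x \<in> V" for x
    using that finV by (subst (asm) sum_nonneg_eq_0_iff) (auto intro: sum_nonneg)
  then have "(h x - h y) * (h x - h y) = 0" if "x \<in> V" "y \<in> nb x" for x y
    using that finite_nb by (simp add: sum_nonneg_eq_0_iff)
  then have step: "h x = h y" if "{x, y} \<in> E" for x y
    using that edgeD(2)[OF that] by (auto simp: nb_def)
  have "reach E u v" using conn assms by (auto simp: connected_graph_reach)
  then show ?thesis
    by (induction rule: reach_induct) (simp_all add: step)
qed

text \<open>The weight \<open>W\<close> serves twice: with \<open>W = 1\<close> the counts are the Green function of the graph,
  and with \<open>W\<close> the indicator of an edge they are that of the graph with this edge contracted, so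
  that no contraction is ever formed.\<close>

definition cnt :: "('a set set \<Rightarrow> real) \<Rightarrow> 'a \<Rightarrow> 'a \<Rightarrow> 'a \<Rightarrow> real" where
  "cnt W r x z = (\<Sum>F\<in>biforests. W F * of_bool (\<not> reach F x r) * of_bool (\<not> reach F z r))"

text \<open>Forests with \<open>x\<close> and \<open>y\<close> on the same side cancel; the others
  correspond to trees through \<open>{x, y}\<close> by \<open>sum_edge_exchange\<close>.\<close>

lemma cnt_diff_edge:
  assumes "{x, y} \<in> E" "z \<in> V" "r \<in> V"
  shows "cnt W r x z - cnt W r y z = (\<Sum>T | T \<in> trees \<and> {x, y} \<in> T. W (T - {{x, y}}) *
     (of_bool (reach (T - {{x, y}}) y r) - of_bool (reach (T - {{x, y}}) y z)))"
proof -
  note xy = edgeD[OF assms(1)]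
  let ?g = "\<lambda>F. W F * (of_bool (reach F y r) - of_bool (reach F y z))"
  have pt: "W F * of_bool (\<not> reach F x r) * of_bool (\<not> reach F z r) -
      W F * of_bool (\<not> reach F y r) * of_bool (\<not> reach F z r)
      = (if \<not> reach F x y then ?g F else 0)" if F: "F \<in> biforests" for F
  proof -
    have "reach F x y \<longleftrightarrow> (reach F x r \<longleftrightarrow> reach F y r)"
      by (rule two_forests_reach_iff[OF F xy(2,3) assms(3)])
    moreover have "reach F y z \<longleftrightarrow> (reach F y r \<longleftrightarrow> reach F z r)"
      by (rule two_forests_reach_iff[OF F xy(3) assms(2,3)])
    ultimately show ?thesis by (cases "reach F x r"; cases "reach F y r"; cases "reach F z r") simp_all
  qed
  have "cnt W r x z - cnt W r y z = (\<Sum>F\<in>biforests. if \<not> reach F x y then ?g F else 0)"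
    unfolding cnt_def sum_subtractf[symmetric] using pt by (intro sum.cong) auto
  also have "\<dots> = (\<Sum>F | F \<in> biforests \<and> \<not> reach F x y. ?g F)"
    using finite_biforests by (intro sum.inter_filter[symmetric])
  also have "\<dots> = (\<Sum>T | T \<in> trees \<and> {x, y} \<in> T. ?g (T - {{x, y}}))"
    using EV assms(1) by (rule sum_edge_exchange)
  finally show ?thesis .
qed

lemma lap_cnt:
  assumes "z \<in> V" "r \<in> V"
  shows "lap (\<lambda>x. cnt W r x z) x = (\<Sum>T\<in>trees. \<Sum>y | {x, y} \<in> T. W (T - {{x, y}}) *
     (of_bool (reach (T - {{x, y}}) y r) - of_bool (reach (T - {{x, y}}) y z)))"
proof -
  let ?g = "\<lambda>T y. W (T - {{x, y}}) *
     (of_bool (reach (T - {{x, y}}) y r) - of_bool (reach (T - {{x, y}}) y z))"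
  have "lap (\<lambda>x. cnt W r x z) x = (\<Sum>y\<in>nb x. \<Sum>T | T \<in> trees \<and> {x, y} \<in> T. ?g T y)"
    unfolding lap_def using assms by (intro sum.cong cnt_diff_edge) (auto simp: nb_def)
  also have "\<dots> = (\<Sum>T\<in>trees. \<Sum>y | y \<in> nb x \<and> {x, y} \<in> T. ?g T y)"
    by (rule sum.swap_restrict[OF finite_nb finite_trees])
  also have "\<dots> = (\<Sum>T\<in>trees. \<Sum>y | {x, y} \<in> T. ?g T y)"
  proof (rule sum.cong)
    fix T assume "T \<in> trees"
    then have "{y. y \<in> nb x \<and> {x, y} \<in> T} = {y. {x, y} \<in> T}"
      by (auto simp: nb_def spanning_trees_def)
    then show "(\<Sum>y | y \<in> nb x \<and> {x, y} \<in> T. ?g T y) = (\<Sum>y | {x, y} \<in> T. ?g T y)" by simp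
  qed simp
  finally show ?thesis .
qed

text \<open>By the all-minors matrix-tree theorem this is the inverse of the Laplacian with the row
  and column of \<open>r\<close> deleted, extended by 0; \<open>lap_green\<close> proves that
  property directly.\<close>

definition green :: "'a \<Rightarrow> 'a \<Rightarrow> 'a \<Rightarrow> real" where
  "green r x z = cnt (\<lambda>_. 1) r x z / tau"

lemma green_sym: "green r x z = green r z x"
  by (simp add: green_def cnt_def mult.commute)

lemma green_root [simp]: "green r r z = 0" "green r z r = 0"
  by (simp_all add: green_def cnt_def)

lemma lap_green:
  assumes "x \<in> V" "z \<in> V" "r \<in> V"
  shows "lap (\<lambda>x. green r x z) x = of_bool (x = z) - of_bool (x = r)"
proof -
  have "lap (\<lambda>x. cnt (\<lambda>_. 1) r x z) x = (\<Sum>T\<in>trees. of_bool (x = z) - of_bool (x = r))"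
    unfolding lap_cnt[OF assms(2,3)]
  proof (rule sum.cong)
    fix T assume "T \<in> trees"
    then have T: "is_tree V T" by (rule tree_is_tree)
    show "(\<Sum>y | {x, y} \<in> T. 1 * (of_bool (reach (T - {{x, y}}) y r) - of_bool (reach (T - {{x, y}}) y z)))
        = (of_bool (x = z) - of_bool (x = r) :: real)"
      using tree_next_hop[OF T finV assms(1,2)] tree_next_hop[OF T finV assms(1,3)]
      by (auto simp: sum_subtractf)
  qed simp
  then have "lap (\<lambda>x. cnt (\<lambda>_. 1) r x z) x = tau * (of_bool (x = z) - of_bool (x = r))"
    by (simp add: tau_def)
  then show ?thesis
    using lap_mult[of "1 / tau" "\<lambda>x. cnt (\<lambda>_. 1) r x z" x] tau_pos by (simp add: green_def)
qed

text \<open>Effective resistance when every edge is a unit resistor, in its two-forest form.\<close>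

definition resist :: "'a \<Rightarrow> 'a \<Rightarrow> real" where
  "resist x y = (\<Sum>F\<in>biforests. of_bool (\<not> reach F x y)) / tau"

lemma resist_green:
  assumes "x \<in> V" "y \<in> V" "r \<in> V"
  shows "resist x y = green r x x + green r y y - 2 * green r x y"
proof -
  have "(\<Sum>F\<in>biforests. of_bool (\<not> reach F x y) :: real) = 
     (\<Sum>F\<in>biforests. of_bool (\<not> reach F x r) * of_bool (\<not> reach F x r)
        + of_bool (\<not> reach F y r) * of_bool (\<not> reach F y r)
        - 2 * (of_bool (\<not> reach F x r) * of_bool (\<not> reach F y r)))"
  proof (rule sum.cong)
    fix F assume "F \<in> biforests"
    from two_forests_reach_iff[OF this assms]
    show "(of_bool (\<not> reach F x y) :: real) = of_bool (\<not> reach F x r) * of_bool (\<not> reach F x r)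
        + of_bool (\<not> reach F y r) * of_bool (\<not> reach F y r)
        - 2 * (of_bool (\<not> reach F x r) * of_bool (\<not> reach F y r))"
      by (cases "reach F x r"; cases "reach F y r") simp_all
  qed simp
  then show ?thesis
    by (simp add: resist_def green_def cnt_def sum.distrib sum_subtractf
        add_divide_distrib diff_divide_distrib flip: sum_distrib_left)
qed

lemma resist_sym: "resist x y = resist y x"
  by (simp add: resist_def reach_commute)

text \<open>Kirchhoff's edge probability: it links resistances to the uniform spanning tree and so,
  through tree sizes, to Foster's theorem.\<close>

lemma resist_edge:
  assumes "{x, y} \<in> E"
  shows "tau * resist x y = (\<Sum>T\<in>trees. of_bool ({x, y} \<in> T))"
proof -
  have "tau * resist x y = (\<Sum>F\<in>biforests. if \<not> reach F x y then 1 else 0)"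
    using tau_pos by (simp add: resist_def of_bool_def)
  also have "\<dots> = (\<Sum>F | F \<in> biforests \<and> \<not> reach F x y. 1)"
    using finite_biforests by (intro sum.inter_filter[symmetric])
  also have "\<dots> = (\<Sum>T | T \<in> trees \<and> {x, y} \<in> T. 1)"
    using EV assms by (rule sum_edge_exchange)
  also have "\<dots> = (\<Sum>T\<in>trees. if {x, y} \<in> T then 1 else 0)"
    using finite_trees by (intro sum.inter_filter)
  finally show ?thesis by (simp add: of_bool_def)
qed

lemma resist_edge_pos:
  assumes "{x, y} \<in> E"
  shows "resist x y > 0"
proof -
  have "cycle_free (insert {x, y} {})"
    using edgeD[OF assms] by (subst cycle_free_insert) auto
  then have "\<exists>T\<in>trees. insert {x, y} {} \<subseteq> T"
    using finE EV conn assms by (intro cycle_free_extend) auto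
  then obtain T where T: "T \<in> trees" "{x, y} \<in> T" by auto
  have "(\<Sum>T\<in>trees. of_bool ({x, y} \<in> T) :: real) > 0"
    using T finite_trees by (intro sum_pos2[of _ T]) auto
  then show ?thesis
    using resist_edge[OF assms] tau_pos by (metis zero_less_mult_pos)
qed


text \<open>The form is the energy of the potential generated by the charges \<open>v\<close>; the
  balancing charge at \<open>r\<close> contributes nothing because the potential vanishes
  there.\<close>

lemma green_psd:
  assumes "r \<in> V"
  shows "(\<Sum>x\<in>V. \<Sum>z\<in>V. v x * v z * green r x z) \<ge> 0"
proof -
  let ?f = "\<lambda>x. \<Sum>z\<in>V. v z * green r x z"
  have lapf: "lap ?f x = v x - of_bool (x = r) * (\<Sum>z\<in>V. v z)" if "x \<in> V" for x
  proof -
    have "lap ?f x = (\<Sum>z\<in>V. v z * (of_bool (x = z) - of_bool (x = r)))"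
      unfolding lap_sum lap_mult using that assms by (intro sum.cong) (auto simp: lap_green)
    also have "\<dots> = (\<Sum>z\<in>V. v z * of_bool (x = z)) - (\<Sum>z\<in>V. v z * of_bool (x = r))"
      by (simp add: sum_subtractf right_diff_distrib)
    also have "(\<Sum>z\<in>V. v z * of_bool (x = z)) = v x"
      using that finV by (simp add: of_bool_def sum.delta if_distrib[of "\<lambda>t. _ * t"] cong: if_cong)
    also have "(\<Sum>z\<in>V. v z * of_bool (x = r)) = of_bool (x = r) * (\<Sum>z\<in>V. v z)"
      by (simp add: sum_distrib_left mult.commute)
    finally show ?thesis .
  qed
  have fr: "?f r = 0" by simp
  have "0 \<le> (\<Sum>x\<in>V. ?f x * lap ?f x)" by (rule lap_energy_nonneg)
  also have "\<dots> = (\<Sum>x\<in>V. ?f x * v x)"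
  proof (rule sum.cong)
    fix x assume "x \<in> V"
    then show "?f x * lap ?f x = ?f x * v x"
      using fr by (cases "x = r") (simp_all add: lapf)
  qed simp
  also have "\<dots> = (\<Sum>x\<in>V. \<Sum>z\<in>V. v x * v z * green r x z)"
    by (simp add: sum_distrib_left mult_ac)
  finally show ?thesis .
qed

text \<open>The count of forests through \<open>{p, q}\<close> is treated as a potential. Its
  Laplacian lives on \<open>p\<close>, \<open>q\<close> and \<open>r\<close> and contains one
  unknown current \<open>c p q\<close>, which is determined by the equality of the potential at
  \<open>p\<close> and \<open>q\<close>.\<close>

lemma contracted_green:
  assumes e: "{p, q} \<in> E" and r: "r \<in> V"
  shows "(\<Sum>F\<in>biforests. of_bool ({p, q} \<in> F \<and> \<not> reach F p r)) / tau
     = green r p p * resist p q - (green r p p - green r p q)\<^sup>2"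
proof -
  note pq = edgeD[OF e]
  let ?W = "\<lambda>F. of_bool ({p, q} \<in> F) :: real"
  let ?phi = "\<lambda>x. cnt ?W r x p"
  define c where "c = (\<lambda>x y. \<Sum>T\<in>trees. of_bool ({p, q} \<in> T) *
     (of_bool (reach (T - {{x, y}}) y r) - of_bool (reach (T - {{x, y}}) y p)) :: real)"
  have main: "lap ?phi x = tau * resist p q * (of_bool (x = p) - of_bool (x = r))
       - of_bool (x = p) * c p q - of_bool (x = q) * c q p" if x: "x \<in> V" for x
  proof -
    let ?I = "\<lambda>T y. of_bool (reach (T - {{x, y}}) y r) - of_bool (reach (T - {{x, y}}) y p) :: real"
    have "(\<Sum>y | {x, y} \<in> T. ?W (T - {{x, y}}) * ?I T y)
        = of_bool ({p, q} \<in> T) * (of_bool (x = p) - of_bool (x = r))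
          - of_bool (x = p) * (of_bool ({p, q} \<in> T) * ?I T q)
          - of_bool (x = q) * (of_bool ({p, q} \<in> T) * ?I T p)" if "T \<in> trees" for T
    proof (cases "{p, q} \<in> T")
      case False
      then show ?thesis by simp
    next
      case True
      have T: "is_tree V T" using that by (rule tree_is_tree)
      have fin: "finite {y. {x, y} \<in> T}"
        using T finV by (auto simp: is_tree_def intro: neighbours_finite)
      \<comment> \<open>The weight suppresses exactly the hop across \<open>{p, q}\<close>
        itself.\<close>
      have "(\<Sum>y | {x, y} \<in> T. ?W (T - {{x, y}}) * ?I T y)
          = (\<Sum>y | {x, y} \<in> T. ?I T y - (if {x, y} = {p, q} then ?I T y else 0))"
        using True by (intro sum.cong) auto
      also have "\<dots> = (\<Sum>y | {x, y} \<in> T. ?I T y) - (\<Sum>y | {x, y} \<in> T. if {x, y} = {p, q} then ?I T y else 0)"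
        by (rule sum_subtractf)
      also have "(\<Sum>y | {x, y} \<in> T. ?I T y) = of_bool (x = p) - of_bool (x = r)"
        using tree_next_hop[OF T finV x r] tree_next_hop[OF T finV x pq(2)]
        by (auto simp: sum_subtractf)
      also have "(\<Sum>y | {x, y} \<in> T. if {x, y} = {p, q} then ?I T y else 0)
          = of_bool (x = p) * ?I T q + of_bool (x = q) * ?I T p"
      proof -
        consider "x = p" | "x = q" | "x \<noteq> p" "x \<noteq> q" by blast
        then show ?thesis
        proof cases
          case 1
          have "(\<Sum>y | {x, y} \<in> T. if {x, y} = {p, q} then ?I T y else 0)
              = (\<Sum>y | {x, y} \<in> T. if y = q then ?I T y else 0)"
            using 1 pq by (intro sum.cong) (auto simp: doubleton_eq_iff)
          also have "\<dots> = ?I T q" using fin True 1 by (simp add: sum.delta)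
          finally show ?thesis using 1 pq by simp
        next
          case 2
          have "(\<Sum>y | {x, y} \<in> T. if {x, y} = {p, q} then ?I T y else 0)
              = (\<Sum>y | {x, y} \<in> T. if y = p then ?I T y else 0)"
            using 2 pq by (intro sum.cong) (auto simp: doubleton_eq_iff)
          also have "\<dots> = ?I T p" using fin True 2 by (simp add: sum.delta insert_commute)
          finally show ?thesis using 2 pq by simp
        next
          case 3
          then show ?thesis by (intro sum.neutral[THEN trans]) (auto simp: doubleton_eq_iff)
        qed
      qed
      finally show ?thesis using True by simp
    qed
    then have "lap ?phi x = (\<Sum>T\<in>trees. of_bool ({p, q} \<in> T) * (of_bool (x = p) - of_bool (x = r))
          - of_bool (x = p) * (of_bool ({p, q} \<in> T) * ?I T q)
          - of_bool (x = q) * (of_bool ({p, q} \<in> T) * ?I T p))"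
      unfolding lap_cnt[OF pq(2) r] by (intro sum.cong) auto
    also have "\<dots> = (\<Sum>T\<in>trees. of_bool ({p, q} \<in> T)) * (of_bool (x = p) - of_bool (x = r))
          - of_bool (x = p) * (\<Sum>T\<in>trees. of_bool ({p, q} \<in> T) * ?I T q)
          - of_bool (x = q) * (\<Sum>T\<in>trees. of_bool ({p, q} \<in> T) * ?I T p)"
      unfolding sum_subtractf sum_distrib_left sum_distrib_right ..
    finally show ?thesis
      unfolding resist_edge[OF e] c_def by (cases "x = p"; cases "x = q") simp_all
  qed
  \<comment> \<open>Once \<open>{p, q}\<close> is removed from a tree, exactly one of its ends stays
    connected to \<open>r\<close>.\<close>
  have c_anti: "c q p = - c p q"
    unfolding c_def sum_negf[symmetric]
  proof (rule sum.cong)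
    fix T assume "T \<in> trees"
    then have T: "is_tree V T" by (rule tree_is_tree)
    show "of_bool ({p, q} \<in> T) * (of_bool (reach (T - {{q, p}}) p r) - of_bool (reach (T - {{q, p}}) p p))
      = - (of_bool ({p, q} \<in> T) * (of_bool (reach (T - {{p, q}}) q r) - of_bool (reach (T - {{p, q}}) q p)) :: real)"
    proof (cases "{p, q} \<in> T")
      case True
      have "reach (T - {{p, q}}) r p \<noteq> reach (T - {{p, q}}) r q"
        "reach (T - {{p, q}}) p p \<noteq> reach (T - {{p, q}}) p q"
        using tree_edge_sides[OF T True r] tree_edge_sides[OF T True pq(2)] by auto
      then show ?thesis
        using reach_commute[of "T - {{p, q}}" r p] reach_commute[of "T - {{p, q}}" r q]
          reach_commute[of "T - {{p, q}}" p q]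
        by (cases "reach (T - {{p, q}}) p r") (simp_all add: insert_commute[of q p])
    qed simp
  qed simp
  \<comment> \<open>The combination of Green functions that has the Laplacian found in
    \<open>main\<close> and vanishes at \<open>r\<close>.\<close>
  let ?psi = "\<lambda>x. (tau * resist p q) * green r x p - c p q * (green r x p - green r x q)"
  have lap_eq: "lap (\<lambda>x. ?phi x - ?psi x) x = 0" if "x \<in> V" for x
    unfolding lap_diff lap_mult main[OF that] lap_green[OF that pq(2) r] lap_green[OF that pq(3) r] c_anti
    by (simp add: algebra_simps)
  have phi_psi: "?phi x = ?psi x" if "x \<in> V" for x
  proof -
    have "?phi x - ?psi x = ?phi r - ?psi r"
      using lap_eq that r by (rule harmonic_constant)
    then show ?thesis by (simp add: cnt_def)
  qed
  \<comment> \<open>Every counted forest contains \<open>{p, q}\<close>, so both ends lie on one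
    side: this is the condition that fixes the current.\<close>
  have "?phi p = ?phi q"
    unfolding cnt_def
  proof (rule sum.cong)
    fix F assume "F \<in> biforests"
    show "?W F * of_bool (\<not> reach F p r) * of_bool (\<not> reach F p r) =
        ?W F * of_bool (\<not> reach F q r) * of_bool (\<not> reach F p r)"
    proof (cases "{p, q} \<in> F")
      case True
      then have "reach F p r \<longleftrightarrow> reach F q r" using reach_edge[of p q F] by (simp add: reach_iff_eq)
      then show ?thesis by simp
    qed simp
  qed simp
  then have "?psi p = ?psi q" using phi_psi pq by simp
  then have "tau * resist p q * (green r p p - green r p q)
      = c p q * (green r p p + green r q q - 2 * green r p q)"
    by (simp add: algebra_simps green_sym[of r q p])
  then have "c p q * resist p q = tau * (green r p p - green r p q) * resist p q"
    by (auto simp add: resist_green[OF pq(2,3) r])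
  then have c: "c p q = tau * (green r p p - green r p q)"
    using resist_edge_pos[OF e] by simp
  have "(\<Sum>F\<in>biforests. of_bool ({p, q} \<in> F \<and> \<not> reach F p r)) = ?phi p"
    unfolding cnt_def by (intro sum.cong) auto
  also have "\<dots> = ?psi p" using phi_psi pq by simp
  finally show ?thesis
    unfolding c using tau_pos by (simp add: field_simps power2_eq_square)
qed

text \<open>The quantity S of the overview.\<close>

definition sratio :: real where "sratio = real (card biforests) / tau"

text \<open>Write 1 as vertices minus edges of the component away from \<open>r\<close> and sum over
  all forests: vertices give the diagonal of \<open>green\<close>, edges give
  \<open>contracted_green\<close>. The final 1/2 is there because each edge is met from both
  ends.\<close>

lemma sratio_green:
  assumes r: "r \<in> V"
  shows "sratio = (\<Sum>x\<in>V. green r x x)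
    - (\<Sum>x\<in>V. \<Sum>y\<in>nb x. green r x x * resist x y - (green r x x - green r x y)\<^sup>2) / 2"
proof -
  let ?A = "\<lambda>F. \<Sum>x\<in>V. of_bool (\<not> reach F x r) :: real"
  let ?B = "\<lambda>F. \<Sum>x\<in>V. \<Sum>y\<in>nb x. of_bool ({x, y} \<in> F \<and> \<not> reach F x r) :: real"
  have one: "1 = ?A F - ?B F / 2" if F: "F \<in> biforests" for F
  proof -
    let ?g = "\<lambda>e. of_bool (e \<in> F \<and> (\<forall>v\<in>e. \<not> reach F v r)) :: real"
    have "?B F = (\<Sum>x\<in>V. \<Sum>y\<in>nb x. ?g {x, y})"
    proof (intro sum.cong refl)
      fix x y
      have "{x, y} \<in> F \<Longrightarrow> reach F x r \<longleftrightarrow> reach F y r"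
        using reach_edge[of x y F] by (simp add: reach_iff_eq)
      then show "of_bool ({x, y} \<in> F \<and> \<not> reach F x r) = ?g {x, y}" by auto
    qed
    also have "\<dots> = 2 * (\<Sum>e\<in>E. ?g e)" by (rule sum_handshake)
    also have "(\<Sum>e\<in>E. ?g e) = real (card {e \<in> F. \<forall>v\<in>e. \<not> reach F v r})"
    proof -
      have "{e \<in> F. \<forall>v\<in>e. \<not> reach F v r} = {e \<in> E. e \<in> F \<and> (\<forall>v\<in>e. \<not> reach F v r)}"
        using F by (auto simp: two_forests_def)
      then show ?thesis using finE by (simp add: of_bool_def sum.If_cases Int_def)
    qed
    finally have "?B F = 2 * real (card {e \<in> F. \<forall>v\<in>e. \<not> reach F v r})" .
    moreover have "?A F = real (card {v \<in> V. \<not> reach F v r})"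
      using finV by (simp add: of_bool_def sum.If_cases Int_def)
    ultimately show ?thesis using two_forests_component_card[OF EV finV F r] by simp
  qed
  have "real (card biforests) = (\<Sum>F\<in>biforests. ?A F - ?B F / 2)"
    using one by (simp flip: sum_constant[where y = "1::real", simplified])
  also have "\<dots> = (\<Sum>F\<in>biforests. ?A F) - (\<Sum>F\<in>biforests. ?B F) / 2"
    by (simp add: sum_subtractf sum_divide_distrib)
  also have "(\<Sum>F\<in>biforests. ?A F) = (\<Sum>x\<in>V. \<Sum>F\<in>biforests. of_bool (\<not> reach F x r))"
    by (rule sum.swap)
  also have "\<dots> = (\<Sum>x\<in>V. tau * green r x x)"
    using tau_pos by (intro sum.cong) (auto simp: green_def cnt_def of_bool_conj[symmetric])
  also have "(\<Sum>F\<in>biforests. ?B F)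
      = (\<Sum>x\<in>V. \<Sum>y\<in>nb x. \<Sum>F\<in>biforests. of_bool ({x, y} \<in> F \<and> \<not> reach F x r))"
    by (subst sum.swap, intro sum.cong refl, rule sum.swap)
  also have "\<dots> = (\<Sum>x\<in>V. \<Sum>y\<in>nb x. tau * (green r x x * resist x y - (green r x x - green r x y)\<^sup>2))"
  proof (intro sum.cong refl)
    fix x y assume "y \<in> nb x"
    then have "{x, y} \<in> E" by (simp add: nb_def)
    from contracted_green[OF this r]
    show "(\<Sum>F\<in>biforests. of_bool ({x, y} \<in> F \<and> \<not> reach F x r))
        = tau * (green r x x * resist x y - (green r x x - green r x y)\<^sup>2)"
      using tau_pos by (simp add: field_simps)
  qed
  finally have "real (card biforests) = tau * ((\<Sum>x\<in>V. green r x x)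
    - (\<Sum>x\<in>V. \<Sum>y\<in>nb x. green r x x * resist x y - (green r x x - green r x y)\<^sup>2) / 2)"
    by (simp add: sum_distrib_left right_diff_distrib)
  then show ?thesis using tau_pos by (simp add: sratio_def)
qed

section \<open>Resistance curvature\<close>


definition edge_prob :: "'a set \<Rightarrow> real" where
  "edge_prob e = (\<Sum>T\<in>trees. of_bool (e \<in> T)) / tau"

text \<open>By \<open>lap_green_diag\<close>, half the Laplacian of the diagonal of the Green
  function up to a point charge at the root; the value itself involves no root.\<close>

definition curv :: "'a \<Rightarrow> real" where
  "curv x = 1 - (\<Sum>y\<in>nb x. resist x y) / 2"

text \<open>The root only fixes the origin of the embedding: by \<open>sratio_rho\<close> all
  \<open>r\<close> in \<open>V\<close> give the same value.\<close>

definition rho :: "'a \<Rightarrow> real" where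
  "rho r = (\<Sum>x\<in>V. curv x * green r x x) / 2"

lemma resist_edge_prob: "y \<in> nb x \<Longrightarrow> resist x y = edge_prob {x, y}"
  using resist_edge[of x y] tau_pos by (simp add: nb_def edge_prob_def field_simps)

text \<open>Foster's theorem: every tree has \<open>card V - 1\<close> edges, and the two sums are
  exchanged.\<close>

lemma sum_edge_prob: "(\<Sum>e\<in>E. edge_prob e) = real (card V) - 1"
proof -
  have "(\<Sum>e\<in>E. of_bool (e \<in> T) :: real) = real (card V) - 1" if T: "T \<in> trees" for T
  proof -
    have "T \<subseteq> E" using T by (simp add: spanning_trees_def)
    then have "(\<Sum>e\<in>E. of_bool (e \<in> T) :: real) = real (card T)"
      using finE by (simp add: of_bool_def sum.If_cases Int_absorb1)
    then show ?thesis using card_tree[OF tree_is_tree[OF T] finV] by simp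
  qed
  then have "(\<Sum>T\<in>trees. \<Sum>e\<in>E. of_bool (e \<in> T) :: real) = tau * (real (card V) - 1)"
    by (simp add: tau_def)
  then have "(\<Sum>e\<in>E. \<Sum>T\<in>trees. of_bool (e \<in> T) :: real) = tau * (real (card V) - 1)"
    by (subst sum.swap)
  then show ?thesis
    using tau_pos by (simp add: edge_prob_def flip: sum_divide_distrib)
qed

lemma sum_nb_resist: "(\<Sum>x\<in>V. \<Sum>y\<in>nb x. resist x y) = 2 * (real (card V) - 1)"
proof -
  have "(\<Sum>x\<in>V. \<Sum>y\<in>nb x. resist x y) = (\<Sum>x\<in>V. \<Sum>y\<in>nb x. edge_prob {x, y})"
    by (intro sum.cong refl resist_edge_prob)
  then show ?thesis by (simp add: sum_handshake sum_edge_prob)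
qed

lemma sum_curv: "(\<Sum>x\<in>V. curv x) = 1"
  using sum_nb_resist
  by (simp add: curv_def sum_subtractf diff_divide_distrib flip: sum_divide_distrib)

lemma lap_green_diag:
  assumes "x \<in> V" "r \<in> V"
  shows "lap (\<lambda>x. green r x x) x = 2 * curv x - 2 * of_bool (x = r)"
proof -
  have "lap (\<lambda>x. green r x x) x = (\<Sum>y\<in>nb x. 2 * (green r x x - green r y x) - resist x y)"
    unfolding lap_def
  proof (rule sum.cong)
    fix y assume "y \<in> nb x"
    then have "y \<in> V" using nb_subset by auto
    then show "green r x x - green r y y = 2 * (green r x x - green r y x) - resist x y"
      using resist_green[OF assms(1) _ assms(2), of y] green_sym[of r x y] by simp
  qed simp
  also have "\<dots> = 2 * lap (\<lambda>u. green r u x) x - (\<Sum>y\<in>nb x. resist x y)"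
    by (simp add: lap_def sum_subtractf flip: sum_distrib_left)
  finally show ?thesis
    by (simp add: lap_green[OF assms(1,1,2)] curv_def)
qed

text \<open>With \<open>a x = green r x x\<close>, the bracket of \<open>sratio_green\<close>
  becomes quadratic in \<open>resist x y\<close> and \<open>a x - a y\<close>. The mixed terms
  cancel by symmetry, the linear ones give 2 rho through \<open>curv\<close>, and the energy of
  \<open>a\<close> gives the third rho.\<close>

lemma sratio_rho:
  assumes r: "r \<in> V"
  shows "sratio = 3 * rho r + (\<Sum>x\<in>V. \<Sum>y\<in>nb x. (resist x y)\<^sup>2) / 8"
proof -
  define a where "a x = green r x x" for x
  have ar: "a r = 0" by (simp add: a_def)
  have pt: "green r x x * resist x y - (green r x x - green r x y)\<^sup>2
      = a x * resist x y - ((resist x y)\<^sup>2 + 2 * (a x * resist x y - a y * resist x y)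
          + (a x - a y) * (a x - a y)) / 4"
    if "x \<in> V" "y \<in> nb x" for x y
  proof -
    have "y \<in> V" using nb_subset that(2) by (rule subsetD)
    then have D: "green r x x - green r x y = (resist x y + a x - a y) / 2"
      using resist_green[OF that(1) _ r, of y] by (simp add: a_def)
    show ?thesis unfolding D by (simp add: a_def power2_eq_square field_simps)
  qed
  have 1: "(\<Sum>x\<in>V. \<Sum>y\<in>nb x. a x * resist x y) = (\<Sum>x\<in>V. 2 * (a x * (1 - curv x)))"
    by (simp add: curv_def flip: sum_distrib_left)
  have 2: "(\<Sum>x\<in>V. \<Sum>y\<in>nb x. a y * resist x y) = (\<Sum>x\<in>V. \<Sum>y\<in>nb x. a x * resist x y)"
    by (subst sum_nb_swap) (simp add: resist_sym)
  have 3: "(\<Sum>x\<in>V. \<Sum>y\<in>nb x. (a x - a y) * (a x - a y)) = 4 * (\<Sum>x\<in>V. curv x * a x)"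
  proof -
    have "(\<Sum>x\<in>V. \<Sum>y\<in>nb x. (a x - a y) * (a x - a y)) = 2 * (\<Sum>x\<in>V. a x * lap a x)"
      by (simp add: lap_energy)
    also have "(\<Sum>x\<in>V. a x * lap a x) = (\<Sum>x\<in>V. 2 * (curv x * a x))"
    proof (rule sum.cong)
      fix x assume "x \<in> V"
      from lap_green_diag[OF this r] have "lap a x = 2 * curv x - 2 * of_bool (x = r)"
        by (simp add: a_def[abs_def])
      then show "a x * lap a x = 2 * (curv x * a x)" using ar by (cases "x = r") auto
    qed simp
    finally show ?thesis by (simp add: sum_distrib_left)
  qed
  have "(\<Sum>x\<in>V. \<Sum>y\<in>nb x. green r x x * resist x y - (green r x x - green r x y)\<^sup>2)
      = (\<Sum>x\<in>V. \<Sum>y\<in>nb x. a x * resist x y - ((resist x y)\<^sup>2 + 2 * (a x * resist x y - a y * resist x y)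
          + (a x - a y) * (a x - a y)) / 4)"
    by (intro sum.cong refl pt)
  also have "\<dots> = (\<Sum>x\<in>V. \<Sum>y\<in>nb x. a x * resist x y)
      - ((\<Sum>x\<in>V. \<Sum>y\<in>nb x. (resist x y)\<^sup>2) + 2 * ((\<Sum>x\<in>V. \<Sum>y\<in>nb x. a x * resist x y)
          - (\<Sum>x\<in>V. \<Sum>y\<in>nb x. a y * resist x y))
          + (\<Sum>x\<in>V. \<Sum>y\<in>nb x. (a x - a y) * (a x - a y))) / 4"
    by (simp only: sum_divide_distrib[symmetric] sum_distrib_left[symmetric] sum.distrib sum_subtractf)
  also have "\<dots> = 2 * (\<Sum>x\<in>V. a x) - 2 * (\<Sum>x\<in>V. curv x * a x)
      - ((\<Sum>x\<in>V. \<Sum>y\<in>nb x. (resist x y)\<^sup>2) + 4 * (\<Sum>x\<in>V. curv x * a x)) / 4"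
    unfolding 2 3 unfolding 1
    by (simp add: right_diff_distrib sum_subtractf mult.commute[of "a _"] flip: sum_distrib_left)
  finally show ?thesis
    unfolding sratio_green[OF r] rho_def by (simp add: a_def field_simps)
qed

text \<open>Both sides have the same Laplacian and vanish at \<open>r\<close>. Geometrically, with
  \<open>r\<close> at the origin, the point with weights \<open>curv\<close> is as far from
  \<open>x\<close> as from \<open>r\<close>.\<close>

lemma green_diag_curv:
  assumes "r \<in> V" "x \<in> V"
  shows "green r x x = 2 * (\<Sum>z\<in>V. curv z * green r x z)"
proof -
  let ?m = "\<lambda>x. \<Sum>z\<in>V. curv z * green r x z"
  have "lap ?m x = curv x - of_bool (x = r)" if x: "x \<in> V" for x
  proof -
    have "lap ?m x = (\<Sum>z\<in>V. curv z * (of_bool (x = z) - of_bool (x = r)))"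
      unfolding lap_sum lap_mult using x assms by (intro sum.cong) (auto simp: lap_green)
    also have "\<dots> = (\<Sum>z\<in>V. if x = z then curv z else 0) - (\<Sum>z\<in>V. curv z) * of_bool (x = r)"
      unfolding right_diff_distrib sum_subtractf sum_distrib_right
      by (intro arg_cong2[of _ _ _ _ "(-)"] sum.cong) auto
    finally show ?thesis using x finV by (simp add: sum_curv)
  qed
  then have "lap (\<lambda>x. green r x x - 2 * ?m x) x = 0" if "x \<in> V" for x
    unfolding lap_diff lap_mult using that lap_green_diag[OF that assms(1)] by simp
  from harmonic_constant[OF this assms(2,1)]
  show ?thesis by simp
qed

text \<open>In the Euclidean embedding of the vertices with squared distances \<open>resist\<close>, the weights
  \<open>curv\<close> are the barycentric coordinates of the circumcentre and \<open>rho r\<close> is the squared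
  circumradius, hence the maximum of \<open>(\<Sum>x z. w x * w z * resist x z) / 2\<close> over weights of sum 1.\<close>

lemma rho_max:
  assumes r: "r \<in> V"
  shows "(\<Sum>x\<in>V. \<Sum>z\<in>V. w x * w z * resist x z) / 2 \<le> (\<Sum>x\<in>V. w x)\<^sup>2 * rho r"
proof -
  define c where "c = (\<Sum>x\<in>V. w x)"
  define a where "a x = green r x x" for x
  define P where "P = (\<Sum>x\<in>V. \<Sum>z\<in>V. w x * w z * green r x z)"
  define q where "q = (\<Sum>x\<in>V. w x * a x)"
  have m: "(\<Sum>z\<in>V. curv z * green r x z) = a x / 2" if "x \<in> V" for x
    using green_diag_curv[OF r that] by (simp add: a_def)
  have X1: "(\<Sum>x\<in>V. \<Sum>z\<in>V. w x * curv z * green r x z) = q / 2"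
  proof -
    have "(\<Sum>x\<in>V. \<Sum>z\<in>V. w x * curv z * green r x z) = (\<Sum>x\<in>V. w x * (\<Sum>z\<in>V. curv z * green r x z))"
      by (simp add: sum_distrib_left mult.assoc)
    also have "\<dots> = (\<Sum>x\<in>V. w x * (a x / 2))" by (intro sum.cong) (auto simp: m)
    finally show ?thesis by (simp add: q_def sum_divide_distrib)
  qed
  have X2: "(\<Sum>x\<in>V. \<Sum>z\<in>V. curv x * w z * green r x z) = q / 2"
  proof -
    have "(\<Sum>x\<in>V. \<Sum>z\<in>V. curv x * w z * green r x z) = (\<Sum>z\<in>V. \<Sum>x\<in>V. w z * curv x * green r z x)"
      by (subst sum.swap, intro sum.cong refl) (metis mult.commute green_sym)
    then show ?thesis by (simp only: X1)
  qed
  have X3: "(\<Sum>x\<in>V. \<Sum>z\<in>V. curv x * curv z * green r x z) = rho r"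
  proof -
    have "(\<Sum>x\<in>V. \<Sum>z\<in>V. curv x * curv z * green r x z) = (\<Sum>x\<in>V. curv x * (\<Sum>z\<in>V. curv z * green r x z))"
      by (simp add: sum_distrib_left mult.assoc)
    also have "\<dots> = (\<Sum>x\<in>V. curv x * (a x / 2))" by (intro sum.cong) (auto simp: m)
    finally show ?thesis by (simp add: rho_def a_def sum_divide_distrib)
  qed
  \<comment> \<open>The weights \<open>w - c * curv\<close> have sum 0 and represent the vector from
    \<open>c\<close> times the circumcentre to the point of \<open>w\<close>; the sum is its squared
    length.\<close>
  have "0 \<le> (\<Sum>x\<in>V. \<Sum>z\<in>V. (w x - c * curv x) * (w z - c * curv z) * green r x z)"
    using r by (rule green_psd)
  also have "\<dots> = (\<Sum>x\<in>V. \<Sum>z\<in>V. w x * w z * green r x z - c * (w x * curv z * green r x z)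
      - c * (curv x * w z * green r x z) + c\<^sup>2 * (curv x * curv z * green r x z))"
    by (intro sum.cong refl) (simp add: algebra_simps power2_eq_square)
  also have "\<dots> = P - c * (q / 2) - c * (q / 2) + c\<^sup>2 * rho r"
    unfolding sum.distrib sum_subtractf P_def
    by (simp only: sum_distrib_left[symmetric] X1 X2 X3)
  finally have "c * q - P \<le> c\<^sup>2 * rho r" by simp
  moreover have "(\<Sum>x\<in>V. \<Sum>z\<in>V. w x * w z * resist x z) = 2 * (c * q - P)"
  proof -
    have "(\<Sum>x\<in>V. \<Sum>z\<in>V. w x * w z * resist x z)
        = (\<Sum>x\<in>V. \<Sum>z\<in>V. (w x * a x) * w z + w x * (w z * a z) - 2 * (w x * w z * green r x z))"
      by (intro sum.cong refl) (simp add: resist_green[OF _ _ r] a_def algebra_simps)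
    also have "\<dots> = q * c + c * q - 2 * P"
      unfolding sum.distrib sum_subtractf P_def c_def q_def
      by (simp only: sum_distrib_left[symmetric] sum_distrib_right[symmetric])
    finally show ?thesis by simp
  qed
  ultimately show ?thesis by (simp add: c_def)
qed

lemma resist_self [simp]: "resist x x = 0"
  by (simp add: resist_def)

lemma resist_nonneg: "resist x y \<ge> 0"
  using tau_pos by (auto simp: resist_def intro!: divide_nonneg_pos sum_nonneg)

text \<open>A chord is no longer than a diameter: \<open>rho_max\<close> with unit weights at
  \<open>x\<close> and \<open>y\<close>.\<close>

lemma resist_le_rho:
  assumes "r \<in> V" "x \<in> V" "y \<in> V"
  shows "resist x y \<le> 4 * rho r"
proof -
  let ?w = "\<lambda>z. of_bool (z = x) + of_bool (z = y) :: real"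
  have pick: "(\<Sum>z\<in>V. ?w z * f z) = f x + f y" for f :: "'a \<Rightarrow> real"
  proof -
    have "(\<Sum>z\<in>V. ?w z * f z) = (\<Sum>z\<in>V. (if z = x then f z else 0) + (if z = y then f z else 0))"
      by (intro sum.cong) auto
    then show ?thesis using assms finV by (simp add: sum.distrib)
  qed
  have "(\<Sum>u\<in>V. \<Sum>z\<in>V. ?w u * ?w z * resist u z) = (\<Sum>u\<in>V. ?w u * (resist u x + resist u y))"
    by (simp only: mult.assoc sum_distrib_left[symmetric] pick)
  also have "\<dots> = 2 * resist x y"
    unfolding pick by (simp add: resist_sym[of y x])
  finally show ?thesis
    using rho_max[OF assms(1), of ?w] pick[of "\<lambda>_. 1"] by simp
qed

text \<open>Uniform weights in \<open>rho_max\<close>; only pairs joined by an edge are kept, and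
  Foster's theorem sums their resistances.\<close>

lemma rho_ge:
  assumes r: "r \<in> V"
  shows "rho r \<ge> (real (card V) - 1) / (real (card V))\<^sup>2"
proof -
  have n: "card V > 0" using r finV by (auto simp: card_gt_0_iff)
  have "2 * (real (card V) - 1) \<le> (\<Sum>x\<in>V. \<Sum>z\<in>V. resist x z)"
    unfolding sum_nb_resist[symmetric]
    by (intro sum_mono sum_mono2 finV nb_subset resist_nonneg)
  then show ?thesis
    using rho_max[OF r, of "\<lambda>_. 1"] n by (simp add: divide_le_eq mult.commute)
qed

lemma sratio_ge:
  assumes r: "r \<in> V" and m: "card E > 0"
  shows "sratio \<ge> 3 * rho r + (real (card V) - 1)\<^sup>2 / (4 * real (card E))"
proof -
  have "(\<Sum>x\<in>V. \<Sum>y\<in>nb x. (resist x y)\<^sup>2) = (\<Sum>x\<in>V. \<Sum>y\<in>nb x. (edge_prob {x, y})\<^sup>2)"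
    by (intro sum.cong refl) (simp add: resist_edge_prob)
  also have "\<dots> = 2 * (\<Sum>e\<in>E. (edge_prob e)\<^sup>2)"
    by (rule sum_handshake)
  finally have 1: "(\<Sum>x\<in>V. \<Sum>y\<in>nb x. (resist x y)\<^sup>2) = 2 * (\<Sum>e\<in>E. (edge_prob e)\<^sup>2)" .
  have "(real (card V) - 1)\<^sup>2 \<le> (\<Sum>e\<in>E. (edge_prob e)\<^sup>2) * real (card E)"
    using sum_squared_le_sum_of_squares[of edge_prob E] by (simp add: sum_edge_prob)
  then have "(real (card V) - 1)\<^sup>2 / real (card E) \<le> (\<Sum>e\<in>E. (edge_prob e)\<^sup>2)"
    using m by (simp add: divide_le_eq)
  then show ?thesis unfolding sratio_rho[OF r] 1 by simp
qed

section \<open>Cuts between the two components\<close>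

definition cut :: "'a set set \<Rightarrow> 'a set set" where
  "cut F = {e \<in> E. \<exists>u v. e = {u, v} \<and> \<not> reach F u v}"

lemma finite_cut: "finite (cut F)"
  using finE by (auto simp: cut_def)

lemma tree_meets_cut:
  assumes "T \<in> trees" "F \<in> biforests"
  shows "T \<inter> cut F \<noteq> {}"
proof
  assume empty: "T \<inter> cut F = {}"
  have "T \<subseteq> E" using assms by (simp add: spanning_trees_def)
  then have step: "reach F u v" if "{u, v} \<in> T" for u v
    using that empty by (auto simp: cut_def)
  from assms(2) obtain x y where xy: "x \<in> V" "y \<in> V" "\<not> reach F x y"
    unfolding two_forests_def by blast
  have "reach T x y" using assms(1) xy by (auto simp: spanning_trees_def connected_graph_reach)
  then have "reach F x y"
  proof (induction rule: reach_induct)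
    case (step u v)
    then show ?case using \<open>\<And>u v. {u, v} \<in> T \<Longrightarrow> reach F u v\<close>[of u v] by (simp add: reach_iff_eq)
  qed simp
  with xy show False by simp
qed

text \<open>Every spanning tree meets the cut, so the edge probabilities over it add up to at least
  1, while each is at most \<open>4 * rho r\<close>.\<close>

lemma cut_rho:
  assumes "r \<in> V" "F \<in> biforests"
  shows "1 \<le> 4 * rho r * real (card (cut F))" "cut F \<noteq> {}"
proof -
  have "1 \<le> (\<Sum>e\<in>cut F. of_bool (e \<in> T) :: real)" if T: "T \<in> trees" for T
  proof -
    obtain e where "e \<in> cut F" "e \<in> T" using tree_meets_cut[OF T assms(2)] by auto
    then show ?thesis
      using member_le_sum[of e "cut F" "\<lambda>e. of_bool (e \<in> T) :: real"] finite_cut by simp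
  qed
  then have "tau \<le> (\<Sum>T\<in>trees. \<Sum>e\<in>cut F. of_bool (e \<in> T))"
    unfolding tau_def using sum_mono[of trees "\<lambda>_. 1::real"] by simp
  also have "\<dots> = (\<Sum>e\<in>cut F. tau * edge_prob e)"
    using tau_pos by (subst sum.swap) (simp add: edge_prob_def)
  finally have "1 \<le> (\<Sum>e\<in>cut F. edge_prob e)"
    using tau_pos by (simp flip: sum_distrib_left)
  also have "\<dots> \<le> (\<Sum>e\<in>cut F. 4 * rho r)"
  proof (rule sum_mono)
    fix e assume "e \<in> cut F"
    then obtain u v where e: "e = {u, v}" "{u, v} \<in> E" by (auto simp: cut_def)
    then show "edge_prob e \<le> 4 * rho r"
      using resist_le_rho[OF assms(1) edgeD(2,3)[OF e(2)]] resist_edge_prob[of v u]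
      by (simp add: nb_def)
  qed
  finally show "1 \<le> 4 * rho r * real (card (cut F))" by (simp add: mult.commute)
  then show "cut F \<noteq> {}" by auto
qed

end

section \<open>Forests versus trees\<close>

text \<open>The quadratic term produces the loss: at u = 1/c, multiplied by the c ways of completing
  a forest to a tree, it leaves 1 - 1/(2c) in \<open>ratio_ge_exp\<close>.\<close>

lemma ln_ge_quadratic:
  fixes u :: real
  assumes "u \<ge> 0"
  shows "u - u\<^sup>2 / 2 \<le> ln (1 + u)"
proof -
  have "ln (1 + 0) - 0 + 0\<^sup>2 / 2 \<le> ln (1 + u) - u + u\<^sup>2 / 2"
  proof (rule DERIV_nonneg_imp_nondecreasing[OF assms])
    fix x :: real assume x: "0 \<le> x" "x \<le> u"
    have "((\<lambda>u. ln (1 + u) - u + u\<^sup>2 / 2) has_real_derivative 1 / (1 + x) - 1 + x) (at x)"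
      using x by (auto intro!: derivative_eq_intros)
    moreover have "1 / (1 + x) - 1 + x = x\<^sup>2 / (1 + x)"
      using x by (simp add: field_simps power2_eq_square)
    then have "0 \<le> 1 / (1 + x) - 1 + x" using x by simp
    ultimately show "\<exists>y. ((\<lambda>u. ln (1 + u) - u + u\<^sup>2 / 2) has_real_derivative y) (at x) \<and> 0 \<le> y"
      by blast
  qed
  then show ?thesis by simp
qed

text \<open>Jensen's inequality for exp, from the tangent line at the mean.\<close>

lemma exp_mean_le:
  fixes f :: "'b \<Rightarrow> real"
  assumes "finite S" "S \<noteq> {}"
  shows "real (card S) * exp ((\<Sum>x\<in>S. f x) / real (card S)) \<le> (\<Sum>x\<in>S. exp (f x))"
proof -
  let ?a = "(\<Sum>x\<in>S. f x) / real (card S)"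
  have n: "real (card S) > 0" using assms by (simp add: card_gt_0_iff)
  have tangent: "exp ?a * (1 + (f x - ?a)) \<le> exp (f x)" for x
    using mult_left_mono[OF exp_ge_add_one_self[of "f x - ?a"], of "exp ?a"]
    by (simp flip: exp_add)
  have "(\<Sum>x\<in>S. exp ?a * (1 + (f x - ?a))) = exp ?a * (real (card S) + ((\<Sum>x\<in>S. f x) - real (card S) * ?a))"
    by (simp add: sum_subtractf sum.distrib flip: sum_distrib_left)
  also have "\<dots> = real (card S) * exp ?a" using n by simp
  finally show ?thesis using sum_mono[of S "\<lambda>x. exp ?a * (1 + (f x - ?a))" "\<lambda>x. exp (f x)"] tangent
    by simp
qed

lemma of_bool_le_if: "(P \<Longrightarrow> Q) \<Longrightarrow> (of_bool P :: real) \<le> (if Q then 1 else 0)"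
  by auto

context conn_graph
begin

section \<open>Exchange of tree edges\<close>

lemma biforest_if_remove:
  assumes "T \<in> trees" "e \<in> T"
  shows "T - {e} \<in> biforests" "e \<in> cut (T - {e})"
proof -
  have TE: "T \<subseteq> E" using assms(1) by (simp add: spanning_trees_def)
  with EV assms(2) obtain x y where e: "e = {x, y}" by (blast elim: complete_edgesE)
  note rem = spanning_trees_remove[OF EV assms(1), of x y]
  show "T - {e} \<in> biforests" using rem(1) assms(2) e by simp
  show "e \<in> cut (T - {e})" using rem(2) assms(2) e TE unfolding cut_def by blast
qed

lemma cut_iff:
  assumes "{u, v} \<in> E"
  shows "{u, v} \<in> cut F \<longleftrightarrow> \<not> reach F u v"
proof
  assume "{u, v} \<in> cut F"
  then obtain x y where "{u, v} = {x, y}" "\<not> reach F x y" unfolding cut_def by blast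
  then show "\<not> reach F u v" using reach_commute[of F u v] by (auto simp: doubleton_eq_iff)
next
  assume "\<not> reach F u v"
  then show "{u, v} \<in> cut F" using assms unfolding cut_def by blast
qed

lemma cut_disjoint: "F \<inter> cut F = {}"
proof -
  have False if "e \<in> F" "e \<in> cut F" for e
  proof -
    from that(2) obtain u v where "e = {u, v}" "\<not> reach F u v" unfolding cut_def by blast
    then show False using that(1) reach_edge[of u v F] by simp
  qed
  then show ?thesis by blast
qed

text \<open>The exchanged edge is the first one at which the path of \<open>T'\<close> between the ends of \<open>e\<close> leaves
  its component of \<open>T - {e}\<close>.\<close>

lemma tree_exchange:
  assumes T: "T \<in> trees" "e \<in> T" and T': "T' \<in> trees" "e \<notin> T'"
  shows "\<exists>f\<in>T' \<inter> cut (T - {e}). insert e (T' - {f}) \<in> trees"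
proof -
  let ?F = "T - {e}"
  have TE: "T \<subseteq> E" "T' \<subseteq> E" using T(1) T'(1) by (auto simp: spanning_trees_def)
  with EV T(2) obtain x y where e: "e = {x, y}" by (blast elim: complete_edgesE)
  have eE: "{x, y} \<in> E" using T(2) TE e by auto
  note xy = edgeD[OF eE]
  have sep: "\<not> reach ?F x y"
    using spanning_trees_remove(2)[OF EV T(1), of x y] T(2) e by simp
  have "reach T' x y" using T'(1) xy by (auto simp: spanning_trees_def connected_graph_reach)
  from reach_imp_path[OF this] obtain p where p: "distinct p" "p \<noteq> []" "hd p = x" "last p = y"
    and pe0: "\<forall>i. Suc i < length p \<longrightarrow> {p ! i, p ! Suc i} \<in> T'"
    by (elim exE conjE)
  have pe: "{p ! i, p ! Suc i} \<in> T'" if "Suc i < length p" for i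
    using pe0 that by simp
  define k where "k = length p - 1"
  have k: "Suc k = length p" using p(2) by (simp add: k_def)
  have p0: "p ! 0 = x" using p(2,3) by (simp add: hd_conv_nth)
  have pk: "p ! k = y" using p(2,4) by (simp add: last_conv_nth k_def)
  have "\<exists>i<k. reach ?F x (p ! i) \<and> \<not> reach ?F x (p ! Suc i)"
  proof (rule ccontr)
    assume none: "\<not> (\<exists>i<k. reach ?F x (p ! i) \<and> \<not> reach ?F x (p ! Suc i))"
    have "i \<le> k \<longrightarrow> reach ?F x (p ! i)" for i
    proof (induction i)
      case 0
      show ?case by (simp add: p0)
    next
      case (Suc i)
      then show ?case using none by auto
    qed
    then have "reach ?F x y" using pk by blast
    with sep show False by simp
  qed
  then obtain i where i: "i < k" "reach ?F x (p ! i)" "\<not> reach ?F x (p ! Suc i)" by blast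
  let ?u = "p ! i" and ?v = "p ! Suc i"
  let ?f = "{?u, ?v}"
  have f: "?f \<in> T'" using pe[of i] i(1) k by simp
  have fE: "?f \<in> E" using f TE by auto
  have inj: "p ! a = p ! b \<longleftrightarrow> a = b" if "a \<le> k" "b \<le> k" for a b
    using that k by (intro nth_eq_iff_index_eq p(1)) auto
  have seg: "{p ! l, p ! Suc l} \<in> T' - {?f}" if "l < k" "l \<noteq> i" for l
    using that i(1) k pe[of l] by (auto simp: doubleton_eq_iff inj)
  \<comment> \<open>Both end pieces of the path survive without \<open>{?u, ?v}\<close>; were
    \<open>x\<close> and \<open>y\<close> still connected, \<open>?u\<close> and \<open>?v\<close>
    would be too.\<close>
  have xu: "reach (T' - {?f}) (p ! 0) ?u"
    by (rule reach_path) (use i(1) k seg in auto)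
  have vy: "reach (T' - {?f}) ?v (p ! k)"
    by (rule reach_path) (use i(1) k seg in auto)
  have bi: "T' - {?f} \<in> biforests" "\<not> reach (T' - {?f}) ?u ?v"
    using spanning_trees_remove[OF EV T'(1) f] by auto
  have "\<not> reach (T' - {?f}) x y"
    using xu vy bi(2) by (simp add: p0 pk reach_iff_eq)
  from two_forests_insert(1)[OF bi(1) xy(2,3) this eE]
  have "insert e (T' - {?f}) \<in> trees" by (simp add: e)
  moreover have "\<not> reach ?F ?u ?v" using i(2,3) by (simp add: reach_iff_eq)
  then have "?f \<in> cut ?F" using fE by (simp add: cut_iff)
  ultimately show ?thesis using f by blast
qed

text \<open>Undoing the exchange recovers \<open>T'\<close>, so the pairs of a cut edge
  \<open>f\<close> and a tree through \<open>e\<close> cover all \<open>T'\<close>; those containing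
  \<open>e\<close> arise with \<open>f = e\<close>. The cut is disjoint from \<open>T - {e}\<close>,
  hence \<open>A\<close> survives the exchange.\<close>

lemma card_trees_superset_step:
  assumes T: "T \<in> trees" "e \<in> T" and A: "A \<subseteq> T" "e \<notin> A"
  shows "card {T' \<in> trees. A \<subseteq> T'} \<le> card (cut (T - {e})) * card {T' \<in> trees. insert e A \<subseteq> T'}"
proof -
  let ?C = "cut (T - {e})" and ?X = "{T' \<in> trees. insert e A \<subseteq> T'}"
  have finX: "finite ?X" by (rule finite_subset[OF _ finite_trees]) auto
  have "{T' \<in> trees. A \<subseteq> T'} \<subseteq> (\<lambda>(f, T''). insert f (T'' - {e})) ` (?C \<times> ?X)"
  proof
    fix T' assume "T' \<in> {T' \<in> trees. A \<subseteq> T'}"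
    then have T': "T' \<in> trees" "A \<subseteq> T'" by auto
    show "T' \<in> (\<lambda>(f, T''). insert f (T'' - {e})) ` (?C \<times> ?X)"
    proof (cases "e \<in> T'")
      case True
      then have "T' = (\<lambda>(f, T''). insert f (T'' - {e})) (e, T')" by auto
      moreover have "(e, T') \<in> ?C \<times> ?X" using True T' biforest_if_remove(2)[OF T] by auto
      ultimately show ?thesis by (rule image_eqI)
    next
      case False
      from tree_exchange[OF T T'(1) this] obtain f
        where f: "f \<in> T'" "f \<in> ?C" "insert e (T' - {f}) \<in> trees" by blast
      have "f \<notin> A" using f(2) cut_disjoint[of "T - {e}"] A by auto
      then have "(f, insert e (T' - {f})) \<in> ?C \<times> ?X" using f T' by auto
      moreover have "T' = (\<lambda>(f, T''). insert f (T'' - {e})) (f, insert e (T' - {f}))"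
        using f False by auto
      ultimately show ?thesis by (rule rev_image_eqI)
    qed
  qed
  then have "card {T' \<in> trees. A \<subseteq> T'} \<le> card (?C \<times> ?X)"
    using finite_cut finX by (intro surj_card_le) auto
  then show ?thesis by (simp add: card_cartesian_product)
qed

lemma tree_subset_eq:
  assumes "T \<in> trees" "T' \<in> trees" "T \<subseteq> T'"
  shows "T = T'"
proof (rule card_subset_eq[OF _ assms(3)])
  show "finite T'" using tree_finite[OF tree_is_tree[OF assms(2)] finV] .
  show "card T = card T'"
    using card_tree[OF tree_is_tree[OF assms(1)] finV] card_tree[OF tree_is_tree[OF assms(2)] finV] by simp
qed

text \<open>\<open>B\<close> is put back edge by edge at the cost of one factor each, and only
  \<open>T\<close> itself contains all of \<open>T\<close>.\<close>

lemma card_trees_superset: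
  assumes T: "T \<in> trees" and B: "B \<subseteq> T"
  shows "real (card {T' \<in> trees. T - B \<subseteq> T'}) \<le> (\<Prod>e\<in>B. real (card (cut (T - {e}))))"
proof -
  have "finite B" using B tree_finite[OF tree_is_tree[OF T] finV] by (rule finite_subset)
  then show ?thesis using B
  proof (induction B rule: finite_induct)
    case empty
    have "{T' \<in> trees. T - {} \<subseteq> T'} = {T}" using T tree_subset_eq by auto
    then show ?case by simp
  next
    case (insert e B)
    then have eq: "insert e (T - insert e B) = T - B" by auto
    have "card {T' \<in> trees. T - insert e B \<subseteq> T'} \<le> card (cut (T - {e})) * card {T' \<in> trees. T - B \<subseteq> T'}"
      using card_trees_superset_step[OF T, of e "T - insert e B"] insert.prems by (simp add: eq)
    then have "real (card {T' \<in> trees. T - insert e B \<subseteq> T'})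
        \<le> real (card (cut (T - {e}))) * real (card {T' \<in> trees. T - B \<subseteq> T'})"
      by (simp flip: of_nat_mult)
    also have "\<dots> \<le> real (card (cut (T - {e}))) * (\<Prod>e\<in>B. real (card (cut (T - {e}))))"
      using insert by (intro mult_left_mono) auto
    finally show ?case using insert by simp
  qed
qed

section \<open>Counting forests by the trees that contain them\<close>

lemma finite_forests: "finite (spanning_forests E)"
proof (rule finite_subset)
  show "spanning_forests E \<subseteq> Pow E" by (auto simp: spanning_forests_def)
qed (simp add: finE)

text \<open>Each forest distributes weight 1 evenly over the trees containing it. A tree then
  receives a sum over its subsets, which dominates the expanded product by
  \<open>card_trees_superset\<close>.\<close>

lemma forests_ge_product:
  "(\<Sum>T\<in>trees. \<Prod>e\<in>T. 1 + 1 / real (card (cut (T - {e})))) \<le> real (card (spanning_forests E))"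
proof -
  let ?N = "\<lambda>A. real (card {T' \<in> trees. A \<subseteq> T'})"
  have "(\<Prod>e\<in>T. 1 + 1 / real (card (cut (T - {e})))) \<le> (\<Sum>A | A \<in> spanning_forests E \<and> A \<subseteq> T. 1 / ?N A)"
    if T: "T \<in> trees" for T
  proof -
    have finT: "finite T" using tree_finite[OF tree_is_tree[OF T] finV] .
    have "(\<Prod>e\<in>T. 1 + 1 / real (card (cut (T - {e}))))
        = (\<Sum>A\<in>Pow T. (\<Prod>e\<in>T - A. 1 / real (card (cut (T - {e})))))"
      using prod_add[OF finT, of "\<lambda>_. 1" "\<lambda>e. 1 / real (card (cut (T - {e})))"] by simp
    also have "\<dots> \<le> (\<Sum>A\<in>Pow T. 1 / ?N A)"
    proof (rule sum_mono)
      fix A assume A: "A \<in> Pow T"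
      then have eq: "T - (T - A) = A" by auto
      have fin: "finite {T' \<in> trees. A \<subseteq> T'}" by (rule finite_subset[OF _ finite_trees]) auto
      have "T \<in> {T' \<in> trees. A \<subseteq> T'}" using T A by auto
      then have "?N A > 0" using fin by (auto simp: card_gt_0_iff)
      moreover have "?N A \<le> (\<Prod>e\<in>T - A. real (card (cut (T - {e}))))"
        using card_trees_superset[OF T, of "T - A"] eq by simp
      ultimately have "1 / (\<Prod>e\<in>T - A. real (card (cut (T - {e})))) \<le> 1 / ?N A"
        by (intro divide_left_mono) auto
      then show "(\<Prod>e\<in>T - A. 1 / real (card (cut (T - {e})))) \<le> 1 / ?N A"
        by (simp add: prod_dividef)
    qed
    also have "Pow T = {A. A \<in> spanning_forests E \<and> A \<subseteq> T}"
      using T by (auto simp: spanning_forests_def spanning_trees_def intro: cycle_free_mono)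
    finally show ?thesis .
  qed
  then have "(\<Sum>T\<in>trees. \<Prod>e\<in>T. 1 + 1 / real (card (cut (T - {e}))))
      \<le> (\<Sum>T\<in>trees. \<Sum>A | A \<in> spanning_forests E \<and> A \<subseteq> T. 1 / ?N A)"
    by (rule sum_mono)
  also have "\<dots> = (\<Sum>A\<in>spanning_forests E. \<Sum>T | T \<in> trees \<and> A \<subseteq> T. 1 / ?N A)"
    by (rule sum.swap_restrict[OF finite_trees finite_forests])
  also have "\<dots> = (\<Sum>A\<in>spanning_forests E. 1)"
  proof (rule sum.cong)
    fix A assume "A \<in> spanning_forests E"
    then have "\<exists>T\<in>trees. A \<subseteq> T"
      using finE EV conn by (intro cycle_free_extend) (auto simp: spanning_forests_def)
    then have "{T' \<in> trees. A \<subseteq> T'} \<noteq> {}" by auto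
    moreover have "finite {T' \<in> trees. A \<subseteq> T'}" by (rule finite_subset[OF _ finite_trees]) auto
    ultimately show "(\<Sum>T | T \<in> trees \<and> A \<subseteq> T. 1 / ?N A) = 1" by simp
  qed simp
  finally show ?thesis by simp
qed

text \<open>A forest \<open>F\<close> arises from one tree for each edge of its cut; this turns the
  mean over trees in Jensen's inequality into a sum over \<open>biforests\<close>.\<close>

lemma sum_tree_edges:
  fixes g :: "'a set set \<Rightarrow> real"
  shows "(\<Sum>T\<in>trees. \<Sum>e\<in>T. g (T - {e})) = (\<Sum>F\<in>biforests. real (card (cut F)) * g F)"
proof -
  have "(\<Sum>T\<in>trees. \<Sum>e\<in>T. g (T - {e})) = (\<Sum>T\<in>trees. \<Sum>e | e \<in> E \<and> e \<in> T. g (T - {e}))"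
  proof (rule sum.cong)
    fix T assume "T \<in> trees"
    then have "{e. e \<in> E \<and> e \<in> T} = T" by (auto simp: spanning_trees_def)
    then show "(\<Sum>e\<in>T. g (T - {e})) = (\<Sum>e | e \<in> E \<and> e \<in> T. g (T - {e}))" by simp
  qed simp
  also have "\<dots> = (\<Sum>e\<in>E. \<Sum>T | T \<in> trees \<and> e \<in> T. g (T - {e}))"
    by (rule sum.swap_restrict[OF finite_trees finE])
  also have "\<dots> = (\<Sum>e\<in>E. \<Sum>F | F \<in> biforests \<and> e \<in> cut F. g F)"
  proof (rule sum.cong)
    fix e assume eE: "e \<in> E"
    with EV obtain u v where e: "e = {u, v}" by (blast elim: complete_edgesE)
    show "(\<Sum>T | T \<in> trees \<and> e \<in> T. g (T - {e})) = (\<Sum>F | F \<in> biforests \<and> e \<in> cut F. g F)"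
      using sum_edge_exchange[OF EV, of u v g] eE by (simp add: e cut_iff)
  qed simp
  also have "\<dots> = (\<Sum>F\<in>biforests. \<Sum>e | e \<in> E \<and> e \<in> cut F. g F)"
    by (rule sum.swap_restrict[OF finE finite_biforests])
  also have "\<dots> = (\<Sum>F\<in>biforests. real (card (cut F)) * g F)"
  proof (rule sum.cong)
    fix F
    have "{e. e \<in> E \<and> e \<in> cut F} = cut F" by (auto simp: cut_def)
    then show "(\<Sum>e | e \<in> E \<and> e \<in> cut F. g F) = real (card (cut F)) * g F" by simp
  qed simp
  finally show ?thesis .
qed

lemma ratio_ge_exp:
  assumes r: "r \<in> V"
  shows "exp ((\<Sum>F\<in>biforests. 1 - 1 / (2 * real (card (cut F)))) / tau) \<le> forest_tree_ratio V E"
proof -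
  let ?u = "\<lambda>F. 1 / real (card (cut F))"
  let ?g = "\<lambda>F. ?u F - (?u F)\<^sup>2 / 2"
  have ne: "trees \<noteq> {}" using tau_pos by (auto simp: tau_def)
  have "exp (\<Sum>e\<in>T. ?g (T - {e})) \<le> (\<Prod>e\<in>T. 1 + ?u (T - {e}))" if "T \<in> trees" for T
  proof -
    have finT: "finite T" using tree_finite[OF tree_is_tree[OF that] finV] .
    have "exp (?g F) \<le> 1 + ?u F" for F
    proof -
      have pos: "0 < 1 + ?u F" by (intro add_pos_nonneg) auto
      have "exp (?g F) \<le> exp (ln (1 + ?u F))"
        by (subst exp_le_cancel_iff) (rule ln_ge_quadratic, simp)
      then show ?thesis using pos by simp
    qed
    then show ?thesis unfolding exp_sum[OF finT] by (intro prod_mono) auto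
  qed
  then have "(\<Sum>T\<in>trees. exp (\<Sum>e\<in>T. ?g (T - {e}))) \<le> (\<Sum>T\<in>trees. \<Prod>e\<in>T. 1 + ?u (T - {e}))"
    by (rule sum_mono)
  also have "\<dots> \<le> real (card (spanning_forests E))" by (rule forests_ge_product)
  finally have "real (card trees) * exp ((\<Sum>T\<in>trees. \<Sum>e\<in>T. ?g (T - {e})) / real (card trees))
      \<le> real (card (spanning_forests E))"
    using exp_mean_le[OF finite_trees ne, of "\<lambda>T. \<Sum>e\<in>T. ?g (T - {e})"] by linarith
  moreover have "(\<Sum>T\<in>trees. \<Sum>e\<in>T. ?g (T - {e})) = (\<Sum>F\<in>biforests. 1 - 1 / (2 * real (card (cut F))))"
    unfolding sum_tree_edges[of ?g]
  proof (rule sum.cong)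
    fix F assume "F \<in> biforests"
    then have "card (cut F) > 0" using cut_rho(2)[OF r] finite_cut by (auto simp: card_gt_0_iff)
    then show "real (card (cut F)) * ?g F = 1 - 1 / (2 * real (card (cut F)))"
      by (simp add: field_simps power2_eq_square)
  qed simp
  ultimately show ?thesis
    using tau_pos by (simp add: forest_tree_ratio_def tau_def le_divide_eq mult.commute)
qed

text \<open>Counts only forests with one or two components, which is enough in
  \<open>ratio_lower\<close> when \<open>sratio\<close> is at least 7/10.\<close>

lemma ratio_ge_sratio: "1 + sratio \<le> forest_tree_ratio V E"
proof -
  have "trees \<inter> biforests = {}"
    unfolding spanning_trees_def two_forests_def connected_graph_reach by blast
  then have "card trees + card biforests = card (trees \<union> biforests)"
    using finite_trees finite_biforests by (simp add: card_Un_disjoint)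
  also have "\<dots> \<le> card (spanning_forests E)"
  proof (rule card_mono[OF finite_forests])
    show "trees \<union> biforests \<subseteq> spanning_forests E"
      unfolding spanning_forests_def spanning_trees_def two_forests_def by blast
  qed
  finally have "tau + real (card biforests) \<le> real (card (spanning_forests E))"
    unfolding tau_def by linarith
  then have "(tau + real (card biforests)) / tau \<le> real (card (spanning_forests E)) / tau"
    using tau_pos by (intro divide_right_mono) auto
  then show ?thesis
    using tau_pos unfolding forest_tree_ratio_def sratio_def tau_def[symmetric]
    by (simp add: add_divide_distrib)
qed

text \<open>Weighting by the cut size turns the sum into a count of pairs of a tree and an edge
  whose removal isolates \<open>x\<close>; then \<open>x\<close> is a leaf, and its tree has only
  one such edge.\<close>

lemma sum_cut_isolated:
  assumes x: "x \<in> V" and n: "card V \<ge> 2"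
  shows "(\<Sum>F\<in>biforests. of_bool (\<forall>y\<in>V. y \<noteq> x \<longrightarrow> \<not> reach F x y) * real (card (cut F))) \<le> tau"
proof -
  let ?iso = "\<lambda>F. \<forall>y\<in>V. y \<noteq> x \<longrightarrow> \<not> reach F x y"
  have "(\<Sum>e\<in>T. of_bool (?iso (T - {e})) :: real) \<le> 1" if T: "T \<in> trees" for T
  proof -
    have finT: "finite T" using tree_finite[OF tree_is_tree[OF T] finV] .
    have "\<exists>y\<in>V. y \<noteq> x"
    proof (rule ccontr)
      assume "\<not> (\<exists>y\<in>V. y \<noteq> x)"
      then have "V = {x}" using x by blast
      then show False using n by simp
    qed
    then obtain y where y: "y \<in> V" "y \<noteq> x" by blast
    have "reach T x y" using T x y by (auto simp: spanning_trees_def connected_graph_reach)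
    from reach_first_edge[OF this] y obtain z where z: "{x, z} \<in> T" by auto
    then have "{x, z} \<in> E" using T by (auto simp: spanning_trees_def)
    note xz = edgeD[OF this]
    have iso: "e = {x, z}" if "?iso (T - {e})" for e
    proof (rule ccontr)
      assume "e \<noteq> {x, z}"
      then have "reach (T - {e}) x z" using z by (intro reach_edge) auto
      with that xz show False by auto
    qed
    have "(\<Sum>e\<in>T. of_bool (?iso (T - {e})) :: real) \<le> (\<Sum>e\<in>T. if e = {x, z} then 1 else 0)"
    proof (rule sum_mono)
      fix e
      show "(of_bool (?iso (T - {e})) :: real) \<le> (if e = {x, z} then 1 else 0)"
      proof (rule of_bool_le_if)
        show "?iso (T - {e}) \<Longrightarrow> e = {x, z}" by (rule iso)
      qed
    qed
    then show ?thesis using finT z by simp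
  qed
  then have "(\<Sum>T\<in>trees. \<Sum>e\<in>T. of_bool (?iso (T - {e})) :: real) \<le> (\<Sum>T\<in>trees. 1)"
    by (rule sum_mono)
  then show ?thesis
    unfolding sum_tree_edges[of "\<lambda>F. of_bool (?iso F)"] by (simp add: tau_def mult.commute)
qed

end

section \<open>Abel identities and Gaussian moments\<close>

text \<open>The n-th finite difference of a polynomial of degree below n. The induction splits off a
  factor x + k and absorbs k into the binomial coefficient.\<close>

lemma alternating_binomial_power_sum:
  fixes x :: real
  shows "j < n \<Longrightarrow> (\<Sum>k\<le>n. (-1) ^ k * real (n choose k) * (x + real k) ^ j) = 0"
proof (induction j arbitrary: n x)
  case 0
  then show ?case using choose_alternating_sum[of n, where 'a = real] by simp
next
  case (Suc j)
  then obtain m where n: "n = Suc m" and jm: "j < m" by (cases n) auto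
  have "(\<Sum>k\<le>n. (-1) ^ k * real (n choose k) * (x + real k) ^ Suc j)
      = (\<Sum>k\<le>n. x * ((-1) ^ k * real (n choose k) * (x + real k) ^ j)
          + (-1) ^ k * (real k * real (n choose k)) * (x + real k) ^ j)"
    by (intro sum.cong refl) (simp add: algebra_simps)
  also have "\<dots> = x * (\<Sum>k\<le>n. (-1) ^ k * real (n choose k) * (x + real k) ^ j)
          + (\<Sum>k\<le>n. (-1) ^ k * (real k * real (n choose k)) * (x + real k) ^ j)"
    by (simp only: sum.distrib sum_distrib_left)
  also have "(\<Sum>k\<le>n. (-1) ^ k * real (n choose k) * (x + real k) ^ j) = 0"
    using Suc.prems by (intro Suc.IH) simp
  also have "(\<Sum>k\<le>n. (-1) ^ k * (real k * real (n choose k)) * (x + real k) ^ j)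
      = (\<Sum>k\<le>m. (-1) ^ Suc k * (real (Suc k) * real (Suc m choose Suc k)) * (x + real (Suc k)) ^ j)"
    unfolding n by (subst sum.atMost_Suc_shift) simp
  also have "\<dots> = (\<Sum>k\<le>m. - real (Suc m) * ((-1) ^ k * real (m choose k) * ((x + 1) + real k) ^ j))"
  proof (intro sum.cong refl)
    fix k
    have "real (Suc k) * real (Suc m choose Suc k) = real (Suc m) * real (m choose k)"
      unfolding of_nat_mult[symmetric] by (simp only: Suc_times_binomial)
    then show "(-1) ^ Suc k * (real (Suc k) * real (Suc m choose Suc k)) * (x + real (Suc k)) ^ j
        = - real (Suc m) * ((-1) ^ k * real (m choose k) * ((x + 1) + real k) ^ j)"
      by (simp only:) (simp add: algebra_simps)
  qed
  also have "\<dots> = 0"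
    unfolding sum_distrib_left[symmetric] using Suc.IH[OF jm, of "x + 1"] by simp
  finally show ?case by simp
qed

lemma mult_rearrange:
  fixes a b c d e f :: real
  assumes "a * b = c * d"
  shows "b * e * (a * f) = c * (d * e * f)"
proof -
  have "b * e * (a * f) = (a * b) * (e * f)" by (simp add: mult_ac)
  also have "\<dots> = c * (d * e * f)" unfolding assms by (simp add: mult_ac)
  finally show ?thesis .
qed

text \<open>Abel polynomials x (x + k)^(k - 1). The case 0 is separate because truncated subtraction
  would give x where the formula means 1.\<close>

definition abel :: "nat \<Rightarrow> real \<Rightarrow> real" where
  "abel k x = (if k = 0 then 1 else x * (x + real k) ^ (k - 1))"

lemma abel_0 [simp]: "abel 0 x = 1"
  by (simp add: abel_def)

lemma abel_Suc: "abel (Suc k) x = x * (x + real (Suc k)) ^ k"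
  by (simp add: abel_def)

text \<open>Abel's binomial theorem. For \<open>Suc n\<close> the derivatives in y agree by the
  induction hypothesis at y + 1, so it remains to compare at y = - x - (n + 1): there the right side
  vanishes, and the left side is an alternating sum of a polynomial of degree n.\<close>

theorem abel_binomial:
  "(\<Sum>k\<le>n. real (n choose k) * abel k x * (y + real (n - k)) ^ (n - k)) = (x + y + real n) ^ n"
proof (induction n arbitrary: y)
  case 0
  then show ?case by simp
next
  case (Suc n)
  let ?N = "Suc n"
  let ?L = "\<lambda>y. \<Sum>k\<le>?N. real (?N choose k) * abel k x * (y + real (?N - k)) ^ (?N - k)"
  let ?h = "\<lambda>y. ?L y - (x + y + real ?N) ^ ?N"
  have "(?h has_real_derivative 0) (at y)" for y
  proof -
    have "(?L has_real_derivative (\<Sum>k\<le>?N. real (?N choose k) * abel k x *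
        (real (?N - k) * (y + real (?N - k)) ^ (?N - k - 1)))) (at y)"
      by (auto intro!: derivative_eq_intros sum.cong simp: mult_ac)
    moreover have "((\<lambda>y. x + y + real ?N) has_real_derivative 1) (at y)"
      by (auto intro!: derivative_eq_intros)
    from DERIV_power[OF this, of ?N]
    have "((\<lambda>y. (x + y + real ?N) ^ ?N) has_real_derivative real ?N * (x + y + real ?N) ^ n) (at y)"
      by simp
    ultimately have "(?h has_real_derivative (\<Sum>k\<le>?N. real (?N choose k) * abel k x *
        (real (?N - k) * (y + real (?N - k)) ^ (?N - k - 1))) - real ?N * (x + y + real ?N) ^ n) (at y)"
      by (rule DERIV_diff)
    moreover have "(\<Sum>k\<le>?N. real (?N choose k) * abel k x * (real (?N - k) * (y + real (?N - k)) ^ (?N - k - 1)))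
        = real ?N * (x + y + real ?N) ^ n"
    proof -
      have "(\<Sum>k\<le>?N. real (?N choose k) * abel k x * (real (?N - k) * (y + real (?N - k)) ^ (?N - k - 1)))
          = (\<Sum>k\<le>n. real (?N choose k) * abel k x * (real (?N - k) * (y + real (?N - k)) ^ (?N - k - 1)))"
        by simp
      also have "\<dots> = (\<Sum>k\<le>n. real ?N * (real (n choose k) * abel k x * ((y + 1) + real (n - k)) ^ (n - k)))"
      proof (intro sum.cong refl)
        fix k assume "k \<in> {..n}"
        then have k: "k \<le> n" by simp
        have "real (?N - k) * real (?N choose k) = real ?N * real (n choose k)"
          unfolding of_nat_mult[symmetric] using binomial_absorb_comp[of ?N k] by simp
        moreover have "y + real (?N - k) = (y + 1) + real (n - k)" "?N - k - 1 = n - k"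
          using k by (simp_all add: Suc_diff_le)
        ultimately show "real (?N choose k) * abel k x * (real (?N - k) * (y + real (?N - k)) ^ (?N - k - 1))
            = real ?N * (real (n choose k) * abel k x * ((y + 1) + real (n - k)) ^ (n - k))"
          by (simp only: mult_rearrange)
      qed
      also have "\<dots> = real ?N * (x + y + real ?N) ^ n"
        unfolding sum_distrib_left[symmetric] Suc.IH by (simp add: algebra_simps)
      finally show ?thesis .
    qed
    ultimately show ?thesis by simp
  qed
  then have const: "?h y = ?h (- x - real ?N)"
    by (intro DERIV_isconst_all) auto
  have "?L (- x - real ?N) = (\<Sum>k\<le>?N. (x * (-1) ^ ?N) * ((-1) ^ k * real (?N choose k) * (x + real k) ^ n))"
  proof (intro sum.cong refl)
    fix k assume "k \<in> {..?N}"
    then have k: "k \<le> ?N" by simp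
    have "- x - real ?N + real (?N - k) = (-1) * (x + real k)" using k by (simp add: of_nat_diff)
    then have p: "(- x - real ?N + real (?N - k)) ^ (?N - k) = (-1) ^ (?N - k) * (x + real k) ^ (?N - k)"
      by (simp only: power_mult_distrib)
    have sq: "(-1) ^ k * (-1) ^ k = (1 :: real)"
      by (simp flip: power_mult_distrib)
    have "(-1) ^ ?N * (-1) ^ k = (-1) ^ (?N - k) * ((-1) ^ k * (-1) ^ k :: real)"
      unfolding mult.assoc[symmetric] power_add[symmetric] using k by simp
    then have s: "(-1) ^ (?N - k) = ((-1) ^ ?N * (-1) ^ k :: real)"
      unfolding sq by simp
    have "abel k x * (x + real k) ^ (?N - k) = x * (x + real k) ^ n"
    proof (cases k)
      case 0
      then show ?thesis by simp
    next
      case (Suc j)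
      have "(x + real (Suc j)) ^ j * (x + real (Suc j)) ^ (n - j) = (x + real (Suc j)) ^ n"
        using k Suc by (simp flip: power_add)
      then show ?thesis using Suc by (simp add: abel_Suc)
    qed
    from mult_rearrange[of "(x + real k) ^ (?N - k)" "abel k x" x "(x + real k) ^ n"
        "real (?N choose k)" "(-1) ^ ?N * (-1) ^ k"] this
    show "real (?N choose k) * abel k x * (- x - real ?N + real (?N - k)) ^ (?N - k)
        = (x * (-1) ^ ?N) * ((-1) ^ k * real (?N choose k) * (x + real k) ^ n)"
      unfolding p s by (simp add: mult_ac)
  qed
  also have "\<dots> = 0"
    unfolding sum_distrib_left[symmetric] using alternating_binomial_power_sum[of n ?N x] by simp
  finally have "?h (- x - real ?N) = 0" by simp
  with const show ?case by simp
qed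

text \<open>Abel polynomials are of binomial type: y (y + i)^(i - 1) = (y + i)^i - i (y + i)^(i -
  1), and both parts are instances of \<open>abel_binomial\<close>.\<close>

theorem abel_convolution:
  "(\<Sum>k\<le>n. real (n choose k) * abel k x * abel (n - k) y) = abel n (x + y)"
proof (cases n)
  case 0
  then show ?thesis by simp
next
  case (Suc m)
  have ab: "abel i y = (y + real i) ^ i - real i * (y + real i) ^ (i - 1)" for i
    by (cases i) (simp_all add: abel_Suc algebra_simps)
  have "(\<Sum>k\<le>n. real (n choose k) * abel k x * abel (n - k) y)
      = (\<Sum>k\<le>n. real (n choose k) * abel k x * (y + real (n - k)) ^ (n - k))
        - (\<Sum>k\<le>n. real (n choose k) * abel k x * (real (n - k) * (y + real (n - k)) ^ (n - k - 1)))"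
    unfolding ab by (simp add: right_diff_distrib sum_subtractf)
  also have "(\<Sum>k\<le>n. real (n choose k) * abel k x * (real (n - k) * (y + real (n - k)) ^ (n - k - 1)))
      = (\<Sum>k\<le>m. real (n choose k) * abel k x * (real (n - k) * (y + real (n - k)) ^ (n - k - 1)))"
    using Suc by simp
  also have "\<dots> = (\<Sum>k\<le>m. real n * (real (m choose k) * abel k x * ((y + 1) + real (m - k)) ^ (m - k)))"
  proof (intro sum.cong refl)
    fix k assume "k \<in> {..m}"
    then have k: "k \<le> m" by simp
    have "real (n - k) * real (n choose k) = real n * real (m choose k)"
      unfolding of_nat_mult[symmetric] using binomial_absorb_comp[of n k] Suc by simp
    moreover have "y + real (n - k) = (y + 1) + real (m - k)" "n - k - 1 = m - k"
      using k Suc by (simp_all add: Suc_diff_le)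
    ultimately show "real (n choose k) * abel k x * (real (n - k) * (y + real (n - k)) ^ (n - k - 1))
        = real n * (real (m choose k) * abel k x * ((y + 1) + real (m - k)) ^ (m - k))"
      by (simp only: mult_rearrange)
  qed
  also have "\<dots> = real n * (x + y + real n) ^ m"
    unfolding sum_distrib_left[symmetric] abel_binomial by (simp add: Suc algebra_simps)
  finally show ?thesis
    unfolding abel_binomial using Suc by (simp add: abel_Suc algebra_simps)
qed

text \<open>\<open>herm r = He\<^sub>r 1 = E (1 + \<i>Z) ^ r\<close> for a standard normal \<open>Z\<close>, and \<open>umbral p = E p (1 + \<i>Z)\<close>.
  The rule \<open>umbral_X\<close> is Gaussian integration by parts.\<close>

fun herm :: "nat \<Rightarrow> real" where
  "herm 0 = 1"
| "herm (Suc 0) = 1"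
| "herm (Suc (Suc r)) = herm (Suc r) - real (Suc r) * herm r"

definition umbral :: "real poly \<Rightarrow> real" where
  "umbral p = (\<Sum>i\<le>degree p. coeff p i * herm i)"

lemma umbral_eq:
  assumes "degree p \<le> N"
  shows "umbral p = (\<Sum>i\<le>N. coeff p i * herm i)"
  unfolding umbral_def
  by (rule sum.mono_neutral_left) (use assms in \<open>auto simp: coeff_eq_0\<close>)

lemma umbral_add: "umbral (p + q) = umbral p + umbral q"
proof -
  let ?N = "max (degree p) (degree q)"
  have "degree (p + q) \<le> ?N" by (rule degree_add_le) auto
  then show ?thesis
    using umbral_eq[of "p + q" ?N] umbral_eq[of p ?N] umbral_eq[of q ?N]
    by (simp add: sum.distrib algebra_simps)
qed

lemma umbral_smult: "umbral (smult c p) = c * umbral p"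
  using umbral_eq[of "smult c p" "degree p"] umbral_eq[of p "degree p"] degree_smult_le[of c p]
  by (simp add: sum_distrib_left mult.assoc)

lemma umbral_0 [simp]: "umbral 0 = 0"
  by (simp add: umbral_def)

lemma umbral_diff: "umbral (p - q) = umbral p - umbral q"
  using umbral_add[of p "smult (-1) q"] umbral_smult[of "-1" q] by simp

lemma umbral_sum: "umbral (\<Sum>i\<in>I. p i) = (\<Sum>i\<in>I. umbral (p i))"
  by (induction I rule: infinite_finite_induct) (simp_all add: umbral_add)

lemma umbral_X: "umbral (pCons 0 p) = umbral p - umbral (pderiv p)"
proof -
  define N where "N = Suc (degree p)"
  have "umbral (pCons 0 p) = (\<Sum>i\<le>Suc N. coeff (pCons 0 p) i * herm i)"
    by (rule umbral_eq) (simp add: N_def degree_pCons_eq_if)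
  also have "\<dots> = (\<Sum>i\<le>N. coeff p i * herm (Suc i))"
    by (subst sum.atMost_Suc_shift) simp
  also have "\<dots> = (\<Sum>i\<le>Suc (degree p). coeff p i * herm i
      - coeff p i * (real i * herm (i - 1)))"
    unfolding N_def
  proof (intro sum.cong refl)
    fix i
    show "coeff p i * herm (Suc i) = coeff p i * herm i - coeff p i * (real i * herm (i - 1))"
      by (cases i) (simp_all add: algebra_simps)
  qed
  also have "\<dots> = (\<Sum>i\<le>Suc (degree p). coeff p i * herm i)
      - (\<Sum>i\<le>Suc (degree p). coeff p i * (real i * herm (i - 1)))"
    by (rule sum_subtractf)
  also have "(\<Sum>i\<le>Suc (degree p). coeff p i * (real i * herm (i - 1)))
      = (\<Sum>i\<le>degree p. coeff (pderiv p) i * herm i)"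
    by (subst sum.atMost_Suc_shift) (simp add: coeff_pderiv mult_ac)
  also have "(\<Sum>i\<le>Suc (degree p). coeff p i * herm i) = umbral p"
    by (rule umbral_eq[symmetric]) simp
  also have "(\<Sum>i\<le>degree p. coeff (pderiv p) i * herm i) = umbral (pderiv p)"
    by (rule umbral_eq[symmetric]) (simp add: degree_pderiv)
  finally show ?thesis .
qed

definition abel_poly :: "nat \<Rightarrow> real poly" where
  "abel_poly n = (if n = 0 then 1 else pCons 0 ([:real n, 1:] ^ (n - 1)))"

lemma poly_abel_poly: "poly (abel_poly n) y = abel n y"
  by (simp add: abel_poly_def abel_def add.commute)

text \<open>The Gaussian expectation of the Abel polynomial; \<open>card_forests_complete\<close>
  identifies it with a number of forests.\<close>

definition forest_number :: "nat \<Rightarrow> real" where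
  "forest_number n = umbral (abel_poly n)"

text \<open>The recursion of forests split by the tree through a fixed vertex. With P = y + n + 1
  and n > 0, Abel convolution collects the right side into P^n - n P^(n - 1); its difference from y
  P^n vanishes under \<open>umbral\<close> by Gaussian integration by parts.\<close>

lemma forest_number_Suc:
  "forest_number (Suc n) = (\<Sum>j\<le>n. real (n choose j) * abel j 1 * forest_number (n - j))"
proof -
  let ?B = "if n = 0 then 1 else [:1, 1:] * [:real (Suc n), 1:] ^ (n - 1)"
  have "(\<Sum>j\<le>n. smult (real (n choose j) * abel j 1) (abel_poly (n - j))) = ?B"
  proof -
    have "poly (\<Sum>j\<le>n. smult (real (n choose j) * abel j 1) (abel_poly (n - j))) y = poly ?B y" for y
    proof -
      have "poly ?B y = abel n (1 + y)" by (simp add: abel_def algebra_simps)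
      then show ?thesis
        by (simp add: poly_sum poly_abel_poly flip: abel_convolution)
    qed
    then show ?thesis by (simp add: poly_eq_poly_eq_iff[symmetric] fun_eq_iff)
  qed
  then have "(\<Sum>j\<le>n. real (n choose j) * abel j 1 * forest_number (n - j)) = umbral ?B"
    by (simp add: forest_number_def flip: umbral_sum umbral_smult)
  also have "\<dots> = umbral (abel_poly (Suc n))"
  proof (cases n)
    case 0
    have "umbral (abel_poly (Suc 0)) = 1"
      using umbral_X[of 1] by (simp add: abel_poly_def umbral_def pderiv_1)
    then show ?thesis using 0 by (simp add: umbral_def)
  next
    case (Suc m)
    let ?P = "[:real (Suc n), 1:]"
    have "abel_poly (Suc n) - ?B = (pCons 0 (?P ^ n) - ?P ^ n) + smult (real n) (?P ^ m)"
    proof -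
      have "poly (abel_poly (Suc n) - ?B) y = poly ((pCons 0 (?P ^ n) - ?P ^ n) + smult (real n) (?P ^ m)) y" for y
        using Suc by (simp add: poly_abel_poly abel_Suc algebra_simps)
      then show ?thesis by (simp add: poly_eq_poly_eq_iff[symmetric] fun_eq_iff)
    qed
    then have "umbral (abel_poly (Suc n)) - umbral ?B
        = (umbral (pCons 0 (?P ^ n)) - umbral (?P ^ n)) + real n * umbral (?P ^ m)"
      by (metis umbral_diff umbral_add umbral_smult)
    moreover have "pderiv (?P ^ n) = smult (real n) (?P ^ m)"
      unfolding Suc pderiv_power_Suc by (simp add: pderiv_pCons)
    then have "umbral (pCons 0 (?P ^ n)) = umbral (?P ^ n) - real n * umbral (?P ^ m)"
      by (simp add: umbral_X umbral_smult)
    ultimately show ?thesis by simp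
  qed
  finally show ?thesis by (simp add: forest_number_def)
qed

lemma forest_number_expand:
  "forest_number (Suc m) = (\<Sum>k\<le>m. real (m choose k) * real (Suc m) ^ (m - k) * herm (Suc k))"
proof -
  have "abel_poly (Suc m) = (\<Sum>k\<le>m. smult (real (m choose k) * real (Suc m) ^ (m - k)) (monom 1 (Suc k)))"
  proof -
    have "poly (abel_poly (Suc m)) y
        = poly (\<Sum>k\<le>m. smult (real (m choose k) * real (Suc m) ^ (m - k)) (monom 1 (Suc k))) y" for y
      using binomial_ring[of y "real (Suc m)" m]
      by (simp add: poly_abel_poly abel_Suc poly_sum poly_monom sum_distrib_left mult_ac)
    then show ?thesis by (simp add: poly_eq_poly_eq_iff[symmetric] fun_eq_iff)
  qed
  moreover have "umbral (monom 1 k) = herm k" for k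
    by (simp add: umbral_def degree_monom_eq coeff_monom if_distrib[of "\<lambda>t. t * _"] sum.delta' cong: if_cong)
  ultimately show ?thesis
    by (simp add: forest_number_def umbral_sum umbral_smult)
qed

section \<open>Asymptotics\<close>

definition gcoef :: "nat \<Rightarrow> real" where
  "gcoef k = herm k / fact k"

text \<open>An index shift with value 0 at 0, so that the recurrence holds for all k; truncated
  \<open>gcoef (k - 1)\<close> would repeat \<open>gcoef 0\<close>.\<close>

definition gprev :: "nat \<Rightarrow> real" where
  "gprev k = (case k of 0 \<Rightarrow> 0 | Suc j \<Rightarrow> gcoef j)"

lemma gprev_simps [simp]: "gprev 0 = 0" "gprev (Suc k) = gcoef k"
  by (simp_all add: gprev_def)

lemma herm_Suc_fact: "herm (Suc k) / fact k = gcoef k - gprev k"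
proof (cases k)
  case (Suc j)
  have "real (Suc j) * herm j / fact (Suc j) = herm j / fact j"
    by (simp add: fact_Suc del: of_nat_Suc)
  then show ?thesis
    by (simp add: Suc gcoef_def diff_divide_distrib del: fact_Suc of_nat_Suc)
qed (simp add: gcoef_def)

lemma gcoef_Suc: "real (Suc k) * gcoef (Suc k) = gcoef k - gprev k"
  unfolding herm_Suc_fact[symmetric] by (simp add: gcoef_def)

text \<open>The recurrence bounds k |g_k| 4^k by 4 C + 16 C, so beyond k = 20 the bound C
  propagates. The rate 4 leaves the ratio 1/2 against the powers of 2 used below.\<close>

lemma gcoef_bound: "\<exists>C. \<forall>k. \<bar>gcoef k\<bar> * 4 ^ k \<le> C"
proof -
  let ?u = "\<lambda>k. \<bar>gcoef k\<bar> * 4 ^ k"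
  define C where "C = Max (?u ` {..20})"
  have C: "?u k \<le> C" if "k \<le> 20" for k
    unfolding C_def using that by (intro Max_ge) auto
  have C0: "C \<ge> 0" using C[of 0] by (simp add: gcoef_def)
  have "?u k \<le> C" for k
  proof (induction k rule: less_induct)
    case (less k)
    show ?case
    proof (cases "k \<le> 20")
      case True
      then show ?thesis by (rule C)
    next
      case False
      define j where "j = k - 2"
      have k: "k = Suc (Suc j)" and j: "18 < j" using False by (auto simp: j_def)
      have u1: "?u (Suc j) \<le> C" by (rule less.IH) (simp add: k)
      have u0: "?u j \<le> C" by (rule less.IH) (simp add: k)
      have "real k * \<bar>gcoef k\<bar> = \<bar>gcoef (Suc j) - gcoef j\<bar>"
        using gcoef_Suc[of "Suc j"] unfolding k by (metis abs_mult abs_of_nat gprev_simps(2))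
      also have "\<dots> \<le> \<bar>gcoef (Suc j)\<bar> + \<bar>gcoef j\<bar>" by (rule abs_triangle_ineq4)
      finally have "real k * \<bar>gcoef k\<bar> * 4 ^ k \<le> (\<bar>gcoef (Suc j)\<bar> + \<bar>gcoef j\<bar>) * 4 ^ k"
        by (rule mult_right_mono) simp
      also have "\<dots> = 4 * ?u (Suc j) + 16 * ?u j" by (simp add: k algebra_simps)
      also have "\<dots> \<le> 20 * C" using u1 u0 by simp
      also have "\<dots> \<le> real k * C" using False C0 by (intro mult_right_mono) auto
      finally have "real k * ?u k \<le> real k * C" by (simp add: mult.assoc)
      then show ?thesis using False by simp
    qed
  qed
  then show ?thesis by blast
qed

text \<open>The weight is the majorant for Tannery's theorem in
  \<open>forest_number_asymptotics\<close>.\<close>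

lemma summable_gcoef_quadratic: "summable (\<lambda>k. \<bar>gcoef k\<bar> * (real k + 3)\<^sup>2)"
proof -
  from gcoef_bound obtain C where C: "\<And>k. \<bar>gcoef k\<bar> * 4 ^ k \<le> C" by blast
  have sq: "(real k + 3)\<^sup>2 \<le> 9 * 2 ^ k" for k
  proof (induction k)
    case (Suc k)
    have "(real (Suc k) + 3)\<^sup>2 \<le> 2 * (real k + 3)\<^sup>2" by (simp add: power2_eq_square algebra_simps)
    also have "\<dots> \<le> 9 * 2 ^ Suc k" using Suc by simp
    finally show ?case .
  qed simp
  have "summable (\<lambda>k. 9 * C * (1 / 2) ^ k)"
    by (intro summable_mult summable_geometric) simp
  then show ?thesis
  proof (rule summable_comparison_test')
    fix k
    have "\<bar>gcoef k\<bar> * (real k + 3)\<^sup>2 \<le> \<bar>gcoef k\<bar> * (9 * 2 ^ k)"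
      by (intro mult_left_mono sq) simp
    also have "\<dots> = 9 * (\<bar>gcoef k\<bar> * 4 ^ k) * (1 / 2) ^ k"
    proof -
      have "(4::real) ^ k * (1 / 2) ^ k = 2 ^ k" by (simp flip: power_mult_distrib)
      then show ?thesis by (metis (no_types, opaque_lifting) mult.assoc mult.commute)
    qed
    also have "\<dots> \<le> 9 * C * (1 / 2) ^ k" by (intro mult_right_mono mult_left_mono C) auto
    finally show "norm (\<bar>gcoef k\<bar> * (real k + 3)\<^sup>2) \<le> 9 * C * (1 / 2) ^ k" by simp
  qed
qed

lemma summable_gcoef_times:
  assumes "\<And>k. \<bar>p k\<bar> \<le> (real k + 3)\<^sup>2"
  shows "summable (\<lambda>k. gcoef k * p k)"
  using summable_gcoef_quadratic
proof (rule summable_comparison_test')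
  fix k
  show "norm (gcoef k * p k) \<le> \<bar>gcoef k\<bar> * (real k + 3)\<^sup>2"
    using assms[of k] by (simp add: abs_mult mult_left_mono)
qed

lemma summable_gcoef: "summable gcoef"
  using summable_gcoef_times[of "\<lambda>_. 1"] by (simp add: power2_eq_square algebra_simps)

lemma gprev_sums:
  assumes "(\<lambda>k. gcoef k * p (Suc k)) sums s"
  shows "(\<lambda>k. gprev k * p k) sums s"
  using assms sums_Suc_iff[of "\<lambda>k. gprev k * p k" s] by simp

text \<open>The generating function of \<open>gcoef\<close> is \<open>exp (x - x\<^sup>2 / 2)\<close>: the recurrence says that its
  derivative is \<open>1 - x\<close> times itself.\<close>

lemma suminf_gcoef: "(\<Sum>k. gcoef k) = exp (1 / 2)"
proof -
  define G where "G x = (\<Sum>k. gcoef k * x ^ k)" for x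
  \<comment> \<open>Convergence at 2 puts the interval from 0 to 1 well inside the disc of
    convergence.\<close>
  have sm: "summable (\<lambda>k. gcoef k * 2 ^ k)"
  proof -
    from gcoef_bound obtain C where C: "\<And>k. \<bar>gcoef k\<bar> * 4 ^ k \<le> C" by blast
    have "summable (\<lambda>k. C * (1 / 2) ^ k)" by (intro summable_mult summable_geometric) simp
    then show ?thesis
    proof (rule summable_comparison_test')
      fix k
      have "(4::real) ^ k * (1 / 2) ^ k = 2 ^ k" by (simp flip: power_mult_distrib)
      then have "\<bar>gcoef k\<bar> * 2 ^ k = (\<bar>gcoef k\<bar> * 4 ^ k) * (1 / 2) ^ k" by simp
      also have "\<dots> \<le> C * (1 / 2) ^ k" by (intro mult_right_mono C) auto
      finally show "norm (gcoef k * 2 ^ k) \<le> C * (1 / 2) ^ k" by (simp add: abs_mult)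
    qed
  qed
  have smx: "summable (\<lambda>k. gcoef k * x ^ k)" if "\<bar>x\<bar> < 2" for x
    using powser_inside[OF sm, of x] that by simp
  have dG: "(G has_real_derivative (1 - x) * G x) (at x)" if x: "\<bar>x\<bar> < 2" for x
  proof -
    have "(G has_real_derivative (\<Sum>k. diffs gcoef k * x ^ k)) (at x)"
      unfolding G_def[abs_def] using x by (intro termdiffs_strong[OF sm]) simp
    moreover have "(\<lambda>k. diffs gcoef k * x ^ k) sums (G x - x * G x)"
    proof -
      have "(\<lambda>k. gcoef k * x ^ k) sums G x"
        unfolding G_def using smx[OF x] by (rule summable_sums)
      moreover from sums_mult[OF this, of x]
      have "(\<lambda>k. gcoef k * x ^ Suc k) sums (x * G x)" by (simp add: mult_ac)
      then have "(\<lambda>k. gprev k * x ^ k) sums (x * G x)" by (rule gprev_sums)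
      ultimately have "(\<lambda>k. gcoef k * x ^ k - gprev k * x ^ k) sums (G x - x * G x)"
        by (rule sums_diff)
      moreover have "diffs gcoef k * x ^ k = gcoef k * x ^ k - gprev k * x ^ k" for k
        unfolding diffs_def using gcoef_Suc[of k] by (simp flip: left_diff_distrib)
      ultimately show ?thesis by simp
    qed
    ultimately show ?thesis by (simp add: sums_iff left_diff_distrib)
  qed
  \<comment> \<open>The quotient of \<open>G\<close> by its expected closed form.\<close>
  let ?h = "\<lambda>x. G x * exp (x\<^sup>2 / 2 - x)"
  have dh: "(?h has_real_derivative 0) (at x)" if x: "\<bar>x\<bar> < 2" for x
  proof -
    have "(?h has_real_derivative ((1 - x) * G x * exp (x\<^sup>2 / 2 - x) + G x * (exp (x\<^sup>2 / 2 - x) * (x - 1)))) (at x)"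
      by (auto intro!: derivative_eq_intros dG[OF x])
    then show ?thesis by (simp add: algebra_simps)
  qed
  have "?h 1 = ?h 0"
  proof (rule DERIV_isconst_end[of 0 1 ?h])
    show "continuous_on {0..1} ?h"
    proof (rule continuous_at_imp_continuous_on, rule ballI)
      fix x :: real assume "x \<in> {0..1}"
      then have "\<bar>x\<bar> < 2" by simp
      from dh[OF this] show "isCont ?h x" by (rule DERIV_isCont)
    qed
  qed (auto intro!: dh)
  moreover have "G 0 = 1" unfolding G_def powser_zero by (simp add: gcoef_def)
  ultimately have "G 1 * exp (- (1 / 2)) = 1" by simp
  then have "G 1 * (exp (- (1 / 2)) * exp (1 / 2)) = exp (1 / 2)" by (simp only: mult.assoc[symmetric] mult_1)
  then show ?thesis by (simp add: G_def flip: exp_add)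
qed

text \<open>For the generating function G one has G'' = ((1 - x)^2 - 1) G, hence G''(1) = - G(1). In
  the series proof by the recurrence the first moment \<open>t\<close> cancels.\<close>

lemma gcoef_second_moment: "(\<lambda>k. gcoef k * (real k * (real k - 1))) sums (- exp (1 / 2))"
proof -
  have b0: "\<bar>real k\<bar> \<le> (real k + 3)\<^sup>2" "\<bar>real k + 1\<bar> \<le> (real k + 3)\<^sup>2" for k
    by (simp_all add: power2_eq_square algebra_simps)
  have s0: "gcoef sums exp (1 / 2)"
    using summable_sums[OF summable_gcoef] by (simp add: suminf_gcoef)
  obtain t where t: "(\<lambda>k. gcoef k * real k) sums t"
    using summable_gcoef_times[of real] b0 by (auto simp: summable_def)
  have "(\<lambda>k. gcoef k * real (Suc k)) sums (t + exp (1 / 2))"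
    using sums_add[OF t s0] by (simp add: algebra_simps)
  then have "(\<lambda>k. gprev k * real k) sums (t + exp (1 / 2))" by (rule gprev_sums)
  from sums_diff[OF t this]
  have "(\<lambda>k. gcoef k * real k - gprev k * real k) sums (- exp (1 / 2))" by simp
  moreover have "gcoef k * real k - gprev k * real k = gcoef (Suc k) * (real (Suc k) * (real (Suc k) - 1))" for k
    using gcoef_Suc[of k] by (metis (no_types, opaque_lifting) add_diff_cancel_right' left_diff_distrib mult.assoc mult.commute of_nat_Suc add.commute)
  ultimately show ?thesis
    using sums_Suc_iff[of "\<lambda>k. gcoef k * (real k * (real k - 1))" "- exp (1 / 2)"] by simp
qed

text \<open>For n > 0 this is (n - 1) ... (n - k) / n^k, the correction when a binomial coefficient
  of n - 1 is replaced by n^k / k!.\<close>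

definition wfac :: "nat \<Rightarrow> nat \<Rightarrow> real" where
  "wfac n k = (\<Prod>i<k. 1 - real (Suc i) / real n)"

lemma wfac_0 [simp]: "wfac n 0 = 1"
  by (simp add: wfac_def)

lemma wfac_Suc: "wfac n (Suc k) = wfac n k * (1 - real (Suc k) / real n)"
  by (simp add: wfac_def)

lemma wfac_eq_0:
  assumes "n > 0" "k \<ge> n"
  shows "wfac n k = 0"
  unfolding wfac_def using assms
  by (intro prod_zero) (auto intro!: bexI[of _ "n - 1"])

lemma wfac_bounds: "0 \<le> wfac n k" "wfac n k \<le> 1"
proof -
  have "0 \<le> wfac n k \<and> wfac n k \<le> 1"
  proof (induction k)
    case (Suc k)
    show ?case
    \<comment> \<open>For n = 0, division by zero makes every factor 1.\<close>
    proof (cases "n = 0 \<or> Suc k \<le> n")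
      case True
      then have "0 \<le> 1 - real (Suc k) / real n" "1 - real (Suc k) / real n \<le> 1"
        by (auto simp: divide_le_eq)
      then show ?thesis unfolding wfac_Suc using Suc by (auto intro: mult_le_one)
    next
      case False
      then show ?thesis using wfac_eq_0[of n "Suc k"] by simp
    qed
  qed simp
  then show "0 \<le> wfac n k" "wfac n k \<le> 1" by auto
qed

lemma wfac_deviation: "real n * (1 - wfac n k) \<le> real k * (real k + 1) / 2"
proof (cases "n = 0")
  case False
  show ?thesis
  proof (induction k)
    case (Suc k)
    have "real n * (1 - wfac n (Suc k)) = real n * (1 - wfac n k) + wfac n k * real (Suc k)"
      using False unfolding wfac_Suc by (simp add: field_simps)
    also have "\<dots> \<le> real k * (real k + 1) / 2 + 1 * real (Suc k)"
      using Suc wfac_bounds by (intro add_mono mult_right_mono) auto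
    finally show ?case by (simp add: field_simps)
  qed simp
qed simp

lemma wfac_limit: "(\<lambda>n. wfac n k) \<longlonglongrightarrow> 1"
proof (induction k)
  case (Suc k)
  have "(\<lambda>n. real (Suc k) / real n) \<longlonglongrightarrow> 0"
    by (rule lim_const_over_n)
  then have "(\<lambda>n. wfac n k * (1 - real (Suc k) / real n)) \<longlonglongrightarrow> 1 * (1 - 0)"
    by (intro tendsto_intros Suc)
  then show ?case by (simp add: wfac_Suc)
qed simp

lemma wfac_deviation_limit: "(\<lambda>n. real n * (1 - wfac n k)) \<longlonglongrightarrow> real k * (real k + 1) / 2"
proof (induction k)
  case (Suc k)
  have "(\<lambda>n. real n * (1 - wfac n k) + wfac n k * real (Suc k)) \<longlonglongrightarrow>
      real k * (real k + 1) / 2 + 1 * real (Suc k)"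
    by (intro tendsto_intros Suc wfac_limit)
  moreover have "\<forall>\<^sub>F n in sequentially. real n * (1 - wfac n k) + wfac n k * real (Suc k)
      = real n * (1 - wfac n (Suc k))"
    using eventually_gt_at_top[of 0]
    by eventually_elim (simp add: wfac_Suc field_simps)
  ultimately have "(\<lambda>n. real n * (1 - wfac n (Suc k))) \<longlonglongrightarrow> real k * (real k + 1) / 2 + 1 * real (Suc k)"
    by (rule Lim_transform_eventually)
  then show ?case by (simp add: field_simps)
qed simp

lemma binomial_wfac: "real (m choose k) * fact k = real (Suc m) ^ k * wfac (Suc m) k"
proof (induction k)
  case (Suc k)
  have "Suc k * (m choose Suc k) = (m - k) * (m choose k)"
    using binomial_absorb_comp[of m k] Suc_times_binomial[of k "m - 1"]
    by (cases m) (simp_all del: binomial_Suc_Suc mult_Suc)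
  then have 1: "real (Suc k) * real (m choose Suc k) = real (m - k) * real (m choose k)"
    unfolding of_nat_mult[symmetric] by simp
  have "real (m - k) * real (m choose k) = (real m - real k) * real (m choose k)"
    by (cases "k \<le> m") (simp_all add: of_nat_diff)
  with 1 have 2: "real (Suc k) * real (m choose Suc k) = (real m - real k) * real (m choose k)"
    by simp
  have "real (m choose Suc k) * fact (Suc k) = (real (Suc k) * real (m choose Suc k)) * fact k"
    by (simp add: mult_ac)
  also have "\<dots> = (real m - real k) * (real (m choose k) * fact k)"
    unfolding 2 by (simp only: mult.assoc)
  also have "\<dots> = (real m - real k) * (real (Suc m) ^ k * wfac (Suc m) k)" by (simp only: Suc.IH)
  also have "real m - real k = real (Suc m) * (1 - real (Suc k) / real (Suc m))"
    by (simp add: field_simps)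
  finally show ?case by (simp add: wfac_Suc mult_ac)
qed simp

lemma sum_gprev_shift:
  assumes "u (Suc m) = (0::real)"
  shows "(\<Sum>k\<le>m. u k * gprev k) = (\<Sum>k\<le>m. u (Suc k) * gcoef k)"
proof -
  have "(\<Sum>k\<le>m. u k * gprev k) = (\<Sum>k\<le>Suc m. u k * gprev k)" using assms by simp
  also have "\<dots> = (\<Sum>k\<le>m. u (Suc k) * gcoef k)" by (subst sum.atMost_Suc_shift) simp
  finally show ?thesis .
qed

text \<open>Two summations by parts with the recurrence for \<open>gcoef\<close> remove the cancellation that hides the
  leading term in the expansion of \<open>forest_number\<close>.\<close>

lemma forest_number_ratio:
  assumes "m \<ge> 1"
  shows "forest_number (Suc m) / real (Suc m) ^ (m - 1) =
    (\<Sum>k\<le>m. gcoef k * (wfac (Suc m) k + wfac (Suc m) (Suc k) - wfac (Suc m) (Suc (Suc k))))"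
proof -
  let ?n = "real (Suc m)" and ?w = "wfac (Suc m)"
  have w0: "?w k = 0" if "k > m" for k using that by (intro wfac_eq_0) auto
  have "forest_number (Suc m) / ?n ^ (m - 1) = (\<Sum>k\<le>m. ?n * ?w k * (gcoef k - gprev k))"
    unfolding forest_number_expand sum_divide_distrib
  proof (intro sum.cong refl)
    fix k assume "k \<in> {..m}"
    then have k: "k \<le> m" by simp
    have "?n ^ (m - k) * ?n ^ k = ?n * ?n ^ (m - 1)"
      using k assms by (simp flip: power_add power_Suc)
    then have "real (m choose k) * fact k * ?n ^ (m - k) = ?n * ?n ^ (m - 1) * ?w k"
      unfolding binomial_wfac by (simp add: mult_ac)
    then have "real (m choose k) * ?n ^ (m - k) = ?n * ?n ^ (m - 1) * ?w k / fact k"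
      by (simp add: field_simps)
    then have "real (m choose k) * ?n ^ (m - k) * herm (Suc k) / ?n ^ (m - 1)
        = ?n * ?w k * (herm (Suc k) / fact k)"
      by simp
    then show "real (m choose k) * ?n ^ (m - k) * herm (Suc k) / ?n ^ (m - 1) = ?n * ?w k * (gcoef k - gprev k)"
      by (simp only: herm_Suc_fact)
  qed
  also have "\<dots> = ?n * ((\<Sum>k\<le>m. ?w k * gcoef k) - (\<Sum>k\<le>m. ?w k * gprev k))"
    by (simp add: sum_distrib_left sum_subtractf right_diff_distrib mult.assoc)
  also have "(\<Sum>k\<le>m. ?w k * gprev k) = (\<Sum>k\<le>m. ?w (Suc k) * gcoef k)"
    by (rule sum_gprev_shift) (simp add: w0)
  also have "?n * ((\<Sum>k\<le>m. ?w k * gcoef k) - (\<Sum>k\<le>m. ?w (Suc k) * gcoef k))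
      = (\<Sum>k\<le>m. ?w k * gcoef k + ?w k * (real k * gcoef k))"
    unfolding sum_subtractf[symmetric] sum_distrib_left
  proof (intro sum.cong refl)
    fix k
    \<comment> \<open>Consecutive weights differ by order 1/n, which absorbs the factor
      \<open>?n\<close>.\<close>
    have "?n * (?w k - ?w (Suc k)) = ?w k * real (Suc k)"
      unfolding wfac_Suc by (simp add: field_simps)
    then have "?n * (?w k - ?w (Suc k)) * gcoef k = ?w k * real (Suc k) * gcoef k" by simp
    then show "?n * (?w k * gcoef k - ?w (Suc k) * gcoef k) = ?w k * gcoef k + ?w k * (real k * gcoef k)"
      by (simp add: algebra_simps)
  qed
  also have "\<dots> = (\<Sum>k\<le>m. ?w k * gcoef k) + (\<Sum>k\<le>m. ?w k * (real k * gcoef k))"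
    by (rule sum.distrib)
  also have "(\<Sum>k\<le>m. ?w k * (real k * gcoef k)) = (\<Sum>k\<le>Suc m. ?w k * (real k * gcoef k))"
    by (simp add: w0)
  also have "\<dots> = (\<Sum>k\<le>m. ?w (Suc k) * (real (Suc k) * gcoef (Suc k)))"
    by (subst sum.atMost_Suc_shift) simp
  also have "\<dots> = (\<Sum>k\<le>m. ?w (Suc k) * gcoef k) - (\<Sum>k\<le>m. ?w (Suc k) * gprev k)"
    unfolding gcoef_Suc by (simp add: right_diff_distrib sum_subtractf)
  also have "(\<Sum>k\<le>m. ?w (Suc k) * gprev k) = (\<Sum>k\<le>m. ?w (Suc (Suc k)) * gcoef k)"
    by (rule sum_gprev_shift[of "\<lambda>k. ?w (Suc k)"]) (simp add: w0)
  finally show ?thesis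
    by (simp add: sum.distrib sum_subtractf algebra_simps)
qed

text \<open>To order 1/n the three weights of \<open>forest_number_ratio\<close> give the
  coefficient \<open>l k\<close>, that is 2 - k (k - 1) / 2. With the sum and the second moment of
  \<open>gcoef\<close> it contributes (2 + 1/2) sqrt e; Tannery's theorem justifies the limit under
  the sum.\<close>

theorem forest_number_asymptotics:
  "(\<lambda>n. real n * (forest_number n / real n ^ (n - 2) - exp (1 / 2))) \<longlonglongrightarrow> 5 / 2 * exp (1 / 2)"
proof -
  define d where "d n k = real n * (wfac n k + wfac n (Suc k) - wfac n (Suc (Suc k)) - 1)" for n k
  define l where "l k = 2 - real k * (real k - 1) / 2" for k
  have d_alt: "d n k = real n * (1 - wfac n (Suc (Suc k))) - real n * (1 - wfac n k) - real n * (1 - wfac n (Suc k))" for n k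
    by (simp add: d_def algebra_simps)
  have lim: "(\<lambda>n. gcoef k * d n k) \<longlonglongrightarrow> gcoef k * l k" for k
  proof -
    have "(\<lambda>n. gcoef k * d n k) \<longlonglongrightarrow> gcoef k * (real (Suc (Suc k)) * (real (Suc (Suc k)) + 1) / 2
        - real k * (real k + 1) / 2 - real (Suc k) * (real (Suc k) + 1) / 2)"
      unfolding d_alt by (intro tendsto_mult tendsto_const tendsto_diff wfac_deviation_limit)
    moreover have "real (Suc (Suc k)) * (real (Suc (Suc k)) + 1) / 2
        - real k * (real k + 1) / 2 - real (Suc k) * (real (Suc k) + 1) / 2 = l k"
      by (simp add: l_def field_simps)
    ultimately show ?thesis by simp
  qed
  have bound: "norm (gcoef k * d n k) \<le> \<bar>gcoef k\<bar> * (real k + 3)\<^sup>2" for n k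
  proof -
    have dev: "0 \<le> real n * (1 - wfac n j) \<and> real n * (1 - wfac n j) \<le> real j * (real j + 1) / 2" for j
      using wfac_deviation[of n j] wfac_bounds(2)[of n j] by simp
    have "\<bar>d n k\<bar> \<le> max (real (Suc (Suc k)) * (real (Suc (Suc k)) + 1) / 2)
        (real k * (real k + 1) / 2 + real (Suc k) * (real (Suc k) + 1) / 2)"
      unfolding d_alt using dev[of k] dev[of "Suc k"] dev[of "Suc (Suc k)"] by linarith
    also have "\<dots> \<le> (real k + 3)\<^sup>2"
      by (simp add: power2_eq_square field_simps)
    finally show ?thesis by (simp add: abs_mult mult_left_mono)
  qed
  have "eventually (\<lambda>(k, n). norm (gcoef k * d n k) \<le> \<bar>gcoef k\<bar> * (real k + 3)\<^sup>2) (at_top \<times>\<^sub>F sequentially)"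
    using bound by (intro always_eventually) auto
  from tannerys_theorem[OF lim this summable_gcoef_quadratic sequentially_bot]
  have "(\<lambda>n. \<Sum>k. gcoef k * d n k) \<longlonglongrightarrow> (\<Sum>k. gcoef k * l k)" by blast
  moreover have "(\<Sum>k. gcoef k * l k) = 5 / 2 * exp (1 / 2)"
  proof -
    have "gcoef sums exp (1 / 2)"
      using summable_sums[OF summable_gcoef] by (simp add: suminf_gcoef)
    from sums_diff[OF sums_mult[OF this, of 2] sums_mult[OF gcoef_second_moment, of "1 / 2"]]
    moreover have "(\<lambda>k. gcoef k * l k) = (\<lambda>k. 2 * gcoef k - 1 / 2 * (gcoef k * (real k * (real k - 1))))"
      by (auto simp: l_def field_simps)
    ultimately have "(\<lambda>k. gcoef k * l k) sums (2 * exp (1 / 2) - 1 / 2 * (- exp (1 / 2)))"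
      by simp
    then show ?thesis by (simp add: sums_iff)
  qed
  moreover have "\<forall>\<^sub>F n in sequentially. (\<Sum>k. gcoef k * d n k)
      = real n * (forest_number n / real n ^ (n - 2) - exp (1 / 2))"
    using eventually_ge_at_top[of 2]
  proof eventually_elim
    case (elim n)
    define m where "m = n - 1"
    have n: "n = Suc m" and m: "m \<ge> 1" using elim by (auto simp: m_def)
    let ?W = "\<lambda>k. wfac n k + wfac n (Suc k) - wfac n (Suc (Suc k))"
    have "(\<lambda>k. gcoef k * ?W k) sums (\<Sum>k\<in>{..m}. gcoef k * ?W k)"
      using n by (intro sums_finite) (auto simp: wfac_eq_0)
    moreover have "gcoef sums exp (1 / 2)"
      using summable_sums[OF summable_gcoef] by (simp add: suminf_gcoef)
    ultimately have "(\<lambda>k. real n * (gcoef k * ?W k - gcoef k)) sums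
        (real n * ((\<Sum>k\<in>{..m}. gcoef k * ?W k) - exp (1 / 2)))"
      by (intro sums_mult sums_diff)
    moreover have "real n * (gcoef k * ?W k - gcoef k) = gcoef k * d n k" for k
      by (simp add: d_def algebra_simps)
    ultimately have "(\<Sum>k. gcoef k * d n k) = real n * ((\<Sum>k\<in>{..m}. gcoef k * ?W k) - exp (1 / 2))"
      by (simp add: sums_iff)
    then show ?case using forest_number_ratio[OF m] by (simp add: n numeral_2_eq_2)
  qed
  ultimately show ?thesis by (auto intro: Lim_transform_eventually)
qed

section \<open>Forests of the complete graph\<close>

lemma mem_component: "y \<in> component A x \<longleftrightarrow> reach A x y"
  by (simp add: component_def)

lemma inter_Pow_union:
  assumes "S \<subseteq> complete_edges A" "T \<subseteq> complete_edges B" "A \<inter> B = {}"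
  shows "(S \<union> T) \<inter> Pow A = S" "(S \<union> T) \<inter> Pow B = T"
proof -
  \<comment> \<open>The empty set would lie in both power sets; edges are nonempty.\<close>
  have S: "S \<subseteq> Pow A - {{}}" and T: "T \<subseteq> Pow B - {{}}"
    using assms(1,2) by (auto simp: complete_edges_def)
  have "S \<inter> Pow B = {}"
  proof (rule equals0I)
    fix e assume "e \<in> S \<inter> Pow B"
    then have "e \<subseteq> A \<inter> B" "e \<noteq> {}" using S by auto
    then show False using assms(3) by simp
  qed
  moreover have "T \<inter> Pow A = {}"
  proof (rule equals0I)
    fix e assume "e \<in> T \<inter> Pow A"
    then have "e \<subseteq> A \<inter> B" "e \<noteq> {}" using T by auto
    then show False using assms(3) by simp
  qed
  moreover have "S \<inter> Pow A = S" "T \<inter> Pow B = T" using S T by auto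
  ultimately show "(S \<union> T) \<inter> Pow A = S" "(S \<union> T) \<inter> Pow B = T"
    by (simp_all add: Int_Un_distrib2)
qed

lemma reach_union_left:
  assumes "S \<subseteq> complete_edges A" "T \<subseteq> complete_edges B" "A \<inter> B = {}" "x \<in> A"
    "reach (S \<union> T) x y"
  shows "y \<in> A \<and> reach S x y"
proof -
  have "y \<in> A \<and> reach ((S \<union> T) \<inter> Pow A) x y"
  proof (rule reach_restrict[OF assms(5,4)])
    fix u v assume "u \<in> A" "{u, v} \<in> S \<union> T"
    then show "v \<in> A"
      using assms(1-3) complete_edges_pairD[of u v A] complete_edges_pairD[of u v B] by auto
  qed
  then show ?thesis by (simp only: inter_Pow_union(1)[OF assms(1-3)])
qed

lemma cycle_free_union:
  assumes S: "S \<subseteq> complete_edges A" "cycle_free S" and T: "T \<subseteq> complete_edges B" "cycle_free T"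
    and AB: "A \<inter> B = {}"
  shows "cycle_free (S \<union> T)"
proof -
  have aux: "\<not> reach (S \<union> T - {{x, y}}) x y"
    if S: "S \<subseteq> complete_edges A" "cycle_free S" and T: "T \<subseteq> complete_edges B"
      and AB: "A \<inter> B = {}" and xy: "{x, y} \<in> S" "x \<noteq> y" for S T A B and x y :: 'a
  proof
    assume r: "reach (S \<union> T - {{x, y}}) x y"
    have x: "x \<in> A" using S(1) xy(1) complete_edges_pairD[of x y A] by auto
    have "reach ((S - {{x, y}}) \<union> T) x y" by (rule reach_mono[OF r]) auto
    moreover have "S - {{x, y}} \<subseteq> complete_edges A" using S(1) by auto
    ultimately have "reach (S - {{x, y}}) x y"
      using reach_union_left[OF _ T AB x, of "S - {{x, y}}" y] by auto
    then show False using cycle_free_separates[OF S(2) xy] by simp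
  qed
  show ?thesis
    unfolding cycle_free_iff
  proof (intro allI impI)
    fix x y assume xy: "x \<noteq> y" "{x, y} \<in> S \<union> T"
    show "\<not> reach (S \<union> T - {{x, y}}) x y"
    proof (cases "{x, y} \<in> S")
      case True
      then show ?thesis using aux[OF S T(1) AB] xy(1) by simp
    next
      case False
      then have "{x, y} \<in> T" using xy by simp
      moreover have "B \<inter> A = {}" using AB by auto
      ultimately have "\<not> reach (T \<union> S - {{x, y}}) x y"
        using aux[OF T S(1)] xy(1) by simp
      then show ?thesis by (simp add: Un_commute)
    qed
  qed
qed

lemma component_union:
  assumes "is_tree A S" "T \<subseteq> complete_edges B" "A \<inter> B = {}" "x \<in> A"
  shows "component (S \<union> T) x = A"
proof -
  have S: "S \<subseteq> complete_edges A" using assms(1) by (simp add: is_tree_def)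
  have "y \<in> A" if "reach (S \<union> T) x y" for y
    using reach_union_left[OF S assms(2-4) that] by simp
  moreover have "reach (S \<union> T) x y" if "y \<in> A" for y
  proof (rule reach_mono)
    show "reach S x y" using assms(1,4) that by (simp add: is_tree_def connected_graph_reach)
  qed simp
  ultimately show ?thesis by (auto simp: mem_component)
qed

lemma component_subset:
  assumes "F \<subseteq> complete_edges V" "v \<in> V"
  shows "component F v \<subseteq> V"
proof
  fix y assume "y \<in> component F v"
  then have "reach F v y" by (simp add: mem_component)
  then show "y \<in> V"
  proof (induction rule: reach_induct)
    case (step a b)
    then show ?case using assms(1) complete_edges_pairD(3)[of a b V] by auto
  qed (rule assms(2))
qed

lemma component_split:
  assumes F: "F \<subseteq> complete_edges V" "cycle_free F" and v: "v \<in> V"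
  defines "A \<equiv> component F v"
  shows "is_tree A (F \<inter> Pow A)" "F = (F \<inter> Pow A) \<union> (F \<inter> Pow (V - A))"
    "F \<inter> Pow (V - A) \<subseteq> complete_edges (V - A)"
proof -
  have closed: "y \<in> A" if "x \<in> A" "{x, y} \<in> F" for x y
    using that reach_edge[of x y F] by (simp add: A_def mem_component reach_iff_eq)
  have "reach (F \<inter> Pow A) x y" if "x \<in> A" "y \<in> A" for x y
  proof -
    have "reach F x y" using that by (simp add: A_def mem_component reach_iff_eq)
    then show ?thesis using reach_restrict[OF _ that(1) closed] by simp
  qed
  moreover have "v \<in> A" by (simp add: A_def mem_component)
  moreover have "F \<inter> Pow A \<subseteq> complete_edges A" using F(1) by (auto simp: complete_edges_def)
  moreover have "cycle_free (F \<inter> Pow A)" using F(2) by (rule cycle_free_mono) simp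
  ultimately show "is_tree A (F \<inter> Pow A)"
    by (auto simp: is_tree_def connected_graph_reach)
  show "F \<inter> Pow (V - A) \<subseteq> complete_edges (V - A)" using F(1) by (auto simp: complete_edges_def)
  have "e \<subseteq> A \<or> e \<subseteq> V - A" if e: "e \<in> F" for e
  proof -
    from e F(1) obtain x y where xy: "e = {x, y}" "x \<in> V" "y \<in> V" by (blast elim: complete_edgesE)
    then have "x \<in> A \<longleftrightarrow> y \<in> A"
      using closed[of x y] closed[of y x] e by (auto simp: insert_commute)
    then show ?thesis using xy by auto
  qed
  then show "F = (F \<inter> Pow A) \<union> (F \<inter> Pow (V - A))" by blast
qed

section \<open>Recursive counts of trees and forests\<close>

lemma spanning_trees_complete: "spanning_trees V (complete_edges V) = {T. is_tree V T}"
  by (auto simp: spanning_trees_def is_tree_def)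

lemma finite_is_tree: "finite V \<Longrightarrow> finite {T. is_tree V T}"
  by (rule finite_subset[of _ "Pow (complete_edges V)"])
    (auto simp: is_tree_def finite_complete_edges)

definition forests_on :: "'a set \<Rightarrow> 'a set set set" where
  "forests_on V = spanning_forests (complete_edges V)"

lemma finite_forests_on: "finite V \<Longrightarrow> finite (forests_on V)"
  by (rule finite_subset[of _ "Pow (complete_edges V)"])
    (auto simp: forests_on_def spanning_forests_def finite_complete_edges)

text \<open>A forest is split at the component \<open>A\<close> of \<open>v\<close>: a tree on
  \<open>A\<close> and an arbitrary forest on the remaining vertices.\<close>

lemma card_forests_rec:
  assumes V: "finite V" and v: "v \<in> V"
  shows "card (forests_on V) = (\<Sum>A | A \<subseteq> V \<and> v \<in> A. card {T. is_tree A T} * card (forests_on (V - A)))"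
proof -
  let ?S = "SIGMA A : {A. A \<subseteq> V \<and> v \<in> A}. {T. is_tree A T} \<times> forests_on (V - A)"
  let ?f = "\<lambda>(A, T, F). T \<union> F"
  have "bij_betw ?f ?S (forests_on V)"
    unfolding bij_betw_def
  proof
    show "inj_on ?f ?S"
    proof (rule inj_onI)
      fix p q assume pq: "p \<in> ?S" "q \<in> ?S" "?f p = ?f q"
      obtain A T F where p: "p = (A, T, F)" by (cases p)
      obtain A' T' F' where q: "q = (A', T', F')" by (cases q)
      have *: "A \<subseteq> V" "v \<in> A" "is_tree A T" "F \<in> forests_on (V - A)"
        "A' \<subseteq> V" "v \<in> A'" "is_tree A' T'" "F' \<in> forests_on (V - A')" "T \<union> F = T' \<union> F'"
        using pq unfolding p q by simp_all
      have F: "F \<subseteq> complete_edges (V - A)" "F' \<subseteq> complete_edges (V - A')"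
        using * by (auto simp: forests_on_def spanning_forests_def)
      have T: "T \<subseteq> complete_edges A" "T' \<subseteq> complete_edges A'" using * by (auto simp: is_tree_def)
      have d: "A \<inter> (V - A) = {}" "A' \<inter> (V - A') = {}" by auto
      have "component (T \<union> F) v = A" "component (T' \<union> F') v = A'"
        using component_union[OF *(3) F(1) d(1) *(2)] component_union[OF *(7) F(2) d(2) *(6)] .
      then have A: "A = A'" using *(9) by simp
      note i = inter_Pow_union[OF T(1) F(1) d(1)] inter_Pow_union[OF T(2) F(2) d(2)]
      have "T = T'" using i(1,3) unfolding A *(9) by (rule trans[OF sym])
      moreover have "F = F'" using i(2,4) unfolding A *(9) by (rule trans[OF sym])
      ultimately show "p = q" using A by (simp add: p q)
    qed
    show "?f ` ?S = forests_on V"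
    proof (intro equalityI subsetI)
      fix G assume "G \<in> ?f ` ?S"
      then obtain A T F where *: "A \<subseteq> V" "is_tree A T" "F \<in> forests_on (V - A)" "G = T \<union> F" by auto
      have "cycle_free (T \<union> F)"
        by (rule cycle_free_union[of T A F "V - A"])
          (use * in \<open>auto simp: is_tree_def forests_on_def spanning_forests_def\<close>)
      moreover have "T \<subseteq> complete_edges V" "F \<subseteq> complete_edges V"
        using * by (auto simp: is_tree_def forests_on_def spanning_forests_def complete_edges_def)
      ultimately show "G \<in> forests_on V" using *(4) by (simp add: forests_on_def spanning_forests_def)
    next
      fix F assume "F \<in> forests_on V"
      then have F: "F \<subseteq> complete_edges V" "cycle_free F"
        by (auto simp: forests_on_def spanning_forests_def)
      let ?A = "component F v"
      note split = component_split[OF F v]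
      have "cycle_free (F \<inter> Pow (V - ?A))" using F(2) by (rule cycle_free_mono) simp
      then have "(?A, F \<inter> Pow ?A, F \<inter> Pow (V - ?A)) \<in> ?S"
        using split component_subset[OF F(1) v]
        by (auto simp: forests_on_def spanning_forests_def mem_component)
      then show "F \<in> ?f ` ?S" using split(2) by (intro rev_image_eqI) auto
    qed
  qed
  then have "card (forests_on V) = card ?S" by (simp add: bij_betw_same_card)
  also have "\<dots> = (\<Sum>A | A \<subseteq> V \<and> v \<in> A. card ({T. is_tree A T} \<times> forests_on (V - A)))"
  proof (rule card_SigmaI[rule_format])
    fix A assume "A \<in> {A. A \<subseteq> V \<and> v \<in> A}"
    then have "finite A" using V by (auto intro: finite_subset)
    then show "finite ({T. is_tree A T} \<times> forests_on (V - A))"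
      using V by (simp add: finite_is_tree finite_forests_on)
  qed (simp add: V)
  finally show ?thesis by (simp add: card_cartesian_product)
qed

text \<open>A tree is cut at the first edge of its path from \<open>v\<close> to \<open>w\<close>; \<open>A\<close> is the side of \<open>w\<close>.\<close>

lemma card_trees_rec:
  assumes V: "finite V" and v: "v \<in> V" and w: "w \<in> V" "v \<noteq> w"
  shows "card {T. is_tree V T} = (\<Sum>A | A \<subseteq> V \<and> w \<in> A \<and> v \<notin> A.
    card A * (card {T. is_tree A T} * card {T. is_tree (V - A) T}))"
proof -
  let ?I = "{A. A \<subseteq> V \<and> w \<in> A \<and> v \<notin> A}"
  \<comment> \<open>The entry from \<open>A\<close> is the far end of the cut edge, whose other end
    is \<open>v\<close>; choosing it gives the factor \<open>card A\<close>.\<close>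
  let ?S = "SIGMA A : ?I. A \<times> ({T. is_tree A T} \<times> {T. is_tree (V - A) T})"
  let ?f = "\<lambda>(A, a, S, T). insert {v, a} (S \<union> T)"
  have good: "is_tree V (insert {v, a} (S \<union> T)) \<and> insert {v, a} (S \<union> T) - {{v, a}} = S \<union> T
      \<and> reach (S \<union> T) a w \<and> component (S \<union> T) w = A"
    if A: "A \<subseteq> V" "w \<in> A" "v \<notin> A" "a \<in> A" and S: "is_tree A S" and T: "is_tree (V - A) T" for A a S T
  proof -
    have ST: "S \<subseteq> complete_edges A" "T \<subseteq> complete_edges (V - A)" "cycle_free S" "cycle_free T"
      using S T by (auto simp: is_tree_def)
    have d: "A \<inter> (V - A) = {}" by auto
    have cA: "component (S \<union> T) x = A" if "x \<in> A" for x
      using S ST(2) d that by (rule component_union)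
    have cB: "component (S \<union> T) x = V - A" if "x \<in> V - A" for x
      using component_union[OF T ST(1) _ that] by (simp add: Un_commute Int_commute)
    have cv: "component (S \<union> T) v = V - A" using v A by (intro cB) auto
    have ca: "component (S \<union> T) a = A" using A by (intro cA)
    have sep: "\<not> reach (S \<union> T) v a" using ca cv A by (auto simp: reach_iff_eq)
    have notin: "{v, a} \<notin> S \<union> T" using sep reach_edge[of v a "S \<union> T"] by auto
    have "cycle_free (S \<union> T)" using ST d by (intro cycle_free_union[of S A T "V - A"])
    moreover have "v \<noteq> a" using A by auto
    ultimately have "cycle_free (insert {v, a} (S \<union> T))"
      using sep notin by (simp add: cycle_free_insert)
    moreover have "insert {v, a} (S \<union> T) \<subseteq> complete_edges V"
      using ST A v \<open>v \<noteq> a\<close> by (auto simp: complete_edges_def)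
    moreover have "reach (insert {v, a} (S \<union> T)) x y" if "x \<in> V" "y \<in> V" for x y
    proof -
      have "component (S \<union> T) x = A \<or> component (S \<union> T) x = V - A"
        "component (S \<union> T) y = A \<or> component (S \<union> T) y = V - A"
        using cA cB that by blast+
      then show ?thesis unfolding reach_insert unfolding reach_iff_eq ca cv by auto
    qed
    ultimately have "is_tree V (insert {v, a} (S \<union> T))"
      using v by (auto simp: is_tree_def connected_graph_reach)
    moreover have "reach (S \<union> T) a w" using cA A by (simp add: reach_iff_eq)
    moreover have "insert {v, a} (S \<union> T) - {{v, a}} = S \<union> T" using notin by auto
    ultimately show ?thesis using cA A by simp
  qed
  have "bij_betw ?f ?S {T. is_tree V T}"
    unfolding bij_betw_def
  proof
    show "inj_on ?f ?S"
    proof (rule inj_onI)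
      fix p q assume pq: "p \<in> ?S" "q \<in> ?S" "?f p = ?f q"
      obtain A a S T where p: "p = (A, a, S, T)" by (cases p)
      obtain A' a' S' T' where q: "q = (A', a', S', T')" by (cases q)
      have *: "A \<subseteq> V" "w \<in> A" "v \<notin> A" "a \<in> A" "is_tree A S" "is_tree (V - A) T"
        "A' \<subseteq> V" "w \<in> A'" "v \<notin> A'" "a' \<in> A'" "is_tree A' S'" "is_tree (V - A') T'"
        using pq unfolding p q by simp_all
      have eq: "insert {v, a} (S \<union> T) = insert {v, a'} (S' \<union> T')"
        using pq unfolding p q by simp
      let ?X = "insert {v, a} (S \<union> T)"
      note g = good[OF *(1-6)] and g' = good[OF *(7-12)]
      \<comment> \<open>The tree determines \<open>a\<close> as the next hop from \<open>v\<close>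
        towards \<open>w\<close>.\<close>
      have aa: "a = a'"
      proof (rule cycle_free_first_edge_unique)
        show "cycle_free ?X" using g by (simp add: is_tree_def)
        show "{v, a} \<in> ?X" by simp
        show "{v, a'} \<in> ?X" unfolding eq by simp
        show "v \<noteq> a" "v \<noteq> a'" using * by auto
        show "reach (?X - {{v, a}}) a w" using g by simp
        show "reach (?X - {{v, a'}}) a' w" unfolding eq using g' by simp
      qed
      have "S \<union> T = insert {v, a} (S \<union> T) - {{v, a}}" using g by simp
      also have "\<dots> = insert {v, a'} (S' \<union> T') - {{v, a}}" by (simp only: eq)
      also have "\<dots> = S' \<union> T'" unfolding aa using g' by simp
      finally have U: "S \<union> T = S' \<union> T'" .
      have "A = component (S \<union> T) w" using g by simp
      also have "\<dots> = A'" unfolding U using g' by simp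
      finally have A: "A = A'" .
      have sub: "S \<subseteq> complete_edges A" "T \<subseteq> complete_edges (V - A)"
        "S' \<subseteq> complete_edges A'" "T' \<subseteq> complete_edges (V - A')"
        using * by (auto simp: is_tree_def)
      have d: "A \<inter> (V - A) = {}" "A' \<inter> (V - A') = {}" by auto
      note i = inter_Pow_union[OF sub(1,2) d(1)] inter_Pow_union[OF sub(3,4) d(2)]
      have "S = S'" using i(1,3) unfolding A U by (rule trans[OF sym])
      moreover have "T = T'" using i(2,4) unfolding A U by (rule trans[OF sym])
      ultimately show "p = q" using A aa by (simp add: p q)
    qed
    show "?f ` ?S = {T. is_tree V T}"
    proof (intro equalityI subsetI)
      fix X assume "X \<in> ?f ` ?S"
      then show "X \<in> {T. is_tree V T}" using good by auto
    next
      fix X assume "X \<in> {T. is_tree V T}"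
      then have X: "is_tree V X" by simp
      then have "reach X v w" using v w by (simp add: is_tree_def connected_graph_reach)
      from reach_first_edge[OF this w(2)] obtain a
        where a: "{v, a} \<in> X" "reach (X - {{v, a}}) a w" by blast
      let ?F = "X - {{v, a}}"
      have XV: "X \<subseteq> complete_edges V" "cycle_free X" using X by (auto simp: is_tree_def)
      have va: "v \<noteq> a" "a \<in> V" using XV a(1) complete_edges_pairD[of v a V] by auto
      have F: "?F \<subseteq> complete_edges V" "cycle_free ?F"
        using XV by (auto intro: cycle_free_mono)
      let ?A = "component ?F w"
      note split = component_split[OF F w(1)]
      have sides: "reach ?F x v \<noteq> reach ?F x a" if "x \<in> V" for x
        using tree_edge_sides[OF X a(1) that] .
      have wa: "component ?F a = ?A" using a(2) by (simp add: reach_iff_eq)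
      have memA: "x \<in> ?A \<longleftrightarrow> reach ?F x a" for x
        using wa by (auto simp: mem_component reach_iff_eq)
      have vA: "v \<notin> ?A" using sides[OF v] memA by simp
      have B: "V - ?A = component ?F v"
      proof (intro equalityI subsetI)
        fix x assume "x \<in> V - ?A"
        then show "x \<in> component ?F v" using sides[of x] memA[of x]
          by (simp add: mem_component reach_commute)
      next
        fix x assume x: "x \<in> component ?F v"
        then have "x \<in> V" using component_subset[OF F(1) v] by auto
        then show "x \<in> V - ?A" using x sides[of x] memA[of x]
          by (simp add: mem_component reach_commute)
      qed
      have "is_tree (V - ?A) (?F \<inter> Pow (V - ?A))"
        unfolding B by (rule component_split(1)[OF F v])
      moreover have "w \<in> ?A" "a \<in> ?A" using memA a(2) by (auto simp: mem_component)
      ultimately have mem: "(?A, a, ?F \<inter> Pow ?A, ?F \<inter> Pow (V - ?A)) \<in> ?S"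
        using split(1) vA component_subset[OF F(1) w(1)] by simp
      have "insert {v, a} (?F \<inter> Pow ?A \<union> ?F \<inter> Pow (V - ?A)) = X"
        unfolding split(2)[symmetric] using a(1) by auto
      then show "X \<in> ?f ` ?S" by (intro rev_image_eqI[OF mem]) (simp only: prod.case)
    qed
  qed
  then have "card {T. is_tree V T} = card ?S" by (simp add: bij_betw_same_card)
  also have "\<dots> = (\<Sum>A\<in>?I. card (A \<times> ({T. is_tree A T} \<times> {T. is_tree (V - A) T})))"
  proof (rule card_SigmaI[rule_format])
    fix A assume "A \<in> ?I"
    then have "finite A" using V by (auto intro: finite_subset)
    then show "finite (A \<times> ({T. is_tree A T} \<times> {T. is_tree (V - A) T}))"
      using V by (simp add: finite_is_tree)
  qed (simp add: V)
  finally show ?thesis by (simp add: card_cartesian_product)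
qed

lemma sum_Pow_card:
  fixes g :: "nat \<Rightarrow> real"
  assumes "finite U"
  shows "(\<Sum>B\<in>Pow U. g (card B)) = (\<Sum>j\<le>card U. real (card U choose j) * g j)"
proof -
  have "(\<Sum>B\<in>Pow U. g (card B)) = (\<Sum>j\<le>card U. \<Sum>B | B \<in> Pow U \<and> card B = j. g (card B))"
    using assms by (intro sum.group[symmetric]) (auto intro: card_mono)
  also have "\<dots> = (\<Sum>j\<le>card U. real (card U choose j) * g j)"
  proof (intro sum.cong refl)
    fix j
    have "card {B. B \<in> Pow U \<and> card B = j} = card U choose j"
      using n_subsets[OF assms, of j] by simp
    then show "(\<Sum>B | B \<in> Pow U \<and> card B = j. g (card B)) = real (card U choose j) * g j" by simp
  qed
  finally show ?thesis .
qed

lemma sum_supersets_card: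
  fixes g :: "nat \<Rightarrow> real"
  assumes "finite U" "w \<notin> U"
  shows "(\<Sum>A | A \<subseteq> insert w U \<and> w \<in> A. g (card A)) = (\<Sum>j\<le>card U. real (card U choose j) * g (Suc j))"
proof -
  have "(\<Sum>A | A \<subseteq> insert w U \<and> w \<in> A. g (card A)) = (\<Sum>B\<in>Pow U. g (Suc (card B)))"
  proof (rule sum.reindex_bij_witness[where i = "insert w" and j = "\<lambda>A. A - {w}"])
    fix A assume A: "A \<in> {A. A \<subseteq> insert w U \<and> w \<in> A}"
    then show "insert w (A - {w}) = A" "A - {w} \<in> Pow U" by auto
    have "finite A" using A assms(1) by (auto intro: finite_subset)
    then show "g (Suc (card (A - {w}))) = g (card A)" using A card_Suc_Diff1[of A w] by simp
  next
    fix B assume "B \<in> Pow U"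
    then show "insert w B - {w} = B" "insert w B \<in> {A. A \<subseteq> insert w U \<and> w \<in> A}"
      using assms(2) by auto
  qed
  then show ?thesis using sum_Pow_card[OF assms(1), of "\<lambda>j. g (Suc j)"] by simp
qed

lemma is_tree_singleton: "{T. is_tree {v} T} = {{}}"
proof -
  have "complete_edges {v} = {}" by (auto simp: complete_edges_def card_2_iff)
  then show ?thesis by (auto simp: is_tree_def connected_graph_reach)
qed

text \<open>In \<open>card_trees_rec\<close>, j * \<open>abel (j - 1) 1\<close> is the pure power
  j^(j - 1), so the recursion becomes \<open>abel_binomial\<close> at x = y = 1.\<close>

theorem cayley: "finite V \<Longrightarrow> card V = Suc n \<Longrightarrow> real (card {T. is_tree V T}) = abel n 1"
proof (induction n arbitrary: V rule: less_induct)
  case (less n)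
  show ?case
  proof (cases n)
    case 0
    then obtain v where "V = {v}" using less.prems card_1_singletonE[of V] by auto
    then show ?thesis using 0 by (simp add: is_tree_singleton)
  next
    case (Suc N)
    then have "card V = Suc (Suc N)" using less.prems by simp
    from card_Suc_eq[THEN iffD1, OF this]
    obtain v W where VW: "V = insert v W" "v \<notin> W" "card W = Suc N" by blast
    from card_Suc_eq[THEN iffD1, OF this(3)]
    obtain w U where WU: "W = insert w U" "w \<notin> U" "card U = N" by blast
    have finU: "finite U" using less.prems VW WU by simp
    let ?g = "\<lambda>j. real j * (abel (j - 1) 1 * abel (Suc N - j) 1)"
    have I: "{A. A \<subseteq> V \<and> w \<in> A \<and> v \<notin> A} = {A. A \<subseteq> insert w U \<and> w \<in> A}"
      using VW WU by auto
    have "real (card {T. is_tree V T}) = (\<Sum>A | A \<subseteq> V \<and> w \<in> A \<and> v \<notin> A.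
      real (card A) * (real (card {T. is_tree A T}) * real (card {T. is_tree (V - A) T})))"
      using VW WU by (subst card_trees_rec[OF less.prems(1), of v w]) auto
    also have "\<dots> = (\<Sum>A | A \<subseteq> insert w U \<and> w \<in> A. ?g (card A))"
      unfolding I
    proof (intro sum.cong refl)
      fix A assume A: "A \<in> {A. A \<subseteq> insert w U \<and> w \<in> A}"
      then have AV: "A \<subseteq> V" "v \<notin> A" "finite A" "A \<noteq> {}" using VW WU finU by (auto intro: finite_subset)
      have cA: "card A \<le> Suc N" using A WU finU card_mono[of "insert w U" A] by simp
      have c1: "card A = Suc (card A - 1)" using AV by (simp add: card_gt_0_iff Suc_leI)
      have c2: "card (V - A) = Suc (Suc N - card A)"
        using AV cA less.prems(2) Suc by (simp add: card_Diff_subset Suc_diff_le)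
      have "real (card {T. is_tree A T}) = abel (card A - 1) 1"
        using cA Suc c1 AV by (intro less.IH) auto
      moreover have "real (card {T. is_tree (V - A) T}) = abel (Suc N - card A) 1"
        using c1 Suc c2 less.prems(1) by (intro less.IH) auto
      ultimately show "real (card A) * (real (card {T. is_tree A T}) * real (card {T. is_tree (V - A) T})) = ?g (card A)"
        by simp
    qed
    also have "\<dots> = (\<Sum>j\<le>N. real (N choose j) * ?g (Suc j))"
      using sum_supersets_card[OF finU WU(2), of ?g] WU(3) by simp
    also have "\<dots> = (\<Sum>k\<le>N. real (N choose k) * abel k 1 * (1 + real (N - k)) ^ (N - k))"
    proof (rule sum.reindex_bij_witness[where i = "\<lambda>k. N - k" and j = "\<lambda>j. N - j"])
      fix j assume "j \<in> {..N}"
      then have j: "j \<le> N" by simp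
      have "real (Suc j) * abel j 1 = (1 + real j) ^ j"
        by (cases j) (simp_all add: abel_Suc)
      then show "real (N choose (N - j)) * abel (N - j) 1 * (1 + real (N - (N - j))) ^ (N - (N - j))
          = real (N choose j) * ?g (Suc j)"
        using j by (simp add: binomial_symmetric[symmetric] mult_ac)
    qed auto
    also have "\<dots> = abel n 1" unfolding abel_binomial by (simp add: Suc abel_Suc)
    finally show ?thesis .
  qed
qed

text \<open>Splitting off the component of a vertex, counted by \<open>cayley\<close>, reproduces
  the recursion \<open>forest_number_Suc\<close>.\<close>

theorem card_forests_complete: "finite V \<Longrightarrow> real (card (forests_on V)) = forest_number (card V)"
proof (induction "card V" arbitrary: V rule: less_induct)
  case less
  show ?case
  proof (cases "card V")
    case 0
    then have "V = {}" using less.prems by simp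
    then have "forests_on V = {{}}"
      by (auto simp: forests_on_def spanning_forests_def complete_edges_def card_2_iff)
    then show ?thesis using 0 by (simp add: forest_number_def abel_poly_def umbral_def)
  next
    case (Suc n)
    from card_Suc_eq[THEN iffD1, OF this]
    obtain v U where VU: "V = insert v U" "v \<notin> U" "card U = n" by blast
    have finU: "finite U" using less.prems VU by simp
    let ?g = "\<lambda>j. abel (j - 1) 1 * forest_number (Suc n - j)"
    have "real (card (forests_on V)) = (\<Sum>A | A \<subseteq> V \<and> v \<in> A.
        real (card {T. is_tree A T}) * real (card (forests_on (V - A))))"
      using VU by (subst card_forests_rec[OF less.prems, of v]) auto
    also have "\<dots> = (\<Sum>A | A \<subseteq> V \<and> v \<in> A. ?g (card A))"
    proof (intro sum.cong refl)
      fix A assume "A \<in> {A. A \<subseteq> V \<and> v \<in> A}"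
      then have A: "A \<subseteq> V" "finite A" "A \<noteq> {}" using less.prems by (auto intro: finite_subset)
      have c1: "card A = Suc (card A - 1)" using A by (simp add: card_gt_0_iff Suc_leI)
      have c2: "card (V - A) = Suc n - card A"
        using A Suc by (simp add: card_Diff_subset)
      have "real (card {T. is_tree A T}) = abel (card A - 1) 1"
        using A(2) c1 by (rule cayley)
      moreover have "real (card (forests_on (V - A))) = forest_number (card (V - A))"
        using c1 c2 Suc less.prems by (intro less.hyps) auto
      ultimately show "real (card {T. is_tree A T}) * real (card (forests_on (V - A))) = ?g (card A)"
        by (simp add: c2)
    qed
    also have "\<dots> = (\<Sum>j\<le>n. real (n choose j) * ?g (Suc j))"
      using sum_supersets_card[OF finU VU(2), of ?g] VU by simp
    also have "\<dots> = forest_number (Suc n)" unfolding forest_number_Suc by (simp add: mult.assoc)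
    finally show ?thesis using Suc by simp
  qed
qed

lemma forest_tree_ratio_complete:
  assumes "n \<ge> 2"
  shows "forest_tree_ratio {..<n} (complete_edges {..<n}) = forest_number n / real n ^ (n - 2)"
proof -
  have "real (card (spanning_trees {..<n} (complete_edges {..<n}))) = abel (n - 1) 1"
    unfolding spanning_trees_complete using assms by (intro cayley) auto
  also have "\<dots> = real n ^ (n - 2)"
  proof -
    obtain k where "n = Suc (Suc k)" using assms by (metis Suc_le_D add_2_eq_Suc le_add_diff_inverse)
    then show ?thesis by (simp add: abel_Suc)
  qed
  finally show ?thesis
    using card_forests_complete[of "{..<n}"] by (simp add: forest_tree_ratio_def forests_on_def)
qed

text \<open>Relaxed to exponential form so that, with slack e / 4, it meets
  \<open>ratio_lower\<close> at the same exponent.\<close>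

lemma forest_tree_ratio_complete_upper:
  assumes "\<eta> > 0"
  shows "\<forall>\<^sub>F n in sequentially. forest_tree_ratio {..<n} (complete_edges {..<n})
    \<le> exp (1 / 2 + (5 / 2 + \<eta>) / real n)"
proof -
  have "5 / 2 * exp (1 / 2) < (5 / 2 + \<eta>) * exp (1 / 2)" using assms by simp
  from order_tendstoD(2)[OF forest_number_asymptotics this] eventually_ge_at_top[of 2]
  show ?thesis
  proof eventually_elim
    case (elim n)
    let ?Q = "forest_number n / real n ^ (n - 2)"
    have n: "real n > 0" using elim by simp
    have "?Q - exp (1 / 2) \<le> (5 / 2 + \<eta>) * exp (1 / 2) / real n"
      using elim(1) n by (simp add: pos_le_divide_eq mult.commute less_imp_le)
    then have "?Q \<le> exp (1 / 2) * (1 + (5 / 2 + \<eta>) / real n)"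
      by (simp add: algebra_simps)
    also have "\<dots> \<le> exp (1 / 2) * exp ((5 / 2 + \<eta>) / real n)"
      by (intro mult_left_mono exp_ge_add_one_self) simp
    finally show ?case using elim(2) by (simp add: forest_tree_ratio_complete exp_add)
  qed
qed

section \<open>The main estimate\<close>

context conn_graph
begin

section \<open>Small cuts and vertices of low degree\<close>

lemma card_complete_edges: "card (complete_edges V) = card V choose 2"
  unfolding complete_edges_def using n_subsets[OF finV, of 2] by simp

lemma card_complete_diff: "card (complete_edges V - E) + card E = card V choose 2"
  using card_mono[OF finite_complete_edges[OF finV] EV]
  by (simp add: card_Diff_subset[OF finE EV] card_complete_edges)

text \<open>Every pair across the partition is an edge of the cut or a missing edge.\<close>

lemma cut_card_ge:
  assumes F: "F \<in> biforests" and r: "r \<in> V"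
  defines "A \<equiv> {v \<in> V. \<not> reach F v r}"
  shows "card A * card (V - A) \<le> card (cut F) + card (complete_edges V - E)"
proof -
  have sep: "\<not> reach F u v" if "u \<in> A" "v \<in> V - A" for u v
    using that by (auto simp: A_def reach_iff_eq)
  have "inj_on (\<lambda>(u, v). {u, v}) (A \<times> (V - A))"
    by (auto simp: inj_on_def doubleton_eq_iff)
  then have "card A * card (V - A) = card ((\<lambda>(u, v). {u, v}) ` (A \<times> (V - A)))"
    by (simp add: card_image card_cartesian_product)
  also have "\<dots> \<le> card (cut F \<union> (complete_edges V - E))"
  proof (rule card_mono)
    show "finite (cut F \<union> (complete_edges V - E))"
      using finite_cut finite_complete_edges[OF finV] by simp
    show "(\<lambda>(u, v). {u, v}) ` (A \<times> (V - A)) \<subseteq> cut F \<union> (complete_edges V - E)"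
    proof
      fix f assume "f \<in> (\<lambda>(u, v). {u, v}) ` (A \<times> (V - A))"
      then obtain u v where f: "f = {u, v}" and uv: "u \<in> A" "v \<in> V - A" by auto
      then have "u \<noteq> v" "u \<in> V" "v \<in> V" by (auto simp: A_def)
      then have "{u, v} \<in> complete_edges V" by (auto simp: complete_edges_def)
      then show "f \<in> cut F \<union> (complete_edges V - E)"
        using sep[OF uv] cut_iff[of u v F] f by auto
    qed
  qed
  also have "\<dots> \<le> card (cut F) + card (complete_edges V - E)" by (rule card_Un_le)
  finally show ?thesis .
qed

abbreviation isolated :: "'a set set \<Rightarrow> 'a \<Rightarrow> bool" where
  "isolated F x \<equiv> \<forall>y\<in>V. y \<noteq> x \<longrightarrow> \<not> reach F x y"

text \<open>If both sides had at least two vertices, the product of their sizes would be at least 2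
  (n - 2), contradicting \<open>cut_card_ge\<close>. The edges at the isolated vertex all belong to
  the cut.\<close>

lemma small_cut_isolated:
  assumes F: "F \<in> biforests"
    and small: "card (cut F) + card (complete_edges V - E) < 2 * (card V - 2)" and n: "card V \<ge> 2"
  shows "\<exists>x\<in>V. isolated F x \<and> card (nb x) \<le> card (cut F)"
proof -
  obtain r where r: "r \<in> V" using conn by (auto simp: connected_graph_def)
  define A where "A = {v \<in> V. \<not> reach F v r}"
  have AV: "A \<subseteq> V" "finite A" using finV by (auto simp: A_def)
  have "A \<noteq> {}"
  proof
    assume "A = {}"
    then have *: "reach F v r" if "v \<in> V" for v using that unfolding A_def by blast
    from F obtain x y where "x \<in> V" "y \<in> V" "\<not> reach F x y" unfolding two_forests_def by blast
    then show False using *[of x] *[of y] by (simp add: reach_iff_eq)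
  qed
  then have a1: "card A \<ge> 1" using AV by (simp add: Suc_le_eq card_gt_0_iff)
  have "r \<in> V - A" using r by (simp add: A_def)
  then have b1: "card (V - A) \<ge> 1" using finV by (auto simp: Suc_le_eq card_gt_0_iff)
  have sum: "card A + card (V - A) = card V"
    using AV finV card_mono[of V A] by (simp add: card_Diff_subset)
  have prod: "card A * card (V - A) < 2 * (card V - 2)"
    using cut_card_ge[OF F r] small unfolding A_def[symmetric] by linarith
  have "card A = 1 \<or> card (V - A) = 1"
  proof (rule ccontr)
    assume "\<not> ?thesis"
    moreover define p where "p = card A - 2"
    moreover define q where "q = card (V - A) - 2"
    ultimately have pq: "card A = p + 2" "card (V - A) = q + 2" using a1 b1 by linarith+
    then have "card V = p + q + 4" using sum by simp
    then show False using prod pq by (simp add: algebra_simps)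
  qed
  then have "\<exists>x\<in>V. isolated F x"
  proof
    assume "card A = 1"
    then obtain x where x: "A = {x}" by (rule card_1_singletonE)
    then have "x \<in> V" "\<not> reach F x r" unfolding A_def by auto
    moreover have "reach F y r" if "y \<in> V" "y \<noteq> x" for y
      using that x unfolding A_def by blast
    ultimately have "isolated F x" by (auto simp: reach_iff_eq)
    then show ?thesis using \<open>x \<in> V\<close> by blast
  next
    assume "card (V - A) = 1"
    then obtain x where x: "V - A = {x}" by (rule card_1_singletonE)
    then have "x = r" using \<open>r \<in> V - A\<close> by simp
    then have "\<not> reach F r y" if "y \<in> V" "y \<noteq> r" for y
      using that x unfolding A_def reach_commute[of F r] by blast
    then show ?thesis using r by blast
  qed
  then obtain x where x: "x \<in> V" "isolated F x" by blast
  have "card (nb x) = card ((\<lambda>y. {x, y}) ` nb x)"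
    by (rule card_image[symmetric]) (auto simp: inj_on_def doubleton_eq_iff)
  also have "\<dots> \<le> card (cut F)"
  proof (rule card_mono[OF finite_cut])
    show "(\<lambda>y. {x, y}) ` nb x \<subseteq> cut F"
    proof (rule image_subsetI)
      fix y assume "y \<in> nb x"
      then have e: "{x, y} \<in> E" by (simp add: nb_def)
      then have "\<not> reach F x y" using x(2) edgeD[OF e] by auto
      then show "{x, y} \<in> cut F" using e by (simp add: cut_iff)
    qed
  qed
  finally show ?thesis using x by blast
qed

text \<open>The missing degrees of all vertices add up to twice the number of missing edges, and
  each vertex of \<open>X\<close> takes at least \<open>card V - 1 - d\<close> of that.\<close>

lemma card_low_degree:
  assumes X: "X \<subseteq> V" "\<And>x. x \<in> X \<Longrightarrow> real (card (nb x)) \<le> d"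
  shows "real (card X) * (real (card V) - 1 - d) \<le> 2 * real (card (complete_edges V - E))"
proof -
  have deg: "real (card (nb x)) \<le> real (card V) - 1" if "x \<in> V" for x
  proof -
    have "x \<notin> nb x" using edgeD(1)[of x x] by (auto simp: nb_def)
    then have "nb x \<subseteq> V - {x}" using nb_subset by auto
    then have "card (nb x) \<le> card (V - {x})" using finV by (intro card_mono) auto
    also have "\<dots> = card V - 1" using that by simp
    finally show ?thesis using that finV card_gt_0_iff[of V] by (auto simp: of_nat_diff)
  qed
  have "real (card X) * (real (card V) - 1 - d) = (\<Sum>x\<in>X. real (card V) - 1 - d)" by simp
  also have "\<dots> \<le> (\<Sum>x\<in>X. real (card V) - 1 - real (card (nb x)))"
    using X(2) by (intro sum_mono) simp
  also have "\<dots> \<le> (\<Sum>x\<in>V. real (card V) - 1 - real (card (nb x)))"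
    using X(1) finV deg by (intro sum_mono2) auto
  also have "\<dots> = real (card V) * (real (card V) - 1) - 2 * real (card E)"
    using sum_handshake[of "\<lambda>_. 1"] by (simp add: sum_subtractf)
  also have "\<dots> = 2 * real (card (complete_edges V - E))"
  proof -
    have "real (card V choose 2) = real (card V) * (real (card V) - 1) / 2"
      by (simp add: binomial_gbinomial gbinomial_prod_rev numeral_2_eq_2 algebra_simps)
    then show ?thesis using card_complete_diff by linarith
  qed
  finally show ?thesis .
qed

text \<open>The bound \<open>1 / (2 c)\<close> on the loss in Jensen's inequality is summed separately over the
  forests with a cut of nearly full size and over those isolating a vertex of low degree; the
  latter are few because such a forest with cut size \<open>c\<close> extends to \<open>c\<close> spanning trees.\<close>

lemma sum_inverse_cut:
  assumes k: "k > 0" "\<And>F. F \<in> biforests \<Longrightarrow> 1 \<le> k * real (card (cut F))"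
    and c0: "c0 > 0" "c0 + real (card (complete_edges V - E)) \<le> 2 * (real (card V) - 2)"
    and n: "card V \<ge> 2"
  shows "(\<Sum>F\<in>biforests. 1 / (2 * real (card (cut F)))) / tau
    \<le> sratio / (2 * c0) + real (card {x \<in> V. real (card (nb x)) \<le> c0}) * k\<^sup>2 / 2"
proof -
  let ?c = "\<lambda>F. real (card (cut F))" and ?X = "{x \<in> V. real (card (nb x)) \<le> c0}"
  have finX: "finite ?X" using finV by simp
  have "1 / (2 * ?c F) \<le> 1 / (2 * c0) + (\<Sum>x\<in>?X. k\<^sup>2 / 2 * (of_bool (isolated F x) * ?c F))"
    if F: "F \<in> biforests" for F
  proof -
    have cpos: "?c F > 0" using k(2)[OF F] k(1) by (cases "?c F = 0") auto
    have nn: "0 \<le> (\<Sum>x\<in>?X. k\<^sup>2 / 2 * (of_bool (isolated F x) * ?c F))"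
      by (intro sum_nonneg mult_nonneg_nonneg) auto
    show ?thesis
    proof (cases "?c F < c0")
      case True
      have "real (card (cut F) + card (complete_edges V - E)) < real (2 * (card V - 2))"
        using True c0 n by (simp add: of_nat_diff)
      then have "card (cut F) + card (complete_edges V - E) < 2 * (card V - 2)"
        by (simp only: of_nat_less_iff)
      from small_cut_isolated[OF F this n] obtain x
        where x: "x \<in> V" "isolated F x" "card (nb x) \<le> card (cut F)" by blast
      then have xX: "x \<in> ?X" using True by simp
      \<comment> \<open>Writing 1/(2c) as c (1/c)^2 / 2 creates the factor c that
        \<open>sum_cut_isolated\<close> requires.\<close>
      have "(1 / ?c F)\<^sup>2 \<le> k\<^sup>2"
        using k(2)[OF F] cpos by (intro power_mono) (auto simp: divide_le_eq)
      then have "(1 / ?c F)\<^sup>2 * (?c F / 2) \<le> k\<^sup>2 * (?c F / 2)"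
        by (rule mult_right_mono) simp
      then have "1 / (2 * ?c F) \<le> k\<^sup>2 / 2 * (of_bool (isolated F x) * ?c F)"
        using cpos x(2) by (simp add: power2_eq_square field_simps)
      also have "\<dots> \<le> (\<Sum>x\<in>?X. k\<^sup>2 / 2 * (of_bool (isolated F x) * ?c F))"
        using xX finX by (intro member_le_sum) auto
      finally show ?thesis using c0 by (simp add: add_increasing)
    next
      case False
      then have "1 / (2 * ?c F) \<le> 1 / (2 * c0)" using c0 by (intro divide_left_mono) auto
      then show ?thesis using nn by linarith
    qed
  qed
  then have "(\<Sum>F\<in>biforests. 1 / (2 * ?c F))
      \<le> (\<Sum>F\<in>biforests. 1 / (2 * c0) + (\<Sum>x\<in>?X. k\<^sup>2 / 2 * (of_bool (isolated F x) * ?c F)))"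
    by (rule sum_mono)
  also have "\<dots> = real (card biforests) / (2 * c0)
      + (\<Sum>x\<in>?X. k\<^sup>2 / 2 * (\<Sum>F\<in>biforests. of_bool (isolated F x) * ?c F))"
    unfolding sum.distrib sum_distrib_left by (subst sum.swap) simp
  also have "\<dots> \<le> real (card biforests) / (2 * c0) + (\<Sum>x\<in>?X. k\<^sup>2 / 2 * tau)"
    using sum_cut_isolated[OF _ n] by (intro add_left_mono sum_mono mult_left_mono) auto
  finally have "(\<Sum>F\<in>biforests. 1 / (2 * ?c F)) / tau
      \<le> (real (card biforests) / (2 * c0) + (\<Sum>x\<in>?X. k\<^sup>2 / 2 * tau)) / tau"
    using tau_pos by (intro divide_right_mono) auto
  also have "\<dots> = sratio / (2 * c0) + real (card ?X) * k\<^sup>2 / 2"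
    using tau_pos by (simp add: sratio_def add_divide_distrib mult_ac)
  finally show ?thesis .
qed

text \<open>The alternative 17/10 lies above sqrt e, hence above Q(K_n) for large n; it settles
  graphs with large \<open>sratio\<close> without any estimate of the loss.\<close>

lemma ratio_lower:
  fixes e :: real
  assumes e: "0 < e" "e \<le> 1 / 10"
    and n: "real (card V) \<ge> 500 / e\<^sup>2"
    and m: "real (card E) < real (card V choose 2) - (1 / 4 + e) * real (card V)"
  shows "17 / 10 \<le> forest_tree_ratio V E \<or>
    exp (1 / 2 + (5 / 2 + e / 4) / real (card V)) < forest_tree_ratio V E"
proof -
  let ?N = "real (card V)" and ?S = sratio
  define D where "D = real (card (complete_edges V - E))"
  define M where "M = ?N * (?N - 1) / 2"
  obtain r where r: "r \<in> V" using conn by (auto simp: connected_graph_def)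
  define \<rho> where "\<rho> = rho r"
  define L where "L = (\<Sum>F\<in>biforests. 1 / (2 * real (card (cut F)))) / tau"
  have e2: "e\<^sup>2 \<le> e * (1 / 10)" using e by (simp add: power2_eq_square)
  have eN: "?N * e\<^sup>2 \<ge> 500" using n e by (simp add: pos_divide_le_eq)
  have N0: "?N > 0"
  proof -
    have "0 < 500 / e\<^sup>2" using e by simp
    then show ?thesis using n by linarith
  qed
  have eN': "?N * e \<ge> 5000"
  proof -
    have "500 \<le> ?N * (e * (1 / 10))" using eN mult_left_mono[OF e2, of ?N] N0 by linarith
    then show ?thesis by simp
  qed
  have N: "?N \<ge> 50000"
  proof -
    have "?N * e \<le> ?N * (1 / 10)" using e N0 by (intro mult_left_mono) auto
    then show ?thesis using eN' by linarith
  qed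
  have n2: "card V \<ge> 2" using N by simp
  have choose: "real (card V choose 2) = M"
    by (simp add: M_def binomial_gbinomial gbinomial_prod_rev numeral_2_eq_2 algebra_simps)
  have mD: "real (card E) = M - D" using card_complete_diff choose by (simp add: D_def)
  have D: "D > (1 / 4 + e) * ?N" using m mD choose by simp
  have E0: "card E > 0"
  proof (rule ccontr)
    assume "\<not> card E > 0"
    then have "E = {}" using finE by simp
    then show False using sum_edge_prob N by simp
  qed
  then have MD: "M - D > 0" using mD by linarith
  \<comment> \<open>From (M - D) (M + D) <= M^2, with (N - 1)^2 = 4 M^2 / N^2; this keeps the
    missing edges to first order.\<close>
  have B: "(?N - 1)\<^sup>2 / (4 * real (card E)) \<ge> 1 / 2 - 1 / (2 * ?N) + D / ?N\<^sup>2"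
  proof -
    have "(M + D) / ?N\<^sup>2 \<le> (?N - 1)\<^sup>2 / (4 * (M - D))"
    proof -
      have "(M + D) * (4 * (M - D)) \<le> 4 * M\<^sup>2"
        by (simp add: power2_eq_square algebra_simps)
      also have "4 * M\<^sup>2 = (?N - 1)\<^sup>2 * ?N\<^sup>2" by (simp add: M_def power2_eq_square)
      finally show ?thesis using MD N0 by (simp add: divide_simps mult_ac)
    qed
    moreover have "(M + D) / ?N\<^sup>2 = 1 / 2 - 1 / (2 * ?N) + D / ?N\<^sup>2"
      using N0 by (simp add: M_def power2_eq_square field_simps)
    ultimately show ?thesis by (simp add: mD)
  qed
  have S: "?S \<ge> 1 / 2 - 1 / (2 * ?N) + D / ?N\<^sup>2 + 3 * \<rho>"
    using sratio_ge[OF r E0] B by (simp add: \<rho>_def)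
  have rho: "\<rho> \<ge> (?N - 1) / ?N\<^sup>2" using rho_ge[OF r] by (simp add: \<rho>_def)
  have rho0: "\<rho> > 0"
  proof -
    have "(?N - 1) / ?N\<^sup>2 > 0" using N by simp
    then show ?thesis using rho by linarith
  qed
  have Q: "exp (?S - L) \<le> forest_tree_ratio V E"
    using ratio_ge_exp[OF r]
    by (simp add: L_def sratio_def sum_subtractf diff_divide_distrib)
  have conclude: ?thesis if "1 / 2 + (5 / 2 + e / 4) / ?N < ?S - L"
    using Q less_le_trans[OF exp_less_mono[OF that]] by blast
  have L1: "L \<le> 2 * \<rho> * ?S"
  proof -
    have "1 / (2 * real (card (cut F))) \<le> 2 * \<rho>" if "F \<in> biforests" for F
    proof -
      have "card (cut F) > 0" using cut_rho(2)[OF r that] finite_cut by (simp add: card_gt_0_iff)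
      then show ?thesis using cut_rho(1)[OF r that] by (simp add: divide_le_eq \<rho>_def)
    qed
    then have "(\<Sum>F\<in>biforests. 1 / (2 * real (card (cut F)))) \<le> (\<Sum>F\<in>biforests. 2 * \<rho>)"
      by (rule sum_mono)
    then show ?thesis
      unfolding L_def sratio_def using tau_pos by (simp add: field_simps)
  qed
  have D_div: "c / ?N < D / ?N\<^sup>2" if "c * ?N < D" for c
  proof -
    have "c * ?N / ?N\<^sup>2 < D / ?N\<^sup>2" using that N0 by (intro divide_strict_right_mono) auto
    then show ?thesis using N0 by (simp add: power2_eq_square)
  qed
  have D1: "D / ?N\<^sup>2 > (1 / 4 + e) / ?N" using D by (rule D_div)
  \<comment> \<open>In (rho), (S) and (D) a surplus pays for the crude loss \<open>L1\<close>; only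
    (main) uses \<open>sum_inverse_cut\<close>.\<close>
  consider (big) "?S \<ge> 7 / 10"
    | (rho) "?S < 7 / 10" "\<rho> \<ge> 2 / ?N"
    | (S) "?S < 7 / 10" "\<rho> < 2 / ?N" "?S \<ge> 1 / 2 + e / 8"
    | (D) "?S < 1 / 2 + e / 8" "\<rho> < 2 / ?N" "(1 + e) * ?N < D"
    | (main) "?S < 1 / 2 + e / 8" "\<rho> < 2 / ?N" "D \<le> (1 + e) * ?N"
    using e by linarith
  then show ?thesis
  proof cases
    case big
    then show ?thesis using ratio_ge_sratio by simp
  next
    case rho
    \<comment> \<open>A gain of 3 rho against a loss of at most 7/5 rho leaves 8/5 rho, which is at
      least 16 / (5 N).\<close>
    then have "\<rho> * ?S \<le> \<rho> * (7 / 10)" using rho0 by (intro mult_left_mono) auto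
    moreover have "0 < (1 / 4 + e) / ?N" using e N0 by (intro divide_pos_pos) auto
    ultimately have "?S - L \<ge> 1 / 2 - 1 / (2 * ?N) + 8 / 5 * \<rho>"
      using S L1 D1 by linarith
    moreover have "8 / 5 * \<rho> \<ge> 16 / 5 / ?N" using rho(2) by simp
    moreover have "1 / 2 - 1 / (2 * ?N) + 16 / 5 / ?N = 1 / 2 + (27 / 10) / ?N" by (simp add: field_simps)
    moreover have "(5 / 2 + e / 4) / ?N < (27 / 10) / ?N" using e N0 by (intro divide_strict_right_mono) auto
    ultimately have "1 / 2 + (5 / 2 + e / 4) / ?N < ?S - L" by linarith
    then show ?thesis by (rule conclude)
  next
    case S
    \<comment> \<open>The loss is of order 1/N, whereas the surplus e / 8 is constant.\<close>
    have "L \<le> (2 * \<rho>) * (7 / 10)"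
      using L1 S rho0 mult_left_mono[of ?S "7 / 10" "2 * \<rho>"] by linarith
    also have "\<dots> \<le> (14 / 5) / ?N" using S(2) by simp
    finally have L2: "L \<le> (14 / 5) / ?N" .
    have "(14 / 5) / ?N + (5 / 2 + e / 4) / ?N = (14 / 5 + (5 / 2 + e / 4)) / ?N"
      by (rule add_divide_distrib[symmetric])
    also have "\<dots> < e / 8"
      using eN' e N0 by (simp add: pos_divide_less_eq algebra_simps)
    finally have "1 / 2 + (5 / 2 + e / 4) / ?N < ?S - L" using S L2 by linarith
    then show ?thesis by (rule conclude)
  next
    case D
    \<comment> \<open>With S near 1/2 the crude loss is about rho. What remains is about 2/N from
      rho, - 1/(2N), and more than (1 + e)/N from D, in total about (5/2 + e)/N.\<close>
    have "L \<le> (2 * \<rho>) * (1 / 2 + e / 8)"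
      using L1 D rho0 mult_left_mono[of ?S "1 / 2 + e / 8" "2 * \<rho>"] by linarith
    then have "?S - L \<ge> 1 / 2 - 1 / (2 * ?N) + D / ?N\<^sup>2 + (2 - e / 4) * \<rho>"
      using S by (simp add: algebra_simps)
    moreover have "(2 - e / 4) * \<rho> \<ge> (2 - e / 4) * ((?N - 1) / ?N\<^sup>2)"
      using rho e by (intro mult_left_mono) auto
    moreover have "D / ?N\<^sup>2 > (1 + e) / ?N" using D(3) by (rule D_div)
    moreover have "1 / 2 - 1 / (2 * ?N) + (1 + e) / ?N + (2 - e / 4) * ((?N - 1) / ?N\<^sup>2)
        > 1 / 2 + (5 / 2 + e / 4) / ?N"
    proof -
      have "(2 - e / 4) / ?N < e / 2" using eN' e N0 by (simp add: pos_divide_less_eq algebra_simps)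
      then have "(2 - e / 4) / ?N / ?N < e / 2 / ?N" using N0 by (intro divide_strict_right_mono) auto
      moreover have "1 / 2 - 1 / (2 * ?N) + (1 + e) / ?N + (2 - e / 4) * ((?N - 1) / ?N\<^sup>2)
          - (1 / 2 + (5 / 2 + e / 4) / ?N) = e / 2 / ?N - (2 - e / 4) / ?N / ?N"
        using N0 by (simp add: power2_eq_square field_simps)
      ultimately show ?thesis by linarith
    qed
    ultimately have "1 / 2 + (5 / 2 + e / 4) / ?N < ?S - L" by linarith
    then show ?thesis by (rule conclude)
  next
    case main
    \<comment> \<open>The threshold keeps c0 + D at most (2 - e/2) N, below the 2 (N - 2) of
      \<open>sum_inverse_cut\<close>; \<open>?k\<close> comes from 4 rho < 8/N.\<close>
    let ?c0 = "(1 - 3 / 2 * e) * ?N" and ?k = "8 / ?N"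
    let ?X = "{x \<in> V. real (card (nb x)) \<le> ?c0}"
    have c0: "?c0 > 0" using e N0 by simp
    have k: "1 \<le> ?k * real (card (cut F))" if "F \<in> biforests" for F
    proof -
      have "4 * \<rho> * real (card (cut F)) \<le> ?k * real (card (cut F))"
        using main(2) by (intro mult_right_mono) auto
      then show ?thesis using cut_rho(1)[OF r that] by (simp add: \<rho>_def)
    qed
    have c0D: "?c0 + real (card (complete_edges V - E)) \<le> 2 * (?N - 2)"
      using main(3) eN' unfolding D_def[symmetric] by (simp add: algebra_simps)
    \<comment> \<open>At most 22/10 N missing edge ends, at least 11/15 N e of them at each vertex
      counted: the quotient is 3/e.\<close>
    have X: "real (card ?X) \<le> 3 / e"
    proof -
      have "real (card ?X) * (?N - 1 - ?c0) \<le> 2 * D"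
        unfolding D_def by (rule card_low_degree) auto
      also have "\<dots> \<le> 22 / 10 * ?N"
      proof -
        have "(1 + e) * ?N \<le> 11 / 10 * ?N" using e N0 by (intro mult_right_mono) auto
        then show ?thesis using main(3) by linarith
      qed
      finally have 1: "real (card ?X) * (?N - 1 - ?c0) \<le> 22 / 10 * ?N" .
      have "?N * e * (11 / 15) \<le> ?N - 1 - ?c0" using eN' by (simp add: algebra_simps)
      then have "real (card ?X) * (?N * e * (11 / 15)) \<le> real (card ?X) * (?N - 1 - ?c0)"
        by (intro mult_left_mono) auto
      with 1 have "real (card ?X) * (?N * e * (11 / 15)) \<le> 22 / 10 * ?N" by linarith
      then have "?N * (real (card ?X) * e) \<le> ?N * 3" by (simp add: mult_ac)
      then have "real (card ?X) * e \<le> 3" using N0 by simp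
      then show ?thesis using e by (simp add: pos_le_divide_eq)
    qed
    have "?k > 0" using N0 by simp
    from sum_inverse_cut[OF this k c0 c0D n2]
    have "L \<le> ?S / (2 * ?c0) + real (card ?X) * ?k\<^sup>2 / 2" by (simp only: L_def)
    moreover have "?S / (2 * ?c0) \<le> (1 / 4 + 11 / 20 * e) / ?N"
    proof -
      have "?S / (2 * ?c0) \<le> (1 / 2 + e / 8) / (2 * ?c0)"
        using main(1) c0 by (intro divide_right_mono) auto
      also have "\<dots> \<le> (1 / 4 + 11 / 20 * e) / ?N"
      proof -
        \<comment> \<open>11/20 exceeds the first-order coefficient 1/16 + 3/8 = 7/16 of e, which
          leaves room for e^2, and the final comparison keeps e - 11/20 e - e/4 = e/5.\<close>
        have "(1 / 4 + 11 / 20 * e) * (2 * (1 - 3 / 2 * e)) = 1 / 2 + 7 / 20 * e - 33 / 20 * e\<^sup>2"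
          by (simp add: power2_eq_square field_simps)
        then have "1 / 2 + e / 8 \<le> (1 / 4 + 11 / 20 * e) * (2 * (1 - 3 / 2 * e))"
          using e e2 by linarith
        then have "(1 / 2 + e / 8) / (2 * ?c0)
            \<le> (1 / 4 + 11 / 20 * e) * (2 * (1 - 3 / 2 * e)) / (2 * ?c0)"
          using c0 by (intro divide_right_mono) auto
        also have "\<dots> = (1 / 4 + 11 / 20 * e) / ?N"
        proof -
          have cancel: "K * (2 * s) / (2 * (s * t)) = K / t" if "s \<noteq> 0" for K s t :: real
            using that by simp
          show ?thesis by (rule cancel) (use e in auto)
        qed
        finally show ?thesis .
      qed
      finally show ?thesis .
    qed
    moreover have "real (card ?X) * ?k\<^sup>2 / 2 \<le> 96 / e / ?N\<^sup>2"
    proof -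
      have "real (card ?X) * ?k\<^sup>2 / 2 \<le> 3 / e * ?k\<^sup>2 / 2"
        using X by (intro divide_right_mono mult_right_mono) auto
      then show ?thesis by (simp add: power_divide)
    qed
    ultimately have L3: "L \<le> (1 / 4 + 11 / 20 * e) / ?N + 96 / e / ?N\<^sup>2" by linarith
    have "1 / 2 + (5 / 2 + e / 4) / ?N
        \<le> 1 / 2 - 1 / (2 * ?N) + (1 / 4 + e) / ?N + 3 * ((?N - 1) / ?N\<^sup>2)
          - ((1 / 4 + 11 / 20 * e) / ?N + 96 / e / ?N\<^sup>2)"
    proof -
      \<comment> \<open>Origin of the constant 500: the error 100/e must be at most e N / 5.\<close>
      have "3 + 96 / e \<le> 100 / e" using e by (simp add: field_simps)
      also have "\<dots> \<le> e / 5 * ?N" using eN e by (simp add: pos_divide_le_eq power2_eq_square mult_ac)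
      finally have "3 + 96 / e \<le> e / 5 * ?N" .
      moreover have "0 < ?N\<^sup>2" using N0 by simp
      ultimately have "(3 + 96 / e) / ?N\<^sup>2 \<le> e / 5 * ?N / ?N\<^sup>2" by (intro divide_right_mono) auto
      also have "\<dots> = e / 5 / ?N" using N0 by (simp add: power2_eq_square)
      finally have "(3 + 96 / e) / ?N\<^sup>2 \<le> e / 5 / ?N" .
      moreover have "1 / 2 - 1 / (2 * ?N) + (1 / 4 + e) / ?N + 3 * ((?N - 1) / ?N\<^sup>2)
          - ((1 / 4 + 11 / 20 * e) / ?N + 96 / e / ?N\<^sup>2) - (1 / 2 + (5 / 2 + e / 4) / ?N)
        = e / 5 / ?N - (3 + 96 / e) / ?N\<^sup>2"
        using N0 e by (simp add: power2_eq_square field_simps)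
      ultimately show ?thesis by linarith
    qed
    then have "1 / 2 + (5 / 2 + e / 4) / ?N < ?S - L" using S L3 D1 rho by linarith
    then show ?thesis by (rule conclude)
  qed
qed

end

section \<open>Comparison with the complete graph\<close>

lemma exp_half_less: "exp (1 / 2 :: real) < 17 / 10"
proof (rule ccontr)
  assume "\<not> ?thesis"
  then have "(17 / 10)\<^sup>2 \<le> (exp (1 / 2 :: real))\<^sup>2" by (intro power_mono) auto
  also have "\<dots> = exp 1" by (simp add: power2_eq_square flip: exp_add)
  finally show False using e_less_272 by (simp add: power2_eq_square)
qed

theorem theorem1p3:
  fixes \<epsilon> :: real
  assumes "\<epsilon> > 0"
  shows "\<exists>n0 :: nat. \<forall>n \<ge> n0. \<forall>(V :: 'a set) (E :: 'a set set).
    simple_graph V E \<and> connected_graph V E \<and> card V = n \<and>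
    real (card E) < real (n choose 2) - (1 / 4 + \<epsilon>) * real n \<longrightarrow>
    forest_tree_ratio V E > forest_tree_ratio {..<n} (complete_edges {..<n})"
proof -
  \<comment> \<open>\<open>ratio_lower\<close> asks for e at most 1/10; the edge bound for the given
    epsilon implies the one for any smaller value.\<close>
  define e where "e = min \<epsilon> (1 / 10)"
  have e: "0 < e" "e \<le> 1 / 10" "e \<le> \<epsilon>" using assms by (auto simp: e_def)
  have "(\<lambda>n. exp (1 / 2 + (5 / 2 + e / 4) / real n)) \<longlonglongrightarrow> exp (1 / 2 + 0)"
    by (intro tendsto_intros lim_const_over_n)
  then have "\<forall>\<^sub>F n in sequentially. exp (1 / 2 + (5 / 2 + e / 4) / real n) < 17 / 10"
    using exp_half_less by (intro order_tendstoD(2)) auto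
  moreover have "\<forall>\<^sub>F n in sequentially. forest_tree_ratio {..<n} (complete_edges {..<n})
      \<le> exp (1 / 2 + (5 / 2 + e / 4) / real n)"
    using e by (intro forest_tree_ratio_complete_upper) simp
  moreover have "\<forall>\<^sub>F n in sequentially. 500 / e\<^sup>2 \<le> real n"
    using filterlim_real_sequentially by (rule filterlim_at_top[THEN iffD1, rule_format])
  ultimately have "\<forall>\<^sub>F n in sequentially. \<forall>(V :: 'a set) (E :: 'a set set).
    simple_graph V E \<and> connected_graph V E \<and> card V = n \<and>
    real (card E) < real (n choose 2) - (1 / 4 + \<epsilon>) * real n \<longrightarrow>
    forest_tree_ratio V E > forest_tree_ratio {..<n} (complete_edges {..<n})"
  proof eventually_elim
    case (elim n)
    show ?case
    proof (intro allI impI, elim conjE)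
      fix V :: "'a set" and E :: "'a set set"
      assume G: "simple_graph V E" "connected_graph V E" "card V = n"
        and m: "real (card E) < real (n choose 2) - (1 / 4 + \<epsilon>) * real n"
      interpret conn_graph V E
        using G by unfold_locales (auto simp: simple_graph_def complete_edges_def)
      have "(1 / 4 + e) * real n \<le> (1 / 4 + \<epsilon>) * real n" using e by (intro mult_right_mono) auto
      then have "real (card E) < real (card V choose 2) - (1 / 4 + e) * real (card V)"
        using m G(3) by simp
      from ratio_lower[OF e(1,2) _ this] elim(3) G(3)
      have "17 / 10 \<le> forest_tree_ratio V E \<or>
          exp (1 / 2 + (5 / 2 + e / 4) / real n) < forest_tree_ratio V E"
        by simp
      then show "forest_tree_ratio {..<n} (complete_edges {..<n}) < forest_tree_ratio V E"
        using elim(1,2) by linarith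
    qed
  qed
  then show ?thesis by (simp add: eventually_sequentially)
qed

end
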